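(* Suppose the Wonham filter is stable, meaning: for all $\mu,\nu\in\mathcal P(\mathbb S)$ with $\mu\ll\nu$ and every $f\in\mathbb R^d$, $$\mathsf E^\mu\big(|\pi_t^\mu(f)-\pi_t^\nu(f)|^2\big)\to 0\quad\text{as } t\to\infty.$$ Then the BSDE $$-\mathrm dY_t(x)=\big((AY_t)(x)+h(x)U_t+h(x)V_t(x)\big)\mathrm dt-V_t(x)\,\mathrm dZ_t,\qquad Y_T=f,$$ is stabilizable. Conversely, if this BSDE is stabilizable, then for all $\mu,\nu\in\mathcal P(\mathbb S)$ with $\mu\ll\nu$ and every $k=1,\dots,m$, $$\pi_T^\nu(\mathsf 1_{\mathbb S_k})\longrightarrow \mathsf 1_{\mathbb S_k}(X_0)\quad \text{as }T\to\infty,\quad \mathsf P^\mu\text{-a.s.}$$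
   Context: Let $\mathbb S=\{1,\dots,d\}$. Functions $f:\mathbb S\to\mathbb R$ are identified with vectors in $\mathbb R^d$. $\mathsf 1$ denotes the all-ones vector and $\mathsf 1_D$ the indicator of $D\subset\mathbb S$. For $f,g\in\mathbb R^d$, $fg$ denotes the entrywise product. $\mathcal P(\mathbb S)$ denotes the set of probability vectors on $\mathbb S$, and for $\mu\in\mathcal P(\mathbb S)$ we write $\mu(f)=\sum_x\mu(x)f(x)$. $X=\{X_t\}_{t\ge0}$ is a continuous-time Markov chain on $\mathbb S$ with rate matrix $A\in\mathbb R^{d\times d}$: off-diagonal entries are nonnegative, rows sum to zero, and $(Af)(x)=\sum_jA(x,j)f(j)$. The set $\mathbb S$ is partitioned into ergodic classes, $\mathbb S=\bigcup_{k=1}^m\mathbb S_k$, where each $\mathbb S_k$ is a closed irreducible class; in particular $\mathsf P(X_t\in\mathbb S_l\mid X_0\in\mathbb S_k)=0$ for $l\ne k$. The observation process is $Z_t=\int_0^th(X_s)\,\mathrm ds+W_t$, where $h\in\mathbb R^d$ and $W$ is a scalar Brownian motion with variance $R>0$, independent of $X$. Let $\mathcal Z_t=\sigma(Z_s:s\le t)$. $\mathsf P^\mu$ (with expectation $\mathsf E^\mu$) denotes the law under which $X_0\sim\mu$. When $\mu\ll\nu$, $\mathsf P^\mu$ and $\mathsf P^\nu$ live on a common space with $\mathrm d\mathsf P^\mu/\mathrm d\mathsf P^\nu=\mu(X_0)/\nu(X_0)$, so $(X,Z)$ has the same transition law under both. Define $\pi_t^\nu(f):=\mathsf E^\nu(f(X_t)\mid\mathcal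 Z_t)$; equivalently, $\pi^\nu$ solves the Wonham filter $$\mathrm d\pi_t=A^\top\pi_t\,\mathrm dt+(\mathrm{diag}(h)-\pi_th^\top)\pi_tR^{-1}(\mathrm dZ_t-\pi_t(h)\,\mathrm dt),\qquad \pi_0=\nu.$$ Admissible controls $U$ are real-valued $\mathcal Z$-adapted processes on $[0,T]$ with $\mathsf E\int_0^TU_t^2\,\mathrm dt<\infty$. The solution $(Y,V)$ of the BSDE is $\mathcal Z$-adapted, square-integrable, and $\mathbb R^d\times\mathbb R^d$-valued. The controllable subspace $\mathcal C$ is the set of $y_0\in\mathbb R^d$ for which there exist a deterministic $c\in\mathbb R$ and an admissible $U$ such that the BSDE solution with $Y_T=c\mathsf 1$ satisfies $Y_0=y_0$. Equivalently (by a known result, for every $T>0$), $\mathcal C$ is the smallest subspace of $\mathbb R^d$ containing $\mathsf 1$ and closed under the maps $g\mapsto Ag$ and $g\mapsto gh$. Since $\mathcal C$ is $A$-invariant, $A$ induces a linear map $\bar A_{uc}$ on the quotient $\mathbb R^d/\mathcal C$; in an orthonormal basis adapted to $\mathcal C\oplus\mathcal C^\perp$, $A$ is block upper triangular and $\bar A_{uc}$ is its lower-right block. The BSDE is stabilizable if either $\mathcal C=\mathbb R^d$, or $\mathcal C\ne\mathbb R^d$ and $\bar A_{uc}$ is Hurwitz (all eigenvalues have negative real part). *)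

theory Defs
  imports "HOL-Analysis.Analysis" "HOL-Probability.Probability"
begin

section \<open>Linear-algebraic part: controllable subspace and stabilizability\<close>

definition rate_matrix :: "real^'n^'n \<Rightarrow> bool" where
  "rate_matrix A \<longleftrightarrow> (\<forall>i j. i \<noteq> j \<longrightarrow> 0 \<le> A$i$j) \<and> (\<forall>i. (\<Sum>j\<in>UNIV. A$i$j) = 0)"

text \<open>A closed irreducible (ergodic) class of the chain with rate matrix A.\<close>
definition ergodic_class :: "real^'n^'n \<Rightarrow> 'n set \<Rightarrow> bool" where
  "ergodic_class A D \<longleftrightarrow> D \<noteq> {} \<and>
     (\<forall>x\<in>D. \<forall>j. j \<notin> D \<longrightarrow> A$x$j = 0) \<and>
     (\<forall>x\<in>D. \<forall>y\<in>D. (x, y) \<in> {(i, j). i \<noteq> j \<and> 0 < A$i$j}\<^sup>*)"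

text \<open>Controllable subspace: smallest subspace containing the all-ones vector,
  closed under g |-> A g and g |-> g h (entrywise product).\<close>
definition ctrl_subspace :: "real^'n^'n \<Rightarrow> real^'n \<Rightarrow> (real^'n) set" where
  "ctrl_subspace A h = \<Inter>{V. subspace V \<and> (1::real^'n) \<in> V \<and>
        (\<forall>g\<in>V. A *v g \<in> V \<and> g * h \<in> V)}"

text \<open>(a + i b) is an eigenvalue of the linear map induced by A on the (complexified)
  quotient space R^d / C: there is a complex vector u + i w whose class modulo C is nonzero
  and with (A - (a + i b)) (u + i w) in the complexification of C.\<close>
definition quotient_eigenvalue :: "real^'n^'n \<Rightarrow> (real^'n) set \<Rightarrow> real \<Rightarrow> real \<Rightarrow> bool" where
  "quotient_eigenvalue A C a b \<longleftrightarrow> (\<exists>u w. \<not> (u \<in> C \<and> w \<in> C) \<and>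
      A *v u - a *\<^sub>R u + b *\<^sub>R w \<in> C \<and> A *v w - a *\<^sub>R w - b *\<^sub>R u \<in> C)"

definition stabilizable :: "real^'n^'n \<Rightarrow> real^'n \<Rightarrow> bool" where
  "stabilizable A h \<longleftrightarrow> ctrl_subspace A h = UNIV \<or>
     (ctrl_subspace A h \<noteq> UNIV \<and>
      (\<forall>a b. quotient_eigenvalue A (ctrl_subspace A h) a b \<longrightarrow> a < 0))"

section \<open>Probabilistic model\<close>

fun matpow :: "real^'n^'n \<Rightarrow> nat \<Rightarrow> real^'n^'n" where
  "matpow A 0 = mat 1"
| "matpow A (Suc k) = A ** matpow A k"

text \<open>Transition matrix exp(t A).\<close>
definition trans_mat :: "real^'n^'n \<Rightarrow> real \<Rightarrow> real^'n^'n" where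
  "trans_mat A t = (\<Sum>k. (t ^ k / fact k) *\<^sub>R matpow A k)"

text \<open>sigma-algebra on the space of M generated by a family of maps into N.\<close>
definition gen_sigma :: "'w measure \<Rightarrow> ('w \<Rightarrow> 'b) set \<Rightarrow> 'b measure \<Rightarrow> 'w measure" where
  "gen_sigma M fs N = sigma (space M) (\<Union>f\<in>fs. {f -` B \<inter> space M | B. B \<in> sets N})"

definition obs :: "real^'n \<Rightarrow> (real \<Rightarrow> 'w \<Rightarrow> 'n) \<Rightarrow> (real \<Rightarrow> 'w \<Rightarrow> real) \<Rightarrow> real \<Rightarrow> 'w \<Rightarrow> real" where
  "obs h X W t \<omega> = (LINT s:{0..t}|lborel. h $ X s \<omega>) + W t \<omega>"

text \<open>Reference model: under M, X is a CTMC with rate matrix A started from the uniform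
  distribution, W is a Brownian motion with variance R (W_0 = 0, continuous paths,
  independent Gaussian increments), and X and W are independent.\<close>
definition wonham_model :: "'w measure \<Rightarrow> real^'n^'n \<Rightarrow> real \<Rightarrow>
    (real \<Rightarrow> 'w \<Rightarrow> 'n) \<Rightarrow> (real \<Rightarrow> 'w \<Rightarrow> real) \<Rightarrow> bool" where
  "wonham_model M A R X W \<longleftrightarrow>
     prob_space M \<and>
     (\<lambda>(t, \<omega>). X t \<omega>) \<in> measurable (lborel \<Otimes>\<^sub>M M) (count_space UNIV) \<and>
     (\<forall>t. W t \<in> borel_measurable M) \<and>
     (\<forall>x. prob_space.prob M {\<omega> \<in> space M. X 0 \<omega> = x} = 1 / real CARD('n)) \<and>
     (\<forall>s t j. 0 \<le> s \<longrightarrow> s \<le> t \<longrightarrow>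
        (AE \<omega> in M. real_cond_exp M (gen_sigma M ((\<lambda>r. X r) ` {0..s}) (count_space UNIV))
            (\<lambda>\<omega>. if X t \<omega> = j then 1 else 0) \<omega> = trans_mat A (t - s) $ X s \<omega> $ j)) \<and>
     (\<forall>\<omega>\<in>space M. W 0 \<omega> = 0 \<and> continuous_on {0..} (\<lambda>t. W t \<omega>)) \<and>
     (\<forall>s t. 0 \<le> s \<longrightarrow> s < t \<longrightarrow>
        prob_space.indep_set M (sets (gen_sigma M ((\<lambda>r. W r) ` {0..s}) borel))
            (sets (gen_sigma M {\<lambda>\<omega>. W t \<omega> - W s \<omega>} borel)) \<and>
        distributed M lborel (\<lambda>\<omega>. W t \<omega> - W s \<omega>)
            (\<lambda>x. ennreal (normal_density 0 (sqrt (R * (t - s))) x))) \<and>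
     prob_space.indep_set M (sets (gen_sigma M (range X) (count_space UNIV)))
        (sets (gen_sigma M (range W) borel))"

definition prob_vec :: "real^'n \<Rightarrow> bool" where
  "prob_vec \<mu> \<longleftrightarrow> (\<forall>x. 0 \<le> \<mu>$x) \<and> (\<Sum>x\<in>UNIV. \<mu>$x) = 1"

definition abs_cont :: "real^'n \<Rightarrow> real^'n \<Rightarrow> bool" where
  "abs_cont \<mu> \<nu> \<longleftrightarrow> (\<forall>x. \<nu>$x = 0 \<longrightarrow> \<mu>$x = 0)"

text \<open>P^mu: law with X_0 ~ mu, obtained by reweighting the reference law by mu(X_0)/unif(X_0).\<close>
definition Pmu :: "'w measure \<Rightarrow> (real \<Rightarrow> 'w \<Rightarrow> 'n::finite) \<Rightarrow> real^'n \<Rightarrow> 'w measure" where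
  "Pmu M X \<mu> = density M (\<lambda>\<omega>. ennreal (real CARD('n) * \<mu> $ X 0 \<omega>))"

text \<open>Observation sigma-algebra Z_t = sigma(Z_s : 0 <= s <= t).\<close>
definition obs_sigma :: "'w measure \<Rightarrow> real^'n \<Rightarrow> (real \<Rightarrow> 'w \<Rightarrow> 'n) \<Rightarrow> (real \<Rightarrow> 'w \<Rightarrow> real)
    \<Rightarrow> real \<Rightarrow> 'w measure" where
  "obs_sigma M h X W t = gen_sigma M ((\<lambda>s. obs h X W s) ` {0..t}) borel"

text \<open>pi_t^mu(f) = E^mu( f(X_t) | Z_t ).\<close>
definition filt :: "'w measure \<Rightarrow> real^'n \<Rightarrow> (real \<Rightarrow> 'w \<Rightarrow> 'n::finite) \<Rightarrow> (real \<Rightarrow> 'w \<Rightarrow> real)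
    \<Rightarrow> real^'n \<Rightarrow> real \<Rightarrow> real^'n \<Rightarrow> 'w \<Rightarrow> real" where
  "filt M h X W \<mu> t f = real_cond_exp (Pmu M X \<mu>) (obs_sigma M h X W t) (\<lambda>\<omega>. f $ X t \<omega>)"

definition filter_stable :: "'w measure \<Rightarrow> real^'n \<Rightarrow> (real \<Rightarrow> 'w \<Rightarrow> 'n::finite)
    \<Rightarrow> (real \<Rightarrow> 'w \<Rightarrow> real) \<Rightarrow> bool" where
  "filter_stable M h X W \<longleftrightarrow> (\<forall>\<mu> \<nu> f. prob_vec \<mu> \<longrightarrow> prob_vec \<nu> \<longrightarrow> abs_cont \<mu> \<nu> \<longrightarrow>
     ((\<lambda>t. \<integral>\<omega>. (filt M h X W \<mu> t f \<omega> - filt M h X W \<nu> t f \<omega>)\<^sup>2 \<partial>(Pmu M X \<mu>)) \<longlongrightarrow> 0) at_top)"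

end

theory Submission
  imports Defs
begin

text \<open>
  Stability implies stabilizability: if \<open>\<rho>\<close> annihilates the controllable subspace, then weighting the
  reference law by \<open>\<rho>(X\<^sub>0)\<close> gives a signed measure that vanishes on all observation events, because the
  finite-dimensional distributions of \<open>h(X)\<close> only involve words in \<open>exp (tA)\<close> and multiplications by
  functions of \<open>h\<close>. For \<open>\<mu> = \<nu> + \<epsilon>\<rho>\<close> with \<open>\<nu>\<close> uniform, the mean of \<open>\<pi>\<^sup>\<mu>\<^sub>t(f) - \<pi>\<^sup>\<nu>\<^sub>t(f)\<close> is therefore
  \<open>\<epsilon> \<rho>(exp (tA) f)\<close>, which tends to \<open>0\<close> by stability; an eigenvalue of the quotient map with nonnegative
  real part would contradict this.

  Stabilizability implies identification of the class: \<open>1\<^sub>D\<close> lies in the kernel of \<open>A\<close>, hence in the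
  controllable subspace. Every \<open>g\<close> in that subspace is the conditional mean, given the past of time \<open>s\<close>
  and up to a small error, of a bounded statistic of the observation shortly after \<open>s\<close>: products of sines
  of small observation increments produce the multiplications by \<open>h\<close>, and time shifts produce
  \<open>exp (\<delta>A)\<close>. As \<open>1\<^sub>D(X\<^sub>s)\<close> does not depend on \<open>s\<close>, averaging these statistics over disjoint time blocks
  approximates \<open>1\<^sub>D(X\<^sub>0)\<close> in \<open>L\<^sup>1\<close>. The weak type maximal inequality for conditional expectations upgrades this
  to almost sure convergence of the filter along rational times, and continuity to all times.
\<close>

section \<open>Matrix exponential and controllable subspace\<close>

text \<open>No path regularity of \<open>X\<close> is available, only joint measurability, and this
  shapes much of the work. The integral \<open>I t\<close> need not be measurable for the past of
  the signal, only almost everywhere equal to a function that is, so the signal sigma-algebras are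
  enlarged by \<open>ae_augment\<close>; and moves of the signal within a short window are
  controlled by stochastic continuity, uniformly in the starting time. The sine is there because
  estimators have to be bounded: they are multiplied with each other and with arbitrary bounded test
  factors. It is linear to first order, and its addition theorem separates signal from noise. An
  estimator is demanded at every \<open>s\<close> with one common window and one error bound. This
  lets the estimator of \<open>g\<close> be started after the window that produces the factor
  \<open>h\<close>, and later be repeated over blocks. \<open>L^1\<close> closeness at single times
  would give convergence in probability only. The maximal inequality applies because g(X_0) does not
  move, so that the filters at all times are conditional expectations of one fixed variable.\<close>

lemma matpow_Suc_mv: "matpow A (Suc k) *v v = A *v (matpow A k *v v)"
  by (simp add: matrix_vector_mul_assoc)

lemma matpow_Suc_mv': "matpow A (Suc k) *v v = matpow A k *v (A *v v)"
proof -
  have "matpow A k ** A = A ** matpow A k"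
    by (induction k) (simp_all add: matrix_mul_assoc, metis matrix_mul_assoc)
  then show ?thesis
    by (simp add: matrix_vector_mul_assoc)
qed

text \<open>The constant \<open>K\<close> bounds left multiplication by \<open>A\<close>, so the
  norm of \<open>matpow A k\<close> is at most a multiple of \<open>K ^ k\<close>, and the
  exponential series of |t| K dominates.\<close>

lemma summable_trans_mat:
  fixes A :: "real^'n::finite^'n"
  shows "summable (\<lambda>k. (t ^ k / fact k) *\<^sub>R matpow A k)"
proof -
  have "linear (\<lambda>B::real^'n^'n. A ** B)"
    by (rule linearI)
      (rule matrix_add_ldistrib, simp add: matrix_matrix_mult_def vec_eq_iff sum_distrib_left mult.left_commute)
  from linear_bounded_pos[OF this] obtain K where K: "K > 0" "\<And>B::real^'n^'n. norm (A ** B) \<le> K * norm B"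
    by blast
  have b: "norm (matpow A k) \<le> K ^ k * norm (mat 1 :: real^'n^'n)" for k
  proof (induction k)
    case (Suc k)
    have "norm (matpow A (Suc k)) \<le> K * norm (matpow A k)" using K by simp
    also have "\<dots> \<le> K * (K ^ k * norm (mat 1 :: real^'n^'n))" using Suc K by simp
    finally show ?case by (simp add: mult.assoc)
  qed simp
  have "summable (\<lambda>k. inverse (fact k) * (\<bar>t\<bar> * K) ^ k * norm (mat 1 :: real^'n^'n))"
    by (intro summable_mult2 summable_exp)
  then show ?thesis
  proof (rule summable_comparison_test'[where N=0])
    fix k
    have "norm ((t ^ k / fact k) *\<^sub>R matpow A k) = \<bar>t\<bar> ^ k / fact k * norm (matpow A k)"
      by (simp add: power_abs)
    also have "\<dots> \<le> \<bar>t\<bar> ^ k / fact k * (K ^ k * norm (mat 1 :: real^'n^'n))"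
      by (intro mult_left_mono b) auto
    finally show "norm ((t ^ k / fact k) *\<^sub>R matpow A k)
        \<le> inverse (fact k) * (\<bar>t\<bar> * K) ^ k * norm (mat 1 :: real^'n^'n)"
      by (simp add: field_simps power_mult_distrib)
  qed
qed

text \<open>The values at time 0 and on the kernel, the derivative, and the invariance of subspaces
  are all read off this series of vectors.\<close>

lemma trans_mat_sums:
  fixes A :: "real^'n::finite^'n"
  shows "(\<lambda>k. (t ^ k / fact k) *\<^sub>R (matpow A k *v v)) sums (trans_mat A t *v v)"
proof -
  have "linear (\<lambda>P::real^'n^'n. P *v v)"
    by (rule linearI) (simp_all add: matrix_vector_mult_add_rdistrib scaleR_matrix_vector_assoc)
  then have bl: "bounded_linear (\<lambda>P::real^'n^'n. P *v v)" by (rule linear_conv_bounded_linear[THEN iffD1])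
  have "(\<lambda>k. (t ^ k / fact k) *\<^sub>R matpow A k) sums trans_mat A t"
    unfolding trans_mat_def by (rule summable_sums[OF summable_trans_mat])
  from bounded_linear.sums[OF bl this] show ?thesis
    by (simp add: scaleR_matrix_vector_assoc)
qed

lemma trans_mat_0_mv [simp]: "trans_mat A 0 *v (v::real^'n::finite) = v"
proof -
  have "(\<lambda>k. (0 ^ k / fact k) *\<^sub>R (matpow A k *v v)) sums v"
    using sums_single[of 0 "\<lambda>k. v"]
    by (rule back_subst[where P = "\<lambda>f. f sums v"]) (auto simp: fun_eq_iff)
  then show ?thesis using trans_mat_sums[of 0 A v] sums_unique2 by blast
qed

lemma trans_mat_kernel_mv:
  assumes "A *v v = 0" shows "trans_mat A t *v (v::real^'n::finite) = v"
proof -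
  have "matpow A k *v v = (if k = 0 then v else 0)" for k
    by (cases k) (simp_all add: matpow_Suc_mv' assms del: matpow.simps(2))
  then have "(\<lambda>k. (t ^ k / fact k) *\<^sub>R (matpow A k *v v)) = (\<lambda>k. if k = 0 then v else 0)"
    by (auto simp: fun_eq_iff)
  then have "(\<lambda>k. (t ^ k / fact k) *\<^sub>R (matpow A k *v v)) sums v"
    using sums_single[of 0 "\<lambda>k. v"] by simp
  then show ?thesis using trans_mat_sums[of t A v] sums_unique2 by blast
qed

text \<open>Through a fixed functional \<open>L\<close> the semigroup becomes a scalar power series
  converging everywhere; \<open>diffs\<close> shifts its coefficients, which amounts to replacing
  \<open>v\<close> by \<open>A *v v\<close>.\<close>

lemma trans_mat_has_real_derivative:
  fixes A :: "real^'n::finite^'n"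
  assumes "bounded_linear L"
  shows "((\<lambda>t. L (trans_mat A t *v v)) has_real_derivative L (trans_mat A t *v (A *v v))) (at t)"
proof -
  define c where "c v k = L (matpow A k *v v) / fact k" for v k
  have s: "(\<lambda>k. c v k * t ^ k) sums L (trans_mat A t *v v)" for v t
    using bounded_linear.sums[OF assms trans_mat_sums[of t A v]]
    by (simp add: c_def linear_simps[OF assms] mult.commute)
  have "diffs (c v) k = c (A *v v) k" for k
    by (simp add: diffs_def c_def matpow_Suc_mv' divide_simps del: matpow.simps(2))
  then have d: "diffs (c v) = c (A *v v)" by auto
  have "((\<lambda>t. \<Sum>k. c v k * t ^ k) has_field_derivative (\<Sum>k. diffs (c v) k * t ^ k)) (at t)"
    by (rule termdiffs_strong_converges_everywhere) (use s in \<open>auto simp: sums_iff\<close>)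
  moreover have "(\<Sum>k. c v k * t ^ k) = L (trans_mat A t *v v)" for v t
    using s sums_unique by metis
  ultimately show ?thesis unfolding d by simp
qed

lemma trans_mat_nth_tendsto_0:
  fixes A :: "real^'n::finite^'n"
  shows "((\<lambda>t. (trans_mat A t *v v) $ i) \<longlongrightarrow> v $ i) (at 0)"
  using DERIV_isCont[OF trans_mat_has_real_derivative[OF bounded_linear_vec_nth[of i], of A v 0]]
  by (simp add: isCont_def)

lemma trans_mat_mv_quotient_tendsto:
  fixes A :: "real^'n::finite^'n"
  shows "((\<lambda>t. (1/t) *\<^sub>R (trans_mat A t *v v - v)) \<longlongrightarrow> A *v v) (at 0)"
proof (rule vec_tendstoI)
  fix i
  show "((\<lambda>t. ((1/t) *\<^sub>R (trans_mat A t *v v - v)) $ i) \<longlongrightarrow> (A *v v) $ i) (at 0)"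
    using trans_mat_has_real_derivative[OF bounded_linear_vec_nth[of i], of A v 0]
    by (simp add: has_field_derivative_iff)
qed

text \<open>The partial sums of the exponential series stay in \<open>V\<close>, and a subspace of a
  finite-dimensional space is closed.\<close>

lemma trans_mat_mv_closed:
  fixes A :: "real^'n::finite^'n"
  assumes "subspace V" "\<And>g. g \<in> V \<Longrightarrow> A *v g \<in> V" "v \<in> V"
  shows "trans_mat A t *v v \<in> V"
proof -
  have p: "matpow A k *v v \<in> V" for k
  proof (induction k)
    case (Suc k)
    then show ?case unfolding matpow_Suc_mv by (rule assms(2))
  qed (simp add: assms(3))
  have "(\<Sum>k<n. (t ^ k / fact k) *\<^sub>R (matpow A k *v v)) \<in> V" for n
    by (intro subspace_sum[OF assms(1)] subspace_scale[OF assms(1)] p)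
  then show ?thesis
    using trans_mat_sums[of t A v] unfolding sums_def
    by (rule closed_sequentially[OF closed_subspace[OF assms(1)]])
qed

section \<open>The controllable subspace: functions of h, and eigenvalues of the quotient
  map\<close>

context
  fixes A :: "real^'n::finite^'n" and h :: "real^'n"
begin

lemma subspace_ctrl: "subspace (ctrl_subspace A h)"
  unfolding ctrl_subspace_def by (rule subspace_Inter) auto

lemma one_in_ctrl: "1 \<in> ctrl_subspace A h"
  and ctrl_A: "g \<in> ctrl_subspace A h \<Longrightarrow> A *v g \<in> ctrl_subspace A h"
  and ctrl_h: "g \<in> ctrl_subspace A h \<Longrightarrow> g * h \<in> ctrl_subspace A h"
  unfolding ctrl_subspace_def by auto

lemma ctrl_subspace_least:
  assumes "subspace V" "1 \<in> V" "\<And>g. g \<in> V \<Longrightarrow> A *v g \<in> V" "\<And>g. g \<in> V \<Longrightarrow> g * h \<in> V"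
  shows "ctrl_subspace A h \<subseteq> V"
  unfolding ctrl_subspace_def using assms by blast

lemma ctrl_trans_mat: "g \<in> ctrl_subspace A h \<Longrightarrow> trans_mat A t *v g \<in> ctrl_subspace A h"
  by (rule trans_mat_mv_closed[OF subspace_ctrl ctrl_A])

text \<open>Lagrange interpolation: \<open>h\<close> takes finitely many values, so every function
  of \<open>h\<close> is a polynomial in \<open>h\<close>, and \<open>ctrl_h\<close> closes the
  subspace under multiplication by polynomials in \<open>h\<close>.\<close>

lemma ctrl_mult_function_of_h:
  assumes g: "g \<in> ctrl_subspace A h"
  shows "(\<chi> x. \<phi> (h $ x) * g $ x) \<in> ctrl_subspace A h"
proof -
  let ?C = "ctrl_subspace A h"
  note sub = subspace_ctrl
  have prodC: "(\<chi> x. (\<Prod>c\<in>T. h $ x - c) * g $ x) \<in> ?C" if "finite T" for T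
    using that
  proof induction
    case empty
    then show ?case using g by simp
  next
    case (insert c T)
    let ?g = "\<chi> x. (\<Prod>c\<in>T. h $ x - c) * g $ x"
    have "(\<chi> x. (\<Prod>c\<in>insert c T. h $ x - c) * g $ x) = ?g * h - c *\<^sub>R ?g"
      using insert by (simp add: vec_eq_iff algebra_simps)
    then show ?case using insert ctrl_h by (simp add: subspace_diff[OF sub] subspace_scale[OF sub])
  qed
  let ?S = "range (\<lambda>x. h $ x)"
  have ind: "(\<chi> x. (if h $ x = c then 1 else 0) * g $ x) \<in> ?C" for c
  proof -
    \<comment> \<open>The Lagrange basis polynomial with node \<open>c\<close>. If \<open>c\<close>
      is not a value of \<open>h\<close>, both sides vanish.\<close>
    have e: "(\<chi> x. (if h $ x = c then 1 else 0) * g $ x)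
      = (inverse (\<Prod>d\<in>?S - {c}. c - d)) *\<^sub>R (\<chi> x. (\<Prod>d\<in>?S - {c}. h $ x - d) * g $ x)"
    proof -
      have "(\<Prod>d\<in>?S - {c}. h $ x - d) = 0" if "h $ x \<noteq> c" for x
        using that by (intro prod_zero) auto
      moreover have "(\<Prod>d\<in>?S - {c}. c - d) \<noteq> 0" by simp
      ultimately show ?thesis by (auto simp: vec_eq_iff)
    qed
    show ?thesis unfolding e by (intro subspace_scale[OF sub] prodC) simp
  qed
  have "(\<chi> x. \<phi> (h $ x) * g $ x) = (\<Sum>c\<in>?S. \<phi> c *\<^sub>R (\<chi> x. (if h $ x = c then 1 else 0) * g $ x))"
    by (simp add: vec_eq_iff if_distrib if_distribR sum.delta cong: if_cong)
  also have "\<dots> \<in> ?C" by (intro subspace_sum[OF sub] subspace_scale[OF sub] ind)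
  finally show ?thesis .
qed

text \<open>Modulo the subspace, exp(tA) multiplies u + i w by the complex exponential of (a + i
  b)t. If \<open>a\<close> is nonnegative, the modulus does not decay, so an annihilator whose
  pairings decay must kill \<open>u\<close> and \<open>w\<close>; as this holds for all
  annihilators, both vectors lie in the subspace.\<close>

lemma quotient_eigenvalue_neg:
  assumes lim: "\<And>\<rho> f. (\<And>g. g \<in> ctrl_subspace A h \<Longrightarrow> \<rho> \<bullet> g = 0) \<Longrightarrow>
      ((\<lambda>t. \<rho> \<bullet> (trans_mat A t *v f)) \<longlongrightarrow> 0) at_top"
    and ev: "quotient_eigenvalue A (ctrl_subspace A h) a b"
  shows "a < 0"
proof (rule ccontr)
  assume "\<not> a < 0"
  then have a: "a \<ge> 0" by simp
  let ?C = "ctrl_subspace A h"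
  note sub = subspace_ctrl
  obtain u w where uw: "\<not> (u \<in> ?C \<and> w \<in> ?C)"
    and u: "A *v u - a *\<^sub>R u + b *\<^sub>R w \<in> ?C" and w: "A *v w - a *\<^sub>R w - b *\<^sub>R u \<in> ?C"
    using ev unfolding quotient_eigenvalue_def by auto
  have orth: "\<rho> \<bullet> u = 0 \<and> \<rho> \<bullet> w = 0" if \<rho>: "\<And>g. g \<in> ?C \<Longrightarrow> \<rho> \<bullet> g = 0" for \<rho>
  proof -
    \<comment> \<open>\<open>\<phi>\<close> and \<open>\<psi>\<close> are the real and imaginary
      part of \<open>\<rho>\<close> applied to exp(tA)(u + i w). The equations \<open>e\<close>
      below are the eigenvalue equation, whose defect lies in the subspace and is
      annihilated.\<close>
    define \<phi> where "\<phi> t = \<rho> \<bullet> (trans_mat A t *v u)" for t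
    define \<psi> where "\<psi> t = \<rho> \<bullet> (trans_mat A t *v w)" for t
    have bl: "bounded_linear (\<lambda>v. \<rho> \<bullet> v)" by (rule bounded_linear_inner_right)
    have e: "\<rho> \<bullet> (trans_mat A t *v (A *v u)) = a * \<phi> t - b * \<psi> t"
      "\<rho> \<bullet> (trans_mat A t *v (A *v w)) = a * \<psi> t + b * \<phi> t" for t
    proof -
      have "\<rho> \<bullet> (trans_mat A t *v (A *v u - a *\<^sub>R u + b *\<^sub>R w)) = 0"
        "\<rho> \<bullet> (trans_mat A t *v (A *v w - a *\<^sub>R w - b *\<^sub>R u)) = 0"
        using \<rho> ctrl_trans_mat u w by blast+
      then show "\<rho> \<bullet> (trans_mat A t *v (A *v u)) = a * \<phi> t - b * \<psi> t"
        "\<rho> \<bullet> (trans_mat A t *v (A *v w)) = a * \<psi> t + b * \<phi> t"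
        by (simp_all add: \<phi>_def \<psi>_def matrix_vector_right_distrib matrix_vector_mult_diff_distrib
            matrix_vector_mult_scaleR inner_add_right inner_diff_right)
    qed
    have d: "(\<phi> has_real_derivative a * \<phi> t - b * \<psi> t) (at t)"
      "(\<psi> has_real_derivative a * \<psi> t + b * \<phi> t) (at t)" for t
      unfolding \<phi>_def \<psi>_def using trans_mat_has_real_derivative[OF bl, of A]
      by (metis e \<phi>_def \<psi>_def)+
    \<comment> \<open>The squared modulus y solves y' = 2 a y; the rotation by \<open>b\<close>
      cancels.\<close>
    have d2: "((\<lambda>t. (\<phi> t)\<^sup>2 + (\<psi> t)\<^sup>2) has_real_derivative 2 * a * ((\<phi> t)\<^sup>2 + (\<psi> t)\<^sup>2)) (at t)" for t
      by (rule derivative_eq_intros d refl)+ (simp add: algebra_simps power2_eq_square)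
    have mono: "(\<phi> 0)\<^sup>2 + (\<psi> 0)\<^sup>2 \<le> (\<phi> t)\<^sup>2 + (\<psi> t)\<^sup>2" if "t \<ge> 0" for t
      by (rule DERIV_nonneg_imp_nondecreasing[OF that]) (use d2 a in \<open>auto intro!: exI mult_nonneg_nonneg\<close>)
    have "(\<phi> \<longlongrightarrow> 0) at_top" "(\<psi> \<longlongrightarrow> 0) at_top"
      unfolding \<phi>_def \<psi>_def by (intro lim \<rho>; simp)+
    then have "((\<lambda>t. (\<phi> t)\<^sup>2 + (\<psi> t)\<^sup>2) \<longlongrightarrow> 0\<^sup>2 + 0\<^sup>2) at_top"
      by (intro tendsto_intros)
    moreover have "eventually (\<lambda>t. (\<phi> 0)\<^sup>2 + (\<psi> 0)\<^sup>2 \<le> (\<phi> t)\<^sup>2 + (\<psi> t)\<^sup>2) at_top"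
      using eventually_ge_at_top[of 0] by eventually_elim (rule mono)
    ultimately have "(\<phi> 0)\<^sup>2 + (\<psi> 0)\<^sup>2 \<le> 0"
      by (simp add: tendsto_lowerbound)
    then have "\<phi> 0 = 0 \<and> \<psi> 0 = 0" by (smt (verit) sum_power2_gt_zero_iff)
    then show ?thesis by (simp add: \<phi>_def \<psi>_def)
  qed
  \<comment> \<open>Double annihilator: the component \<open>z\<close> of \<open>v\<close>
    orthogonal to the subspace is itself an annihilator, hence orthogonal to \<open>v\<close>, hence
    zero.\<close>
  have "v \<in> ?C" if v: "\<And>\<rho>. (\<And>g. g \<in> ?C \<Longrightarrow> \<rho> \<bullet> g = 0) \<Longrightarrow> \<rho> \<bullet> v = 0" for v
  proof -
    obtain y z where yz: "y \<in> span ?C" "\<And>x. x \<in> span ?C \<Longrightarrow> orthogonal z x" "v = y + z"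
      using orthogonal_subspace_decomp_exists[of ?C v] by metis
    then have y: "y \<in> ?C" and z: "\<And>x. x \<in> ?C \<Longrightarrow> z \<bullet> x = 0"
      using sub by (auto simp: span_eq_iff[THEN iffD2] orthogonal_def)
    have "z \<bullet> v = 0" using v z by blast
    then have "z = 0" using z[OF y] yz by (simp add: inner_add_right)
    then show ?thesis using y yz by simp
  qed
  then show False using uw orth by blast
qed

end

section \<open>Closed classes\<close>

lemma ergodic_class_reachable:
  assumes "ergodic_class A D" "x \<in> D" "(x, y) \<in> {(i, j). i \<noteq> j \<and> 0 < A$i$j}\<^sup>*"
  shows "y \<in> D"
  using assms(3,2)
proof induction
  case (step y z)
  then show ?case using assms(1) unfolding ergodic_class_def by force
qed

text \<open>A row inside \<open>D\<close> already sums to zero over \<open>D\<close>, since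
  \<open>D\<close> is closed. A row outside \<open>D\<close> belongs to another closed class and has
  no weight on \<open>D\<close>; here the absence of transient states enters, since a transient
  state could jump into \<open>D\<close>.\<close>

lemma generator_indicator_eq_0:
  fixes A :: "real^'n::finite^'n"
  assumes "rate_matrix A" "\<forall>x. \<exists>D. ergodic_class A D \<and> x \<in> D" "ergodic_class A D"
  shows "A *v (\<chi> x. indicator D x) = 0"
proof -
  have "(\<Sum>j\<in>UNIV. A$x$j * indicator D j) = 0" for x
  proof (cases "x \<in> D")
    case True
    then have "A$x$j * indicator D j = A$x$j" for j
      using assms(3) by (auto simp: ergodic_class_def indicator_def)
    then show ?thesis using assms(1) unfolding rate_matrix_def by presburger
  next
    case False
    obtain E where E: "ergodic_class A E" "x \<in> E" using assms(2) by blast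
    \<comment> \<open>Irreducibility of \<open>E\<close> would lead from a common point
      \<open>j\<close> to \<open>x\<close>, and closedness of \<open>D\<close> would then put
      \<open>x\<close> into \<open>D\<close>.\<close>
    have "j \<notin> E" if "j \<in> D" for j
      using ergodic_class_reachable[OF assms(3) that, of x] False E by (auto simp: ergodic_class_def)
    then have "A$x$j * indicator D j = 0" for j
      using E by (auto simp: ergodic_class_def indicator_def)
    then show ?thesis by (intro sum.neutral) blast
  qed
  then show ?thesis by (simp add: vec_eq_iff matrix_vector_mult_def)
qed

text \<open>A kernel vector outside the subspace would be an eigenvector of the quotient map for the
  eigenvalue 0, which is not negative.\<close>

lemma stabilizable_kernel_in_ctrl:
  fixes A :: "real^'n::finite^'n"
  assumes "stabilizable A h" "A *v v = 0"
  shows "v \<in> ctrl_subspace A h"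
proof (rule ccontr)
  assume v: "v \<notin> ctrl_subspace A h"
  have "0 \<in> ctrl_subspace A h" using subspace_ctrl subspace_0 by blast
  then have "quotient_eigenvalue A (ctrl_subspace A h) 0 0"
    unfolding quotient_eigenvalue_def using v assms(2) by (intro exI[of _ v] exI[of _ 0]) simp
  then show False using v assms(1) unfolding stabilizable_def by force
qed

section \<open>Sub-sigma-algebras\<close>

lemma space_gen_sigma [simp]: "space (gen_sigma M fs N) = space M"
  unfolding gen_sigma_def by (simp add: space_measure_of_conv)

lemma sets_gen_sigma:
  "sets (gen_sigma M fs N) = sigma_sets (space M) (\<Union>f\<in>fs. {f -` B \<inter> space M | B. B \<in> sets N})"
  unfolding gen_sigma_def by (rule sets_measure_of) auto

lemma measurable_gen_sigma:
  assumes "f \<in> fs" "f \<in> measurable M N"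
  shows "f \<in> measurable (gen_sigma M fs N) N"
  using assms by (auto simp: measurable_def sets_gen_sigma)

lemma subalgebra_gen_sigma:
  assumes "\<And>f. f \<in> fs \<Longrightarrow> f \<in> measurable K N" "space K = space M"
  shows "subalgebra K (gen_sigma M fs N)"
proof -
  have "sigma_sets (space M) (\<Union>f\<in>fs. {f -` B \<inter> space M | B. B \<in> sets N}) \<subseteq> sets K"
    unfolding assms(2)[symmetric]
    by (rule sets.sigma_sets_subset) (auto intro: measurable_sets[OF assms(1)])
  then show ?thesis by (simp add: subalgebra_def sets_gen_sigma assms(2))
qed

lemma subalgebra_trans: "subalgebra M F \<Longrightarrow> subalgebra F G \<Longrightarrow> subalgebra M G"
  unfolding subalgebra_def by auto

text \<open>Needed for time integrals of the signal: they involve uncountably many times, and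
  without path regularity they are only almost everywhere equal to a function measurable for the
  past.\<close>

definition ae_augment :: "'w measure \<Rightarrow> 'w measure \<Rightarrow> 'w measure" where
  "ae_augment M F = sigma (space M) {E \<in> sets M. \<exists>E'\<in>sets F. AE \<omega> in M. \<omega> \<in> E \<longleftrightarrow> \<omega> \<in> E'}"

lemma space_ae_augment [simp]: "space (ae_augment M F) = space M"
  unfolding ae_augment_def by (simp add: space_measure_of_conv)

text \<open>The generating collection is already a sigma-algebra: the representatives
  \<open>E'\<close> are complemented and united along with the sets, and countably many exceptional
  null sets form a null set.\<close>

lemma sets_ae_augment:
  assumes "subalgebra M F"
  shows "sets (ae_augment M F) = {E \<in> sets M. \<exists>E'\<in>sets F. AE \<omega> in M. \<omega> \<in> E \<longleftrightarrow> \<omega> \<in> E'}"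
    (is "_ = ?S")
proof -
  have sp: "space F = space M" using assms by (simp add: subalgebra_def)
  have "sigma_algebra (space M) ?S"
    unfolding sigma_algebra_iff2
  proof (intro conjI ballI allI impI)
    show "?S \<subseteq> Pow (space M)" using sets.sets_into_space by auto
    show "{} \<in> ?S" by auto
    show "space M - E \<in> ?S" if E: "E \<in> ?S" for E
    proof -
      from E obtain E' where E': "E' \<in> sets F" "AE \<omega> in M. \<omega> \<in> E \<longleftrightarrow> \<omega> \<in> E'" by auto
      have "AE \<omega> in M. \<omega> \<in> space M - E \<longleftrightarrow> \<omega> \<in> space F - E'"
        using E'(2) by eventually_elim (auto simp: sp)
      then show ?thesis using E E'(1) by (auto intro!: bexI[of _ "space F - E'"])
    qed
    show "(\<Union>i. E i) \<in> ?S" if E: "range E \<subseteq> ?S" for E :: "nat \<Rightarrow> _"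
    proof -
      have "\<forall>i. \<exists>E'. E' \<in> sets F \<and> (AE \<omega> in M. \<omega> \<in> E i \<longleftrightarrow> \<omega> \<in> E')"
        using E by blast
      then obtain E' where E': "\<And>i. E' i \<in> sets F" "\<And>i. AE \<omega> in M. \<omega> \<in> E i \<longleftrightarrow> \<omega> \<in> E' i"
        by metis
      have "AE \<omega> in M. \<forall>i. \<omega> \<in> E i \<longleftrightarrow> \<omega> \<in> E' i"
        using E'(2) by (simp add: AE_all_countable)
      then have "AE \<omega> in M. \<omega> \<in> (\<Union>i. E i) \<longleftrightarrow> \<omega> \<in> (\<Union>i. E' i)"
        by eventually_elim auto
      moreover have "(\<Union>i. E i) \<in> sets M" using E by (intro sets.countable_UN) auto
      moreover have "(\<Union>i. E' i) \<in> sets F" using E' by auto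
      ultimately show ?thesis by blast
    qed
  qed
  then show ?thesis unfolding ae_augment_def by (simp add: sigma_algebra.sigma_sets_eq sigma_algebra.sets_measure_of_eq)
qed

lemma subalgebra_ae_augment:
  assumes "subalgebra M F"
  shows "subalgebra M (ae_augment M F)" "subalgebra (ae_augment M F) F"
  using assms by (auto simp: subalgebra_def sets_ae_augment)

lemma ae_augment_mono:
  assumes "subalgebra M F" "subalgebra F G"
  shows "subalgebra (ae_augment M F) (ae_augment M G)"
  using assms subalgebra_trans[OF assms] by (auto simp: subalgebra_def sets_ae_augment)

lemma measurable_ae_augment:
  assumes "subalgebra M F" "f \<in> measurable M N" "f' \<in> measurable F N" "AE \<omega> in M. f \<omega> = f' \<omega>"
  shows "f \<in> measurable (ae_augment M F) N"
proof (rule measurableI)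
  fix B assume B: "B \<in> sets N"
  have "AE \<omega> in M. \<omega> \<in> f -` B \<inter> space M \<longleftrightarrow> \<omega> \<in> f' -` B \<inter> space F"
    using assms(4) by eventually_elim (use assms(1) in \<open>auto simp: subalgebra_def\<close>)
  then show "f -` B \<inter> space (ae_augment M F) \<in> sets (ae_augment M F)"
    using B measurable_sets[OF assms(2) B] measurable_sets[OF assms(3) B]
    unfolding sets_ae_augment[OF assms(1)] space_ae_augment
    by (intro CollectI conjI bexI[of _ "f' -` B \<inter> space F"])
qed (use measurable_space[OF assms(2)] in auto)

text \<open>Generating by intersections rather than by the union gives a pi-system, so that
  independence can be exploited on rectangles \<open>A \<inter> B\<close>.\<close>

definition join_sigma :: "'w measure \<Rightarrow> 'w measure \<Rightarrow> 'w measure \<Rightarrow> 'w measure" where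
  "join_sigma M F G = sigma (space M) {A \<inter> B | A B. A \<in> sets F \<and> B \<in> sets G}"

lemma space_join_sigma [simp]: "space (join_sigma M F G) = space M"
  unfolding join_sigma_def by (simp add: space_measure_of_conv)

lemma sets_join_sigma:
  assumes "subalgebra M F"
  shows "sets (join_sigma M F G) = sigma_sets (space M) {A \<inter> B | A B. A \<in> sets F \<and> B \<in> sets G}"
  unfolding join_sigma_def
  by (rule sets_measure_of) (use assms sets.sets_into_space in \<open>fastforce simp: subalgebra_def\<close>)

lemma subalgebra_join_sigma_least:
  assumes "subalgebra M F" "subalgebra K F" "subalgebra K G"
  shows "subalgebra K (join_sigma M F G)"
proof -
  have sp: "space K = space M" using assms by (simp add: subalgebra_def)
  have "sets (join_sigma M F G) \<subseteq> sets K"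
    unfolding sets_join_sigma[OF assms(1)] sp[symmetric]
    by (rule sets.sigma_sets_subset) (use assms in \<open>auto simp: subalgebra_def\<close>)
  then show ?thesis by (simp add: subalgebra_def sp)
qed

lemma subalgebra_join_sigma:
  assumes "subalgebra M F" "subalgebra M G"
  shows "subalgebra (join_sigma M F G) F" "subalgebra (join_sigma M F G) G"
proof -
  have "A \<in> sets (join_sigma M F G)" if "A \<in> sets F" for A
  proof -
    have "A = A \<inter> space G" using sets.sets_into_space[OF that] assms by (auto simp: subalgebra_def)
    then have "A \<in> {A \<inter> B | A B. A \<in> sets F \<and> B \<in> sets G}" using that by blast
    then show ?thesis unfolding sets_join_sigma[OF assms(1)] by (rule sigma_sets.Basic)
  qed
  moreover have "A \<in> sets (join_sigma M F G)" if "A \<in> sets G" for A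
  proof -
    have "A = space F \<inter> A" using sets.sets_into_space[OF that] assms by (auto simp: subalgebra_def)
    then have "A \<in> {A \<inter> B | A B. A \<in> sets F \<and> B \<in> sets G}" using that by blast
    then show ?thesis unfolding sets_join_sigma[OF assms(1)] by (rule sigma_sets.Basic)
  qed
  ultimately show "subalgebra (join_sigma M F G) F" "subalgebra (join_sigma M F G) G"
    using assms by (auto simp: subalgebra_def)
qed

section \<open>Functions with vanishing conditional expectation\<close>

text \<open>Vanishing conditional expectation in integrated form: it passes at once to smaller
  sigma-algebras and can be verified on a generating pi-system.\<close>

definition null_on :: "'w measure \<Rightarrow> 'w measure \<Rightarrow> ('w \<Rightarrow> real) \<Rightarrow> bool" where
  "null_on M F f \<longleftrightarrow> (\<forall>A\<in>sets F. (\<integral>\<omega>\<in>A. f \<omega> \<partial>M) = 0)"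

lemma integrable_bounded_mult:
  fixes f K :: "'w \<Rightarrow> real"
  assumes "integrable M f" "K \<in> borel_measurable M" "\<And>\<omega>. \<omega> \<in> space M \<Longrightarrow> \<bar>K \<omega>\<bar> \<le> c"
  shows "integrable M (\<lambda>\<omega>. K \<omega> * f \<omega>)"
proof (rule Bochner_Integration.integrable_bound)
  show "integrable M (\<lambda>\<omega>. c * f \<omega>)" using assms by simp
  show "(\<lambda>\<omega>. K \<omega> * f \<omega>) \<in> borel_measurable M" using assms by simp
  show "AE \<omega> in M. norm (K \<omega> * f \<omega>) \<le> norm (c * f \<omega>)"
  proof (rule AE_I2)
    fix \<omega> assume "\<omega> \<in> space M"
    then have "\<bar>K \<omega>\<bar> \<le> \<bar>c\<bar>" using assms(3)[of \<omega>] by linarith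
    then show "norm (K \<omega> * f \<omega>) \<le> norm (c * f \<omega>)" by (simp add: abs_mult mult_right_mono)
  qed
qed

lemma (in finite_measure) integrable_bounded:
  fixes f :: "'a \<Rightarrow> real"
  assumes "f \<in> borel_measurable M" "\<And>\<omega>. \<omega> \<in> space M \<Longrightarrow> \<bar>f \<omega>\<bar> \<le> c"
  shows "integrable M f"
  by (rule integrable_const_bound[where B=c]) (use assms in auto)

context prob_space
begin

lemma sigma_finite_subalg: "subalgebra M F \<Longrightarrow> sigma_finite_subalgebra M F"
  by (rule finite_measure_subalgebra_is_sigma_finite)
    (simp add: finite_measure_subalgebra_def finite_measure_subalgebra_axioms_def finite_measure_axioms)

text \<open>Dynkin's pi-lambda argument. \<open>E\<close> need not contain the whole space, so the
  vanishing of the total integral is assumed separately; complements use it.\<close>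

lemma null_on_sigma_setsI:
  fixes f :: "'a \<Rightarrow> real"
  assumes f: "integrable M f" and E: "Int_stable E" "E \<subseteq> sets M" "(\<integral>\<omega>. f \<omega> \<partial>M) = 0"
    and zero: "\<And>A. A \<in> E \<Longrightarrow> (\<integral>\<omega>\<in>A. f \<omega> \<partial>M) = 0"
    and F: "sets F = sigma_sets (space M) E"
  shows "null_on M F f"
  unfolding null_on_def
proof
  have M: "A \<in> sets M" if "A \<in> sigma_sets (space M) E" for A
    using that E(2) sets.sigma_sets_subset by blast
  have int: "set_integrable M A f" if "A \<in> sets M" for A
    unfolding set_integrable_def by (rule integrable_mult_indicator[OF that f])
  have EP: "E \<subseteq> Pow (space M)" using E(2) sets.space_closed by auto
  fix A assume "A \<in> sets F"
  then have "A \<in> sigma_sets (space M) E" by (simp add: F)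
  then show "(\<integral>\<omega>\<in>A. f \<omega> \<partial>M) = 0"
  proof (induct rule: sigma_sets_induct_disjoint[OF E(1) EP, consumes 1, case_names basic empty compl union])
    case (basic A) then show ?case by (rule zero)
  next
    case empty then show ?case by (simp add: set_lebesgue_integral_def)
  next
    case (compl A)
    have A: "A \<in> sets M" using M compl by auto
    have "(\<integral>\<omega>\<in>A \<union> (space M - A). f \<omega> \<partial>M) = (\<integral>\<omega>\<in>A. f \<omega> \<partial>M) + (\<integral>\<omega>\<in>space M - A. f \<omega> \<partial>M)"
      by (rule set_integral_Un) (use A int in auto)
    moreover have "A \<union> (space M - A) = space M" using sets.sets_into_space[OF A] by auto
    ultimately show ?case using compl E(3) f by (simp add: set_integral_space)
  next
    case (union A)
    have A: "range A \<subseteq> sets M" using union M by auto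
    have "(\<integral>\<omega>\<in>(\<Union>i. A i). f \<omega> \<partial>M) = (\<Sum>i. \<integral>\<omega>\<in>A i. f \<omega> \<partial>M)"
      by (rule lebesgue_integral_countable_add)
        (use A union(1) int in \<open>auto simp: disjoint_family_on_def\<close>)
    then show ?case using union by simp
  qed
qed

lemma null_on_AE:
  assumes "subalgebra M F" "integrable M f" "null_on M F f"
  shows "AE \<omega> in M. real_cond_exp M F f \<omega> = 0"
proof -
  interpret sigma_finite_subalgebra M F by (rule sigma_finite_subalg[OF assms(1)])
  show ?thesis
    by (rule real_cond_exp_charact) (use assms in \<open>auto simp: null_on_def\<close>)
qed

lemma null_on_integral_mult:
  assumes "subalgebra M F" "integrable M f" "null_on M F f"
    and K: "K \<in> borel_measurable F" "\<And>\<omega>. \<omega> \<in> space M \<Longrightarrow> \<bar>K \<omega>\<bar> \<le> c"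
  shows "(\<integral>\<omega>. K \<omega> * f \<omega> \<partial>M) = 0"
proof -
  interpret sigma_finite_subalgebra M F by (rule sigma_finite_subalg[OF assms(1)])
  have KM: "K \<in> borel_measurable M" using K assms(1) measurable_from_subalg by blast
  have "(\<integral>\<omega>. K \<omega> * f \<omega> \<partial>M) = (\<integral>\<omega>. K \<omega> * real_cond_exp M F f \<omega> \<partial>M)"
    by (rule real_cond_exp_intg(2)[symmetric])
      (use K KM assms in \<open>auto intro!: integrable_bounded_mult[where c=c]\<close>)
  also have "\<dots> = (\<integral>\<omega>. 0 \<partial>M)"
    using null_on_AE[OF assms(1-3)] KM by (intro integral_cong_AE) auto
  finally show ?thesis by simp
qed

lemma real_cond_exp_abs_le:
  assumes "subalgebra M F" "f \<in> borel_measurable M" "\<And>\<omega>. \<omega> \<in> space M \<Longrightarrow> \<bar>f \<omega>\<bar> \<le> c"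
  shows "AE \<omega> in M. \<bar>real_cond_exp M F f \<omega>\<bar> \<le> c"
proof -
  interpret S: sigma_finite_subalgebra M F by (rule sigma_finite_subalg[OF assms(1)])
  have i: "integrable M f" by (rule integrable_bounded[OF assms(2,3)])
  have "AE \<omega> in M. real_cond_exp M F f \<omega> \<le> c"
    by (rule S.real_cond_exp_le_c[OF i]) (use assms(3) in \<open>force intro!: AE_I2\<close>)
  moreover have "AE \<omega> in M. real_cond_exp M F f \<omega> \<ge> - c"
    by (rule S.real_cond_exp_ge_c[OF i]) (use assms(3) in \<open>force intro!: AE_I2\<close>)
  ultimately show ?thesis by eventually_elim auto
qed

text \<open>A conditional expectation inherits bounds only almost everywhere. Truncation gives a
  version bounded at every point, which can serve as a factor in
  \<open>null_on_integral_mult\<close>.\<close>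

lemma obtain_bounded_cond_exp:
  assumes F: "subalgebra M F" and f: "f \<in> borel_measurable M" "\<And>\<omega>. \<omega> \<in> space M \<Longrightarrow> \<bar>f \<omega>\<bar> \<le> c"
  obtains K where "K \<in> borel_measurable F" "\<And>\<omega>. \<bar>K \<omega>\<bar> \<le> c" "null_on M F (\<lambda>\<omega>. f \<omega> - K \<omega>)"
proof -
  interpret S: sigma_finite_subalgebra M F by (rule sigma_finite_subalg[OF F])
  have fi: "integrable M f" by (rule integrable_bounded[OF f])
  \<comment> \<open>A point of the space forces \<open>c\<close> to be nonnegative, so that the
    truncation below has values between -c and c.\<close>
  obtain \<omega>0 where "\<omega>0 \<in> space M" using not_empty by auto
  then have c: "c \<ge> 0" using f(2) by fastforce
  define K where "K \<omega> = max (- c) (min c (real_cond_exp M F f \<omega>))" for \<omega>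
  have KF: "K \<in> borel_measurable F" unfolding K_def by measurable
  have KM [measurable]: "K \<in> borel_measurable M" using F KF measurable_from_subalg by blast
  have Kb: "\<bar>K \<omega>\<bar> \<le> c" for \<omega> unfolding K_def using c by auto
  have Ki: "integrable M K" by (rule integrable_bounded[OF KM Kb])
  have Kf: "AE \<omega> in M. K \<omega> = real_cond_exp M F f \<omega>"
  proof -
    have "AE \<omega> in M. \<bar>real_cond_exp M F f \<omega>\<bar> \<le> c" by (rule real_cond_exp_abs_le[OF F f])
    then show ?thesis by eventually_elim (auto simp: K_def)
  qed
  have "null_on M F (\<lambda>\<omega>. f \<omega> - K \<omega>)"
    unfolding null_on_def
  proof
    fix B assume B: "B \<in> sets F"
    then have BM: "B \<in> sets M" using F by (auto simp: subalgebra_def)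
    have "(\<integral>\<omega>\<in>B. K \<omega> \<partial>M) = (\<integral>\<omega>\<in>B. real_cond_exp M F f \<omega> \<partial>M)"
      by (rule set_lebesgue_integral_cong_AE) (use Kf BM in auto)
    also have "\<dots> = (\<integral>\<omega>\<in>B. f \<omega> \<partial>M)" using S.real_cond_exp_intA[OF fi B] by simp
    finally show "(\<integral>\<omega>\<in>B. (f \<omega> - K \<omega>) \<partial>M) = 0"
      using integrable_mult_indicator[OF BM fi] integrable_mult_indicator[OF BM Ki]
      by (subst set_integral_diff) (simp_all add: set_integrable_def)
  qed
  from that[OF KF Kb this] show ?thesis .
qed

lemma null_on_ae_augment:
  assumes "subalgebra M F" "integrable M f" "null_on M F f"
  shows "null_on M (ae_augment M F) f"
  unfolding null_on_def
proof
  fix E assume "E \<in> sets (ae_augment M F)"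
  then obtain E' where E: "E \<in> sets M" "E' \<in> sets F" "AE \<omega> in M. \<omega> \<in> E \<longleftrightarrow> \<omega> \<in> E'"
    by (auto simp: sets_ae_augment[OF assms(1)])
  have E': "E' \<in> sets M" using E assms(1) by (auto simp: subalgebra_def)
  have "(\<integral>\<omega>\<in>E. f \<omega> \<partial>M) = (\<integral>\<omega>\<in>E'. f \<omega> \<partial>M)"
    unfolding set_lebesgue_integral_def
  proof (rule integral_cong_AE)
    show "AE \<omega> in M. indicator E \<omega> *\<^sub>R f \<omega> = indicator E' \<omega> *\<^sub>R f \<omega>"
      using E(3) by eventually_elim (auto simp: indicator_def)
  qed (use E E' assms in auto)
  then show "(\<integral>\<omega>\<in>E. f \<omega> \<partial>M) = 0" using E assms by (auto simp: null_on_def)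
qed

lemma null_on_join_sigma:
  assumes "subalgebra M F" "subalgebra M G" "integrable M f"
    and "\<And>A B. A \<in> sets F \<Longrightarrow> B \<in> sets G \<Longrightarrow> (\<integral>\<omega>\<in>A \<inter> B. f \<omega> \<partial>M) = 0"
  shows "null_on M (join_sigma M F G) f"
proof (rule null_on_sigma_setsI[OF assms(3) _ _ _ _ sets_join_sigma[OF assms(1)]])
  show "Int_stable {A \<inter> B |A B. A \<in> sets F \<and> B \<in> sets G}"
    unfolding Int_stable_def
  proof clarify
    fix A B A' B' assume "A \<in> sets F" "B \<in> sets G" "A' \<in> sets F" "B' \<in> sets G"
    then show "\<exists>C D. A \<inter> B \<inter> (A' \<inter> B') = C \<inter> D \<and> C \<in> sets F \<and> D \<in> sets G"
      by (intro exI[of _ "A \<inter> A'"] exI[of _ "B \<inter> B'"]) auto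
  qed
  show "{A \<inter> B |A B. A \<in> sets F \<and> B \<in> sets G} \<subseteq> sets M"
    using assms by (auto simp: subalgebra_def)
  show "(\<integral>\<omega>. f \<omega> \<partial>M) = 0"
    using assms(4)[OF sets.top sets.top] assms(1-3) by (simp add: subalgebra_def set_integral_space)
qed (use assms(4) in auto)

lemma null_on_gen_sigma:
  assumes Y: "\<And>t. t \<in> T \<Longrightarrow> Y t \<in> measurable M N" and f: "integrable M f"
    and zero: "\<And>J B. finite J \<Longrightarrow> J \<subseteq> T \<Longrightarrow> (\<And>j. j \<in> J \<Longrightarrow> B j \<in> sets N) \<Longrightarrow>
      (\<integral>\<omega>\<in>{\<omega>\<in>space M. \<forall>j\<in>J. Y j \<omega> \<in> B j}. f \<omega> \<partial>M) = 0"
  shows "null_on M (gen_sigma M (Y ` T) N) f"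
proof -
  define E where "E = {{\<omega>\<in>space M. \<forall>j\<in>J. Y j \<omega> \<in> B j} | J B. finite J \<and> J \<subseteq> T \<and> (\<forall>j\<in>J. B j \<in> sets N)}"
  have EI: "{\<omega>\<in>space M. \<forall>j\<in>J. Y j \<omega> \<in> B j} \<in> E"
    if "finite J" "J \<subseteq> T" "\<And>j. j \<in> J \<Longrightarrow> B j \<in> sets N" for J B
    unfolding E_def using that by blast
  have EM: "E \<subseteq> sets K" if "\<And>t. t \<in> T \<Longrightarrow> Y t \<in> measurable K N" "space K = space M" for K
  proof
    fix A assume "A \<in> E"
    then obtain J B where J: "A = {\<omega>\<in>space M. \<forall>j\<in>J. Y j \<omega> \<in> B j}" "finite J" "J \<subseteq> T" "\<forall>j\<in>J. B j \<in> sets N"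
      unfolding E_def by blast
    have "{\<omega>\<in>space K. \<forall>j\<in>J. Y j \<omega> \<in> B j} \<in> sets K"
    proof (intro sets.sets_Collect_finite_All J(2))
      fix j assume "j \<in> J"
      then have "Y j -` B j \<inter> space K \<in> sets K" using J that(1) by (intro measurable_sets) auto
      then show "{\<omega>\<in>space K. Y j \<omega> \<in> B j} \<in> sets K" by (simp add: vimage_def Int_def conj_commute)
    qed
    then show "A \<in> sets K" using J that by simp
  qed
  have sets: "sets (gen_sigma M (Y ` T) N) = sigma_sets (space M) E"
  proof
    have "f -` B \<inter> space M \<in> E" if "f \<in> Y ` T" "B \<in> sets N" for f B
    proof -
      from that obtain t where "t \<in> T" "f = Y t" by auto
      then show ?thesis using EI[of "{t}" "\<lambda>_. B"] that by (simp add: vimage_def Int_def conj_commute)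
    qed
    then show "sets (gen_sigma M (Y ` T) N) \<subseteq> sigma_sets (space M) E"
      unfolding sets_gen_sigma by (intro sigma_sets_mono) (auto intro: sigma_sets.Basic)
    have "E \<subseteq> sets (gen_sigma M (Y ` T) N)"
      by (rule EM) (auto intro: measurable_gen_sigma Y)
    then show "sigma_sets (space M) E \<subseteq> sets (gen_sigma M (Y ` T) N)"
      using sets.sigma_sets_subset[of E "gen_sigma M (Y ` T) N"] by simp
  qed
  show ?thesis
  proof (rule null_on_sigma_setsI[OF f _ _ _ _ sets])
    show "Int_stable E"
    proof (rule Int_stableI)
      fix a b assume "a \<in> E" "b \<in> E"
      then obtain J B J' B' where J: "a = {\<omega>\<in>space M. \<forall>j\<in>J. Y j \<omega> \<in> B j}" "finite J" "J \<subseteq> T" "\<forall>j\<in>J. B j \<in> sets N"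
        and J': "b = {\<omega>\<in>space M. \<forall>j\<in>J'. Y j \<omega> \<in> B' j}" "finite J'" "J' \<subseteq> T" "\<forall>j\<in>J'. B' j \<in> sets N"
        unfolding E_def by blast
      \<comment> \<open>Coordinates restricted by only one of the two cylinders get
        \<open>space N\<close> from the other.\<close>
      let ?B = "\<lambda>j. (if j \<in> J then B j else space N) \<inter> (if j \<in> J' then B' j else space N)"
      have "a \<inter> b = {\<omega>\<in>space M. \<forall>j\<in>J \<union> J'. Y j \<omega> \<in> ?B j}"
        using J J' measurable_space[OF Y] by (auto split: if_splits)
      also have "\<dots> \<in> E" by (rule EI) (use J J' in auto)
      finally show "a \<inter> b \<in> E" .
    qed
    show "E \<subseteq> sets M" by (rule EM) (auto intro: Y)
    show "(\<integral>\<omega>. f \<omega> \<partial>M) = 0"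
      using zero[of "{}"] f by (simp add: set_integral_space)
    show "(\<integral>\<omega>\<in>A. f \<omega> \<partial>M) = 0" if "A \<in> E" for A
      using that zero unfolding E_def by blast
  qed
qed

text \<open>Independence says that \<open>indicator B \<omega> - prob B\<close> has vanishing
  conditional expectation given \<open>F\<close>; testing it with \<open>K\<close> gives the
  product.\<close>

lemma indep_set_integral:
  assumes "subalgebra M F" "subalgebra M G"
    and ind: "\<And>A B. A \<in> sets F \<Longrightarrow> B \<in> sets G \<Longrightarrow> prob (A \<inter> B) = prob A * prob B"
    and K: "K \<in> borel_measurable F" "\<And>\<omega>. \<omega> \<in> space M \<Longrightarrow> \<bar>K \<omega>\<bar> \<le> c"
    and B: "B \<in> sets G"
  shows "(\<integral>\<omega>\<in>B. K \<omega> \<partial>M) = prob B * (\<integral>\<omega>. K \<omega> \<partial>M)"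
proof -
  have BM: "B \<in> sets M" using assms by (auto simp: subalgebra_def)
  have KM: "K \<in> borel_measurable M" using K assms(1) measurable_from_subalg by blast
  have i: "integrable M K" using integrable_bounded[OF KM K(2)] .
  have bi: "integrable M (\<lambda>\<omega>. indicator B \<omega> - prob B)"
    using BM by (intro Bochner_Integration.integrable_diff integrable_const integrable_real_indicator) (auto simp: less_top[symmetric])
  have "null_on M F (\<lambda>\<omega>. indicator B \<omega> - prob B)"
    unfolding null_on_def
  proof
    fix A assume A: "A \<in> sets F"
    then have AM: "A \<in> sets M" using assms by (auto simp: subalgebra_def)
    have "(\<integral>\<omega>\<in>A. (indicator B \<omega> - prob B) \<partial>M) = (\<integral>\<omega>. indicator (A \<inter> B) \<omega> - prob B * indicator A \<omega> \<partial>M)"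
      unfolding set_lebesgue_integral_def
      by (rule Bochner_Integration.integral_cong) (auto simp: indicator_def)
    also have "\<dots> = prob (A \<inter> B) - prob B * prob A"
      using AM BM by (subst Bochner_Integration.integral_diff) (auto simp: less_top[symmetric])
    finally show "(\<integral>\<omega>\<in>A. (indicator B \<omega> - prob B) \<partial>M) = 0" using ind[OF A B] by simp
  qed
  from null_on_integral_mult[OF assms(1) bi this K]
  have "0 = (\<integral>\<omega>. K \<omega> * (indicator B \<omega> - prob B) \<partial>M)" by simp
  also have "\<dots> = (\<integral>\<omega>. indicator B \<omega> *\<^sub>R K \<omega> - prob B * K \<omega> \<partial>M)"
    by (simp add: algebra_simps)
  also have "\<dots> = (\<integral>\<omega>\<in>B. K \<omega> \<partial>M) - prob B * (\<integral>\<omega>. K \<omega> \<partial>M)"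
    unfolding set_lebesgue_integral_def
    by (subst Bochner_Integration.integral_diff) (use i integrable_mult_indicator[OF BM i] in auto)
  finally show ?thesis by simp
qed

text \<open>Doob's weak type inequality for the martingale closed by \<open>\<Phi>\<close>. The
  event is split by the first time \<open>t\<close> of exceedance; the piece \<open>E t\<close>
  belongs to \<open>F t\<close>, so on it the conditional expectation may be integrated as
  \<open>\<Phi>\<close> itself.\<close>

lemma cond_exp_maximal_finite:
  fixes F :: "'t::linorder \<Rightarrow> 'a measure"
  assumes F: "\<And>t. t \<in> J \<Longrightarrow> subalgebra M (F t)"
    and mono: "\<And>s t. s \<in> J \<Longrightarrow> t \<in> J \<Longrightarrow> s \<le> t \<Longrightarrow> subalgebra (F t) (F s)"
    and \<Phi>: "integrable M \<Phi>" "\<And>\<omega>. \<Phi> \<omega> \<ge> 0" and c: "c > 0" and J: "finite J"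
  shows "prob {\<omega>\<in>space M. \<exists>t\<in>J. real_cond_exp M (F t) \<Phi> \<omega> > c} \<le> (\<integral>\<omega>. \<Phi> \<omega> \<partial>M) / c"
proof -
  let ?m = "\<lambda>t. real_cond_exp M (F t) \<Phi>"
  define E where "E t = {\<omega>\<in>space M. ?m t \<omega> > c \<and> (\<forall>s\<in>{s\<in>J. s < t}. \<not> ?m s \<omega> > c)}" for t
  have EF: "E t \<in> sets (F t)" if t: "t \<in> J" for t
  proof -
    have sp: "space (F t) = space M" using F[OF t] by (simp add: subalgebra_def)
    have [measurable]: "?m s \<in> borel_measurable (F t)" if "s \<in> J" "s \<le> t" for s
      by (rule measurable_from_subalg[OF mono[OF that(1) t that(2)] borel_measurable_cond_exp])
    have "{\<omega>\<in>space (F t). ?m t \<omega> > c} \<in> sets (F t)" using t by measurable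
    moreover have "{\<omega>\<in>space (F t). \<forall>s\<in>{s\<in>J. s < t}. \<not> ?m s \<omega> > c} \<in> sets (F t)"
      using J by (intro sets.sets_Collect_finite_All) (auto intro!: sets.sets_Collect_neg)
    ultimately have "{\<omega>\<in>space (F t). ?m t \<omega> > c} \<inter> {\<omega>\<in>space (F t). \<forall>s\<in>{s\<in>J. s < t}. \<not> ?m s \<omega> > c} \<in> sets (F t)"
      by (rule sets.Int)
    moreover have "{\<omega>\<in>space (F t). ?m t \<omega> > c} \<inter> {\<omega>\<in>space (F t). \<forall>s\<in>{s\<in>J. s < t}. \<not> ?m s \<omega> > c} = E t"
      unfolding E_def sp by blast
    ultimately show ?thesis by simp
  qed
  have EM [measurable]: "E t \<in> sets M" if "t \<in> J" for t
    using EF[OF that] F[OF that] by (auto simp: subalgebra_def)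
  have disj: "disjoint_family_on E J"
  proof -
    have "E s \<inter> E t = {}" if "s \<in> J" "t \<in> J" "s < t" for s t
      using that unfolding E_def by blast
    then show ?thesis unfolding disjoint_family_on_def by (metis Int_commute linorder_neqE)
  qed
  have eq: "{\<omega>\<in>space M. \<exists>t\<in>J. ?m t \<omega> > c} = (\<Union>t\<in>J. E t)"
  proof (intro equalityI subsetI)
    fix \<omega> assume "\<omega> \<in> {\<omega>\<in>space M. \<exists>t\<in>J. ?m t \<omega> > c}"
    then have w: "\<omega> \<in> space M" and ne: "{t\<in>J. ?m t \<omega> > c} \<noteq> {}" by auto
    have fin: "finite {t\<in>J. ?m t \<omega> > c}" using J by simp
    let ?t = "Min {t\<in>J. ?m t \<omega> > c}"
    have "?t \<in> {t\<in>J. ?m t \<omega> > c}" using Min_in[OF fin ne] .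
    moreover have "\<not> ?m s \<omega> > c" if "s \<in> J" "s < ?t" for s
      using Min_le[OF fin, of s] that by auto
    ultimately show "\<omega> \<in> (\<Union>t\<in>J. E t)" using w unfolding E_def by blast
  qed (auto simp: E_def)
  have "prob {\<omega>\<in>space M. \<exists>t\<in>J. ?m t \<omega> > c} = (\<Sum>t\<in>J. prob (E t))"
    unfolding eq by (rule finite_measure_finite_Union) (use J EM disj in auto)
  moreover have "c * prob (E t) \<le> (\<integral>\<omega>\<in>E t. \<Phi> \<omega> \<partial>M)" if t: "t \<in> J" for t
  proof -
    interpret sigma_finite_subalgebra M "F t" by (rule sigma_finite_subalg[OF F[OF t]])
    have "(\<integral>\<omega>. c * indicator (E t) \<omega> \<partial>M) \<le> (\<integral>\<omega>\<in>E t. ?m t \<omega> \<partial>M)"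
      unfolding set_lebesgue_integral_def
    proof (rule integral_mono)
      show "integrable M (\<lambda>\<omega>. c * indicator (E t) \<omega>)"
        using EM[OF t] by (auto simp: less_top[symmetric])
      show "integrable M (\<lambda>\<omega>. indicator (E t) \<omega> *\<^sub>R ?m t \<omega>)"
        by (rule integrable_mult_indicator[OF EM[OF t] real_cond_exp_int(1)[OF \<Phi>(1)]])
      show "c * indicator (E t) \<omega> \<le> indicator (E t) \<omega> *\<^sub>R ?m t \<omega>" for \<omega>
        by (auto simp: E_def indicator_def)
    qed
    also have "\<dots> = (\<integral>\<omega>\<in>E t. \<Phi> \<omega> \<partial>M)"
      by (rule real_cond_exp_intA[symmetric]) (use \<Phi> EF[OF t] in auto)
    finally show ?thesis using EM[OF t] by simp
  qed
  ultimately have "c * prob {\<omega>\<in>space M. \<exists>t\<in>J. ?m t \<omega> > c} \<le> (\<Sum>t\<in>J. \<integral>\<omega>\<in>E t. \<Phi> \<omega> \<partial>M)"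
    by (simp add: sum_distrib_left sum_mono)
  also have "\<dots> = (\<integral>\<omega>\<in>(\<Union>t\<in>J. E t). \<Phi> \<omega> \<partial>M)"
    by (rule set_integral_finite_Union[symmetric])
      (use J disj EM integrable_mult_indicator[OF _ \<Phi>(1)] in \<open>simp_all add: set_integrable_def\<close>)
  also have "\<dots> \<le> (\<integral>\<omega>. \<Phi> \<omega> \<partial>M)"
    unfolding set_lebesgue_integral_def
  proof (rule integral_mono)
    show "integrable M (\<lambda>\<omega>. indicator (\<Union>t\<in>J. E t) \<omega> *\<^sub>R \<Phi> \<omega>)"
      using J EM by (intro integrable_mult_indicator \<Phi>(1) sets.finite_UN) auto
  qed (use \<Phi> in \<open>auto simp: indicator_def\<close>)
  finally show ?thesis using c by (simp add: field_simps)
qed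

text \<open>The finite case is applied to initial segments of an enumeration, which need not respect
  the order of the times; the exceedance events increase to the full one.\<close>

lemma cond_exp_maximal:
  fixes F :: "'t::linorder \<Rightarrow> 'a measure"
  assumes F: "\<And>t. t \<in> J \<Longrightarrow> subalgebra M (F t)"
    and mono: "\<And>s t. s \<in> J \<Longrightarrow> t \<in> J \<Longrightarrow> s \<le> t \<Longrightarrow> subalgebra (F t) (F s)"
    and \<Phi>: "integrable M \<Phi>" "\<And>\<omega>. \<Phi> \<omega> \<ge> 0" and c: "c > 0" and J: "countable J"
  shows "prob {\<omega>\<in>space M. \<exists>t\<in>J. real_cond_exp M (F t) \<Phi> \<omega> > c} \<le> (\<integral>\<omega>. \<Phi> \<omega> \<partial>M) / c"
proof (cases "J = {}")
  case True
  then show ?thesis using \<Phi> c by simp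
next
  case False
  define u where "u = from_nat_into J"
  have u: "range u = J" using False J by (simp add: u_def range_from_nat_into)
  define B where "B n = {\<omega>\<in>space M. \<exists>t\<in>u ` {..n}. real_cond_exp M (F t) \<Phi> \<omega> > c}" for n :: nat
  have BM: "B n \<in> sets M" for n unfolding B_def by measurable
  have "(\<lambda>n. prob (B n)) \<longlonglongrightarrow> prob (\<Union>n. B n)"
  proof (rule finite_Lim_measure_incseq)
    show "incseq B" unfolding incseq_def B_def by fastforce
  qed (use BM in auto)
  moreover have "prob (B n) \<le> (\<integral>\<omega>. \<Phi> \<omega> \<partial>M) / c" for n
    unfolding B_def by (rule cond_exp_maximal_finite) (use F mono \<Phi> c u in auto)
  ultimately have "prob (\<Union>n. B n) \<le> (\<integral>\<omega>. \<Phi> \<omega> \<partial>M) / c"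
    by (intro LIMSEQ_le_const2) auto
  moreover have "(\<Union>n. B n) = {\<omega>\<in>space M. \<exists>t\<in>J. real_cond_exp M (F t) \<Phi> \<omega> > c}"
    unfolding B_def u[symmetric] by force
  ultimately show ?thesis by simp
qed

end

section \<open>Time integrals of a measurable process\<close>

lemma set_integral_time_measurable:
  fixes Y :: "real \<Rightarrow> 'w \<Rightarrow> real"
  assumes "(\<lambda>(s, \<omega>). Y s \<omega>) \<in> borel_measurable (lborel \<Otimes>\<^sub>M M)"
  shows "(\<lambda>\<omega>. LINT s:{a..b}|lborel. Y s \<omega>) \<in> borel_measurable M"
proof -
  have [measurable]: "(\<lambda>(\<omega>, s). Y s \<omega>) \<in> borel_measurable (M \<Otimes>\<^sub>M lborel)"
    using measurable_pair_swap[OF assms] by simp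
  show ?thesis
    unfolding set_lebesgue_integral_def
    by (rule lborel.borel_measurable_lebesgue_integral) measurable
qed

lemma set_integrable_bounded_path:
  fixes y :: "real \<Rightarrow> real"
  assumes "y \<in> borel_measurable lborel" "\<And>s. \<bar>y s\<bar> \<le> c"
  shows "set_integrable lborel {a..b} y"
  unfolding set_integrable_def
  by (rule integrableI_bounded_set_indicator[where B=c])
    (use assms in \<open>auto simp: emeasure_lborel_Icc_eq\<close>)

lemma set_integral_path_bound:
  fixes y :: "real \<Rightarrow> real"
  assumes "y \<in> borel_measurable lborel" "\<And>s. \<bar>y s\<bar> \<le> c" "a \<le> b"
  shows "\<bar>LINT s:{a..b}|lborel. y s\<bar> \<le> c * (b - a)"
proof -
  have "\<bar>LINT s:{a..b}|lborel. y s\<bar> \<le> (LINT s:{a..b}|lborel. \<bar>y s\<bar>)"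
    using set_integral_norm_bound[OF set_integrable_bounded_path[OF assms(1,2)], of a b] by simp
  also have "\<dots> \<le> (LINT s:{a..b}|lborel. c)"
    by (rule set_integral_mono)
      (use assms order_trans[OF abs_ge_zero assms(2)] in \<open>auto intro!: set_integrable_bounded_path[where c=c]\<close>)
  also have "\<dots> = c * (b - a)" using assms(3) by (simp add: set_integral_const)
  finally show ?thesis .
qed

lemma (in prob_space) expectation_time_integral:
  fixes Y :: "real \<Rightarrow> 'a \<Rightarrow> real"
  assumes Y: "(\<lambda>(s, \<omega>). Y s \<omega>) \<in> borel_measurable (lborel \<Otimes>\<^sub>M M)" "\<And>s \<omega>. \<omega> \<in> space M \<Longrightarrow> \<bar>Y s \<omega>\<bar> \<le> c"
  shows "(\<integral>\<omega>. (LINT s:{a..b}|lborel. Y s \<omega>) \<partial>M) = (LINT s:{a..b}|lborel. (\<integral>\<omega>. Y s \<omega> \<partial>M))"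
proof -
  interpret pair_sigma_finite lborel M ..
  have "integrable (lborel \<Otimes>\<^sub>M M) (\<lambda>(s, \<omega>). indicator {a..b} s *\<^sub>R Y s \<omega>)"
  proof (rule integrableI_bounded_set[where A="{a..b} \<times> space M" and B=c])
    show "(\<lambda>(s, \<omega>). indicator {a..b} s *\<^sub>R Y s \<omega>) \<in> borel_measurable (lborel \<Otimes>\<^sub>M M)"
      using Y(1) by measurable
    show "emeasure (lborel \<Otimes>\<^sub>M M) ({a..b} \<times> space M) < \<infinity>"
    proof -
      have "emeasure (lborel \<Otimes>\<^sub>M M) ({a..b} \<times> space M) = emeasure lborel {a..b} * emeasure M (space M)"
        by (rule sigma_finite_measure.emeasure_pair_measure_Times) (simp_all add: prob_space_imp_sigma_finite prob_space_axioms)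
      then show ?thesis by (simp add: emeasure_space_1 emeasure_lborel_Icc_eq)
    qed
  qed (use Y(2) in \<open>auto simp: space_pair_measure indicator_def\<close>)
  from Fubini_integral[OF this] show ?thesis
    by (simp add: set_lebesgue_integral_def)
qed

text \<open>No path regularity is needed: testing the error of the conditional expectation against
  itself and exchanging the integrals shows that it vanishes.\<close>

lemma (in prob_space) time_integral_measurable_ae_augment:
  fixes Y :: "real \<Rightarrow> 'a \<Rightarrow> real"
  assumes Y: "(\<lambda>(s, \<omega>). Y s \<omega>) \<in> borel_measurable (lborel \<Otimes>\<^sub>M M)" "\<And>s \<omega>. \<omega> \<in> space M \<Longrightarrow> \<bar>Y s \<omega>\<bar> \<le> c"
    and S: "subalgebra M S" "\<And>s. s \<in> {0..t} \<Longrightarrow> Y s \<in> borel_measurable S" and t: "0 \<le> t"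
  shows "(\<lambda>\<omega>. LINT s:{0..t}|lborel. Y s \<omega>) \<in> borel_measurable (ae_augment M S)"
proof -
  define J where "J \<omega> = (LINT s:{0..t}|lborel. Y s \<omega>)" for \<omega>
  have [measurable]: "J \<in> borel_measurable M"
    unfolding J_def by (rule set_integral_time_measurable[OF Y(1)])
  have path: "(\<lambda>s. Y s \<omega>) \<in> borel_measurable lborel" if "\<omega> \<in> space M" for \<omega>
    using measurable_compose[OF measurable_Pair2'[OF that, of lborel] Y(1)] by simp
  have Jb: "\<bar>J \<omega>\<bar> \<le> c * t" if "\<omega> \<in> space M" for \<omega>
    unfolding J_def using set_integral_path_bound[OF path[OF that] Y(2)[OF that] t] by simp
  have Ji: "integrable M J" by (rule integrable_bounded[OF _ Jb]) auto
  obtain K where KS: "K \<in> borel_measurable S" and Kb: "\<And>\<omega>. \<bar>K \<omega>\<bar> \<le> c * t"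
    and KJ: "null_on M S (\<lambda>\<omega>. J \<omega> - K \<omega>)"
    by (rule obtain_bounded_cond_exp[OF S(1) _ Jb]) auto
  have [measurable]: "K \<in> borel_measurable M" using S(1) KS measurable_from_subalg by blast
  define D where "D \<omega> = J \<omega> - K \<omega>" for \<omega>
  have [measurable]: "D \<in> borel_measurable M" unfolding D_def by measurable
  have Db: "\<bar>D \<omega>\<bar> \<le> 2 * (c * t)" if "\<omega> \<in> space M" for \<omega>
    unfolding D_def using Jb[OF that] Kb[of \<omega>] by linarith
  have Di: "integrable M D" by (rule integrable_bounded[OF _ Db]) auto
  have null: "null_on M S D" unfolding D_def by (rule KJ)
  have "(\<integral>\<omega>. K \<omega> * D \<omega> \<partial>M) = 0"
    by (rule null_on_integral_mult[OF S(1) Di null KS Kb])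
  moreover have "(\<integral>\<omega>. J \<omega> * D \<omega> \<partial>M) = 0"
  proof -
    have m: "(\<lambda>(s, \<omega>). Y s \<omega> * D \<omega>) \<in> borel_measurable (lborel \<Otimes>\<^sub>M M)"
      using Y(1) by measurable
    have b: "\<bar>Y s \<omega> * D \<omega>\<bar> \<le> c * (2 * (c * t))" if "\<omega> \<in> space M" for s \<omega>
      using Y(2)[OF that, of s] Db[OF that] by (simp add: abs_mult mult_mono')
    have "(\<integral>\<omega>. J \<omega> * D \<omega> \<partial>M) = (\<integral>\<omega>. (LINT s:{0..t}|lborel. Y s \<omega> * D \<omega>) \<partial>M)"
      unfolding J_def by simp
    also have "\<dots> = (LINT s:{0..t}|lborel. (\<integral>\<omega>. Y s \<omega> * D \<omega> \<partial>M))"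
      by (rule expectation_time_integral[OF m b])
    also have "\<dots> = (LINT s:{0..t}|lborel. 0)"
      by (rule set_lebesgue_integral_cong)
        (use null_on_integral_mult[OF S(1) Di null S(2) Y(2)] in auto)
    finally show ?thesis by (simp add: set_lebesgue_integral_def)
  qed
  ultimately have "(\<integral>\<omega>. (D \<omega>)\<^sup>2 \<partial>M) = 0"
  proof -
    have "(\<integral>\<omega>. (D \<omega>)\<^sup>2 \<partial>M) = (\<integral>\<omega>. J \<omega> * D \<omega> - K \<omega> * D \<omega> \<partial>M)"
      by (rule Bochner_Integration.integral_cong) (auto simp: D_def power2_eq_square algebra_simps)
    also have "\<dots> = (\<integral>\<omega>. J \<omega> * D \<omega> \<partial>M) - (\<integral>\<omega>. K \<omega> * D \<omega> \<partial>M)"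
      by (rule Bochner_Integration.integral_diff)
        (auto intro!: integrable_bounded_mult[OF Di] Jb Kb)
    finally show ?thesis using \<open>(\<integral>\<omega>. K \<omega> * D \<omega> \<partial>M) = 0\<close> \<open>(\<integral>\<omega>. J \<omega> * D \<omega> \<partial>M) = 0\<close> by simp
  qed
  moreover have "integrable M (\<lambda>\<omega>. (D \<omega>)\<^sup>2)"
    unfolding power2_eq_square by (rule integrable_bounded_mult[OF Di _ Db]) auto
  ultimately have "AE \<omega> in M. (D \<omega>)\<^sup>2 = 0"
    by (subst (asm) integral_nonneg_eq_0_iff_AE) auto
  then have "AE \<omega> in M. J \<omega> = K \<omega>" by (simp add: D_def)
  from measurable_ae_augment[OF S(1) _ KS this] show ?thesis
    unfolding J_def[symmetric] by simp
qed

section \<open>The Wonham model\<close>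

locale wonham = prob_space M for M :: "'w measure" +
  fixes A :: "real^'n::finite^'n" and h :: "real^'n" and R :: real
    and X :: "real \<Rightarrow> 'w \<Rightarrow> 'n" and W :: "real \<Rightarrow> 'w \<Rightarrow> real"
  assumes model: "wonham_model M A R X W" and R_pos: "0 < R"
begin

definition "FX s = gen_sigma M (X ` {0..s}) (count_space UNIV)"
definition "FXall = gen_sigma M (range X) (count_space UNIV)"
definition "FW s = gen_sigma M (W ` {0..s}) (borel :: real measure)"
definition "FWall = gen_sigma M (range W) (borel :: real measure)"
definition "I t \<omega> = (LINT s:{0..t}|lborel. h $ X s \<omega>)"
text \<open>The past of signal and noise. The augmentation makes \<open>I s\<close> measurable for
  it, so it contains the observation up to \<open>s\<close> (\<open>obs_Filt\<close>).\<close>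

definition "Filt s = join_sigma M (ae_augment M (FX s)) (FW s)"

lemma X_joint: "(\<lambda>(t, \<omega>). X t \<omega>) \<in> measurable (lborel \<Otimes>\<^sub>M M) (count_space UNIV)"
  and W_meas [measurable]: "W t \<in> borel_measurable M"
  and X_init: "prob {\<omega> \<in> space M. X 0 \<omega> = x} = 1 / real CARD('n)"
  and X_markov: "0 \<le> s \<Longrightarrow> s \<le> t \<Longrightarrow> AE \<omega> in M. real_cond_exp M (FX s)
            (\<lambda>\<omega>. if X t \<omega> = j then 1 else 0) \<omega> = trans_mat A (t - s) $ X s \<omega> $ j"
  and W_indep: "0 \<le> s \<Longrightarrow> s < t \<Longrightarrow> indep_set (sets (FW s))
            (sets (gen_sigma M {\<lambda>\<omega>. W t \<omega> - W s \<omega>} borel))"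
  and W_distr: "0 \<le> s \<Longrightarrow> s < t \<Longrightarrow> distributed M lborel (\<lambda>\<omega>. W t \<omega> - W s \<omega>)
            (\<lambda>x. ennreal (normal_density 0 (sqrt (R * (t - s))) x))"
  and XW_indep: "indep_set (sets FXall) (sets FWall)"
  using model unfolding wonham_model_def FX_def FXall_def FW_def FWall_def by auto

lemma X_meas [measurable]: "X t \<in> measurable M (count_space UNIV)"
  using measurable_compose[OF measurable_Pair1'[of t lborel M] X_joint] by simp

lemma gX_joint: "(\<lambda>(t, \<omega>). (g::real^'n) $ X t \<omega>) \<in> borel_measurable (lborel \<Otimes>\<^sub>M M)"
  using measurable_compose[OF X_joint, of "\<lambda>x. g $ x" borel] by (simp add: case_prod_beta)

lemma gX_meas: "X t \<in> measurable F (count_space UNIV) \<Longrightarrow> (\<lambda>\<omega>. (\<phi>::'n \<Rightarrow> real) (X t \<omega>)) \<in> borel_measurable F"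
  by (rule measurable_compose[where f="X t" and N="count_space UNIV"]) (auto simp: measurable_count_space_eq1)

lemma gX_bound: "\<bar>(g::real^'n) $ X t \<omega>\<bar> \<le> norm g"
  using component_le_norm_cart[of g "X t \<omega>"] by simp

lemma gX_int: "integrable M (\<lambda>\<omega>. (g::real^'n) $ X t \<omega>)"
  by (rule integrable_bounded[where c="norm g"]) (auto intro: gX_meas gX_bound)

lemma sub_FX: "subalgebra M (FX s)" and sub_FXall: "subalgebra M FXall"
  and sub_FXall_FX: "subalgebra FXall (FX s)"
  and sub_FW: "subalgebra M (FW s)" and sub_FWall: "subalgebra M FWall"
  and sub_FWall_FW: "subalgebra FWall (FW s)"
  unfolding FX_def FXall_def FW_def FWall_def
  by (rule subalgebra_gen_sigma; auto intro: measurable_gen_sigma)+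

lemma FX_mono: "s \<le> t \<Longrightarrow> subalgebra (FX t) (FX s)"
  unfolding FX_def by (rule subalgebra_gen_sigma) (auto intro: measurable_gen_sigma)

lemma FW_mono: "s \<le> t \<Longrightarrow> subalgebra (FW t) (FW s)"
  unfolding FW_def by (rule subalgebra_gen_sigma) (auto intro: measurable_gen_sigma)

lemmas sub_aug_FX = subalgebra_ae_augment[OF sub_FX]
lemmas sub_aug_FXall = subalgebra_ae_augment[OF sub_FXall]

lemma X_FX: "0 \<le> r \<Longrightarrow> r \<le> s \<Longrightarrow> X r \<in> measurable (FX s) (count_space UNIV)"
  unfolding FX_def by (rule measurable_gen_sigma) auto

lemma X_FXall: "X r \<in> measurable FXall (count_space UNIV)"
  unfolding FXall_def by (rule measurable_gen_sigma) auto

lemma W_FW: "0 \<le> r \<Longrightarrow> r \<le> s \<Longrightarrow> W r \<in> borel_measurable (FW s)"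
  unfolding FW_def by (rule measurable_gen_sigma) auto

lemma W_FWall: "W r \<in> borel_measurable FWall"
  unfolding FWall_def by (rule measurable_gen_sigma) auto

text \<open>The model states the Markov property for indicators of states; \<open>g\<close> is
  expanded into these.\<close>

lemma markov_null_on_FX:
  assumes st: "0 \<le> s" "s \<le> t"
  shows "null_on M (FX s) (\<lambda>\<omega>. g $ X t \<omega> - (trans_mat A (t - s) *v g) $ X s \<omega>)"
  unfolding null_on_def
proof
  interpret S: sigma_finite_subalgebra M "FX s" by (rule sigma_finite_subalg[OF sub_FX])
  fix B assume B: "B \<in> sets (FX s)"
  then have BM [measurable]: "B \<in> sets M" using sub_FX by (auto simp: subalgebra_def)
  let ?e = "\<lambda>j \<omega>. if X t \<omega> = j then 1 else (0::real)"
  let ?p = "\<lambda>j \<omega>. trans_mat A (t - s) $ X s \<omega> $ j"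
  have ei: "integrable M (?e j)" for j
    by (rule integrable_bounded[where c=1]) auto
  have pi: "integrable M (?p j)" for j
    by (rule integrable_bounded[OF gX_meas[OF X_meas], where c="norm (\<chi> i. trans_mat A (t - s) $ i $ j)"])
      (use component_le_norm_cart[of "\<chi> i. trans_mat A (t - s) $ i $ j"] in auto)
  have z: "(\<integral>\<omega>\<in>B. ?e j \<omega> \<partial>M) = (\<integral>\<omega>\<in>B. ?p j \<omega> \<partial>M)" for j
  proof -
    have "(\<integral>\<omega>\<in>B. ?e j \<omega> \<partial>M) = (\<integral>\<omega>\<in>B. real_cond_exp M (FX s) (?e j) \<omega> \<partial>M)"
      by (rule S.real_cond_exp_intA[OF ei B])
    also have "\<dots> = (\<integral>\<omega>\<in>B. ?p j \<omega> \<partial>M)"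
      by (rule set_lebesgue_integral_cong_AE) (use X_markov[OF st, of j] pi in auto)
    finally show ?thesis .
  qed
  have "(\<integral>\<omega>\<in>B. (g $ X t \<omega> - (trans_mat A (t - s) *v g) $ X s \<omega>) \<partial>M)
      = (\<integral>\<omega>. (\<Sum>j\<in>UNIV. g $ j * (indicator B \<omega> *\<^sub>R ?e j \<omega> - indicator B \<omega> *\<^sub>R ?p j \<omega>)) \<partial>M)"
    unfolding set_lebesgue_integral_def
  proof (rule Bochner_Integration.integral_cong[OF refl])
    fix \<omega>
    have "(\<Sum>j\<in>UNIV. g $ j * ?e j \<omega>) = g $ X t \<omega>" by (simp add: if_distrib sum.delta cong: if_cong)
    then show "indicator B \<omega> *\<^sub>R (g $ X t \<omega> - (trans_mat A (t - s) *v g) $ X s \<omega>) =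
      (\<Sum>j\<in>UNIV. g $ j * (indicator B \<omega> *\<^sub>R ?e j \<omega> - indicator B \<omega> *\<^sub>R ?p j \<omega>))"
      by (auto simp: indicator_def matrix_vector_mult_def sum_subtractf right_diff_distrib mult.commute)
  qed
  also have "\<dots> = (\<Sum>j\<in>UNIV. g $ j * ((\<integral>\<omega>\<in>B. ?e j \<omega> \<partial>M) - (\<integral>\<omega>\<in>B. ?p j \<omega> \<partial>M)))"
    unfolding set_lebesgue_integral_def
    using integrable_mult_indicator[OF BM ei] integrable_mult_indicator[OF BM pi]
    by (simp add: Bochner_Integration.integral_sum Bochner_Integration.integral_diff)
  also have "\<dots> = 0" using z by simp
  finally show "(\<integral>\<omega>\<in>B. (g $ X t \<omega> - (trans_mat A (t - s) *v g) $ X s \<omega>) \<partial>M) = 0" .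
qed

lemma aug_X_W_indep:
  assumes "B \<in> sets (ae_augment M FXall)" "C \<in> sets FWall"
  shows "prob (B \<inter> C) = prob B * prob C"
proof -
  obtain B' where B: "B \<in> sets M" "B' \<in> sets FXall" "AE \<omega> in M. \<omega> \<in> B \<longleftrightarrow> \<omega> \<in> B'"
    using assms(1) by (auto simp: sets_ae_augment[OF sub_FXall])
  have M: "B' \<in> sets M" "C \<in> sets M"
    using B assms sub_FXall sub_FWall by (auto simp: subalgebra_def)
  have "prob (B \<inter> C) = prob (B' \<inter> C)"
    by (rule finite_measure_eq_AE) (use B M in auto)
  also have "\<dots> = prob B' * prob C" by (rule indep_setD[OF XW_indep B(2) assms(2)])
  also have "prob B' = prob B"
    by (rule finite_measure_eq_AE) (use B M in auto)
  finally show ?thesis .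
qed

text \<open>The noise is independent of the whole signal: on a rectangle \<open>B \<inter> C\<close>
  the factor \<open>prob C\<close> splits off, leaving the integral of \<open>f\<close> over
  \<open>B\<close>, which vanishes by assumption.\<close>

lemma null_on_join_FWall:
  assumes S: "subalgebra FXall S" and f: "f \<in> borel_measurable (ae_augment M FXall)"
    "\<And>\<omega>. \<omega> \<in> space M \<Longrightarrow> \<bar>f \<omega>\<bar> \<le> c" and null: "null_on M S f"
  shows "null_on M (join_sigma M (ae_augment M S) FWall) f"
proof (rule null_on_join_sigma)
  have SM: "subalgebra M S" using subalgebra_trans[OF sub_FXall S] .
  show sM: "subalgebra M (ae_augment M S)" using subalgebra_ae_augment(1)[OF SM] .
  show "subalgebra M FWall" by (rule sub_FWall)
  have fM: "f \<in> borel_measurable M" using f(1) sub_aug_FXall(1) measurable_from_subalg by blast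
  show fi: "integrable M f" by (rule integrable_bounded[OF fM f(2)])
  fix B C assume B: "B \<in> sets (ae_augment M S)" and C: "C \<in> sets FWall"
  have B': "B \<in> sets (ae_augment M FXall)"
    using B ae_augment_mono[OF sub_FXall S] by (auto simp: subalgebra_def)
  have "(\<integral>\<omega>\<in>B \<inter> C. f \<omega> \<partial>M) = (\<integral>\<omega>\<in>C. indicator B \<omega> * f \<omega> \<partial>M)"
    unfolding set_lebesgue_integral_def by (rule Bochner_Integration.integral_cong) (auto simp: indicator_def)
  also have "\<dots> = prob C * (\<integral>\<omega>. indicator B \<omega> * f \<omega> \<partial>M)"
  proof (rule indep_set_integral[OF sub_aug_FXall(1) sub_FWall aug_X_W_indep _ _ C, where c=c])
    show "(\<lambda>\<omega>. indicator B \<omega> * f \<omega>) \<in> borel_measurable (ae_augment M FXall)"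
      using B' f(1) by measurable
    show "\<bar>indicator B \<omega> * f \<omega>\<bar> \<le> c" if "\<omega> \<in> space M" for \<omega>
      using f(2)[OF that] by (auto simp: indicator_def)
  qed
  also have "(\<integral>\<omega>. indicator B \<omega> * f \<omega> \<partial>M) = 0"
    using null_on_ae_augment[OF SM fi null] B by (simp add: null_on_def set_lebesgue_integral_def)
  finally show "(\<integral>\<omega>\<in>B \<inter> C. f \<omega> \<partial>M) = 0" by simp
qed

text \<open>By independence of signal and noise, the test factor \<open>H\<close> may depend on the
  entire noise path besides the signal past, and hence on the observation up to
  \<open>s\<close>.\<close>

lemma markov:
  assumes st: "0 \<le> s" "s \<le> t"
    and H: "H \<in> borel_measurable (join_sigma M (ae_augment M (FX s)) FWall)" "\<And>\<omega>. \<omega> \<in> space M \<Longrightarrow> \<bar>H \<omega>\<bar> \<le> c"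
  shows "(\<integral>\<omega>. H \<omega> * g $ X t \<omega> \<partial>M) = (\<integral>\<omega>. H \<omega> * (trans_mat A (t - s) *v g) $ X s \<omega> \<partial>M)"
proof -
  let ?f = "\<lambda>\<omega>. g $ X t \<omega> - (trans_mat A (t - s) *v g) $ X s \<omega>"
  have sub: "subalgebra M (join_sigma M (ae_augment M (FX s)) FWall)"
    by (rule subalgebra_join_sigma_least) (use sub_aug_FX sub_FWall in auto)
  have HM: "H \<in> borel_measurable M" using H(1) sub measurable_from_subalg by blast
  have "null_on M (join_sigma M (ae_augment M (FX s)) FWall) ?f"
  proof (rule null_on_join_FWall[OF sub_FXall_FX])
    have "X r \<in> measurable (ae_augment M FXall) (count_space UNIV)" for r
      using X_FXall sub_aug_FXall(2) measurable_from_subalg by blast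
    then show "?f \<in> borel_measurable (ae_augment M FXall)"
      by (intro borel_measurable_diff gX_meas)
    show "\<bar>?f \<omega>\<bar> \<le> norm g + norm (trans_mat A (t - s) *v g)" for \<omega>
      using gX_bound[of g t \<omega>] gX_bound[of "trans_mat A (t - s) *v g" s \<omega>] by linarith
  qed (rule markov_null_on_FX[OF st])
  from null_on_integral_mult[OF sub _ this H]
  have "(\<integral>\<omega>. H \<omega> * ?f \<omega> \<partial>M) = 0" using gX_int by simp
  then have "(\<integral>\<omega>. H \<omega> * g $ X t \<omega> - H \<omega> * (trans_mat A (t - s) *v g) $ X s \<omega> \<partial>M) = 0"
    by (simp add: right_diff_distrib)
  then show ?thesis
    by (subst (asm) Bochner_Integration.integral_diff) (auto intro!: integrable_bounded_mult[OF gX_int HM H(2)])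
qed

text \<open>The counterpart of \<open>markov\<close> for the noise: \<open>K\<close> may see the
  whole signal, future included, and the noise up to \<open>s\<close>. On a rectangle the signal
  event splits off by independence of \<open>X\<close> and \<open>W\<close>, then the noise event by
  independence of increments.\<close>

lemma brownian_increment_indep:
  fixes \<phi> :: "real \<Rightarrow> real"
  assumes st: "0 \<le> s" "s < t" and \<phi>: "\<phi> \<in> borel_measurable borel" "\<And>x. \<bar>\<phi> x\<bar> \<le> b"
    and K: "K \<in> borel_measurable (join_sigma M (ae_augment M FXall) (FW s))" "\<And>\<omega>. \<omega> \<in> space M \<Longrightarrow> \<bar>K \<omega>\<bar> \<le> c"
  shows "(\<integral>\<omega>. K \<omega> * \<phi> (W t \<omega> - W s \<omega>) \<partial>M) = (\<integral>\<omega>. K \<omega> \<partial>M) * (\<integral>\<omega>. \<phi> (W t \<omega> - W s \<omega>) \<partial>M)"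
proof -
  let ?F = "join_sigma M (ae_augment M FXall) (FW s)"
  let ?D = "gen_sigma M {\<lambda>\<omega>. W t \<omega> - W s \<omega>} borel"
  define f where "f \<omega> = \<phi> (W t \<omega> - W s \<omega>)" for \<omega>
  define m where "m = (\<integral>\<omega>. f \<omega> \<partial>M)"
  have sub: "subalgebra M ?F"
    by (rule subalgebra_join_sigma_least) (use sub_aug_FXall sub_FW in auto)
  have KM: "K \<in> borel_measurable M" using K(1) sub measurable_from_subalg by blast
  have subD: "subalgebra M ?D" by (rule subalgebra_gen_sigma) auto
  have fD: "f \<in> borel_measurable ?D"
    unfolding f_def by (rule measurable_compose[OF measurable_gen_sigma \<phi>(1)]) auto
  have fW: "f \<in> borel_measurable FWall"
    unfolding f_def by (rule measurable_compose[OF _ \<phi>(1)]) (intro borel_measurable_diff W_FWall)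
  have fM [measurable]: "f \<in> borel_measurable M" using fD subD measurable_from_subalg by blast
  have fb: "\<bar>f \<omega>\<bar> \<le> b" for \<omega> unfolding f_def by (rule \<phi>(2))
  have fi: "integrable M f" by (rule integrable_bounded[OF fM fb])
  have fmi: "integrable M (\<lambda>\<omega>. f \<omega> - m)" using fi by simp
  have "null_on M ?F (\<lambda>\<omega>. f \<omega> - m)"
  proof (rule null_on_join_sigma[OF sub_aug_FXall(1) sub_FW fmi])
    fix B C assume B: "B \<in> sets (ae_augment M FXall)" and C: "C \<in> sets (FW s)"
    have BM: "B \<in> sets M" using B sub_aug_FXall(1) by (auto simp: subalgebra_def)
    have CM: "C \<in> sets M" using C sub_FW by (auto simp: subalgebra_def)
    have CW: "C \<in> sets FWall" using C sub_FWall_FW by (auto simp: subalgebra_def)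
    have "(\<integral>\<omega>\<in>B \<inter> C. (f \<omega> - m) \<partial>M) = (\<integral>\<omega>\<in>B. indicator C \<omega> * (f \<omega> - m) \<partial>M)"
      unfolding set_lebesgue_integral_def by (rule Bochner_Integration.integral_cong) (auto simp: indicator_def)
    also have "\<dots> = prob B * (\<integral>\<omega>. indicator C \<omega> * (f \<omega> - m) \<partial>M)"
    proof (rule indep_set_integral[OF sub_FWall sub_aug_FXall(1) _ _ _ B, where c="b + \<bar>m\<bar>"])
      show "prob (C \<inter> B) = prob C * prob B" if "C \<in> sets FWall" "B \<in> sets (ae_augment M FXall)" for C B
        using aug_X_W_indep[OF that(2,1)] by (simp add: Int_commute)
      show "(\<lambda>\<omega>. indicator C \<omega> * (f \<omega> - m)) \<in> borel_measurable FWall"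
        using CW fW by measurable
      show "\<bar>indicator C \<omega> * (f \<omega> - m)\<bar> \<le> b + \<bar>m\<bar>" for \<omega>
        using fb[of \<omega>] by (auto simp: indicator_def)
    qed
    also have "(\<integral>\<omega>. indicator C \<omega> * (f \<omega> - m) \<partial>M) = (\<integral>\<omega>\<in>C. f \<omega> \<partial>M) - m * prob C"
    proof -
      have "(\<integral>\<omega>. indicator C \<omega> * (f \<omega> - m) \<partial>M) = (\<integral>\<omega>. indicator C \<omega> *\<^sub>R f \<omega> - m * indicator C \<omega> \<partial>M)"
        by (rule Bochner_Integration.integral_cong) (auto simp: algebra_simps)
      then show ?thesis
        unfolding set_lebesgue_integral_def
        using integrable_mult_indicator[OF CM fi] CM
        by (subst (asm) Bochner_Integration.integral_diff) (auto simp: less_top[symmetric])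
    qed
    also have "(\<integral>\<omega>\<in>C. f \<omega> \<partial>M) = prob C * m"
      unfolding m_def
      by (rule indep_set_integral[OF subD sub_FW _ fD fb C])
        (metis indep_setD[OF W_indep[OF st]] Int_commute mult.commute)
    finally show "(\<integral>\<omega>\<in>B \<inter> C. (f \<omega> - m) \<partial>M) = 0" by simp
  qed
  from null_on_integral_mult[OF sub fmi this K]
  have "(\<integral>\<omega>. K \<omega> * f \<omega> - m * K \<omega> \<partial>M) = 0"
    by (simp add: algebra_simps)
  then have "(\<integral>\<omega>. K \<omega> * f \<omega> \<partial>M) = m * (\<integral>\<omega>. K \<omega> \<partial>M)"
    using integrable_bounded_mult[OF fi KM K(2)] integrable_bounded[OF KM K(2)]
    by (subst (asm) Bochner_Integration.integral_diff) auto
  then show ?thesis unfolding m_def f_def by (simp add: mult.commute)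
qed

end

section \<open>The observation sigma-algebra and the initial weights it cannot see\<close>

context wonham
begin

lemma I_ae_augment:
  assumes "subalgebra M S" "\<And>s. s \<in> {0..t} \<Longrightarrow> (\<lambda>\<omega>. h $ X s \<omega>) \<in> borel_measurable S" "0 \<le> t"
  shows "I t \<in> borel_measurable (ae_augment M S)"
  using time_integral_measurable_ae_augment[OF gX_joint gX_bound assms]
  unfolding I_def[abs_def] .

lemma obs_eq: "obs h X W t = (\<lambda>\<omega>. I t \<omega> + W t \<omega>)"
  by (simp add: obs_def[abs_def] I_def[abs_def])

lemma I_meas [measurable]: "I t \<in> borel_measurable M"
  unfolding I_def[abs_def] by (rule set_integral_time_measurable[OF gX_joint])

lemma obs_meas [measurable]: "obs h X W t \<in> borel_measurable M"
  unfolding obs_eq by measurable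

lemma sub_obs: "subalgebra M (obs_sigma M h X W t)"
  unfolding obs_sigma_def by (rule subalgebra_gen_sigma) auto

lemma sub_obs_mono: "s \<le> t \<Longrightarrow> subalgebra (obs_sigma M h X W t) (obs_sigma M h X W s)"
  unfolding obs_sigma_def by (rule subalgebra_gen_sigma) (auto intro: measurable_gen_sigma)

lemma obs_in_obs_sigma: "0 \<le> s \<Longrightarrow> s \<le> t \<Longrightarrow> obs h X W s \<in> borel_measurable (obs_sigma M h X W t)"
  unfolding obs_sigma_def by (rule measurable_gen_sigma) auto

lemma obs_join_sigma:
  assumes "subalgebra M S" "\<And>s. s \<in> {0..t} \<Longrightarrow> (\<lambda>\<omega>. h $ X s \<omega>) \<in> borel_measurable S" "0 \<le> t"
    and "subalgebra M G" "W t \<in> borel_measurable G"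
  shows "obs h X W t \<in> borel_measurable (join_sigma M (ae_augment M S) G)"
proof -
  note sub = subalgebra_join_sigma[OF subalgebra_ae_augment(1)[OF assms(1)] assms(4)]
  show ?thesis unfolding obs_eq
    using measurable_from_subalg[OF sub(1) I_ae_augment[OF assms(1-3)]]
      measurable_from_subalg[OF sub(2) assms(5)] by simp
qed

lemma expectation_X0: "(\<integral>\<omega>. g $ X 0 \<omega> \<partial>M) = (\<Sum>x\<in>UNIV. g $ x) / real CARD('n)"
proof -
  have S: "{\<omega>\<in>space M. X 0 \<omega> = x} \<in> sets M" for x by measurable
  have "(\<integral>\<omega>. g $ X 0 \<omega> \<partial>M) = (\<integral>\<omega>. (\<Sum>x\<in>UNIV. g $ x * indicator {\<omega>\<in>space M. X 0 \<omega> = x} \<omega>) \<partial>M)"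
    by (rule Bochner_Integration.integral_cong) (auto simp: indicator_def if_distrib sum.delta cong: if_cong)
  also have "\<dots> = (\<Sum>x\<in>UNIV. g $ x * prob {\<omega>\<in>space M. X 0 \<omega> = x})"
    using S by (subst Bochner_Integration.integral_sum) (auto simp: less_top[symmetric])
  finally show ?thesis by (simp add: X_init sum_divide_distrib)
qed

lemma FX_join: "f \<in> measurable (FX s) N \<Longrightarrow> f \<in> measurable (join_sigma M (ae_augment M (FX s)) FWall) N"
  using measurable_from_subalg[OF subalgebra_trans[OF subalgebra_join_sigma(1)[OF sub_aug_FX(1) sub_FWall] sub_aug_FX(2)]] .

text \<open>The bridge from integrals to linear algebra: the Markov property moves \<open>g\<close>
  back to time 0, where the reference law is uniform.\<close>

lemma expectation_initial_weight:
  assumes "0 \<le> t"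
  shows "(\<integral>\<omega>. \<rho> $ X 0 \<omega> * g $ X t \<omega> \<partial>M) = \<rho> \<bullet> (trans_mat A t *v g) / real CARD('n)"
proof -
  have "(\<integral>\<omega>. \<rho> $ X 0 \<omega> * g $ X t \<omega> \<partial>M) = (\<integral>\<omega>. \<rho> $ X 0 \<omega> * (trans_mat A (t - 0) *v g) $ X 0 \<omega> \<partial>M)"
    by (rule markov[OF _ assms FX_join gX_bound]) (auto intro!: gX_meas X_FX)
  also have "\<dots> = (\<integral>\<omega>. (\<chi> x. \<rho> $ x * (trans_mat A t *v g) $ x) $ X 0 \<omega> \<partial>M)" by simp
  finally show ?thesis unfolding expectation_X0 by (simp add: inner_vec_def)
qed

text \<open>Conditioning at the latest time \<open>b\<close> carries \<open>g\<close> back to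
  \<open>b\<close> by the semigroup, and the indicator there multiplies it by a function of
  \<open>h\<close>. Both operations stay in the controllable subspace; at time 0 the result is
  annihilated by \<open>\<rho>\<close>.\<close>

lemma unobservable_fdd:
  fixes \<rho> :: "real^'n"
  assumes \<rho>: "\<And>g. g \<in> ctrl_subspace A h \<Longrightarrow> \<rho> \<bullet> g = 0" and B: "\<And>j. B j \<in> sets borel"
    and J: "finite J" "J \<subseteq> {0..s}" "0 \<le> s" "g \<in> ctrl_subspace A h"
  shows "(\<integral>\<omega>. (\<rho> $ X 0 \<omega> * (\<Prod>j\<in>J. indicator (B j) (h $ X j \<omega>))) * g $ X s \<omega> \<partial>M) = 0"
  using J
\<comment> \<open>The induction adds the largest time. The time \<open>s\<close> and the function
  \<open>g\<close> must vary, since the step replaces them by \<open>b\<close> and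
  \<open>?k\<close>.\<close>
proof (induction J arbitrary: s g rule: finite_linorder_max_induct)
  case empty
  then show ?case using expectation_initial_weight[OF \<open>0 \<le> s\<close>, of \<rho> g] \<rho>[OF ctrl_trans_mat[of g A h s]] by simp
next
  case (insert b J)
  let ?H = "\<lambda>\<omega>. \<rho> $ X 0 \<omega> * (\<Prod>j\<in>insert b J. indicator (B j) (h $ X j \<omega>) :: real)"
  have b: "0 \<le> b" "b \<le> s" using insert by auto
  have Hm: "?H \<in> borel_measurable (FX b)"
    using insert b
    by (intro borel_measurable_times borel_measurable_prod gX_meas[where \<phi>="\<lambda>x. indicator (B _) (h $ x)"]
        gX_meas[where \<phi>="\<lambda>x. \<rho> $ x"] X_FX) (auto simp: less_imp_le)
  have Hb: "\<bar>?H \<omega>\<bar> \<le> norm \<rho>" for \<omega>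
  proof -
    have "\<bar>\<Prod>j\<in>insert b J. indicator (B j) (h $ X j \<omega>) :: real\<bar> \<le> 1"
      unfolding abs_prod by (rule prod_le_1) (auto simp: indicator_def)
    then show ?thesis unfolding abs_mult
      using mult_mono[OF gX_bound[of \<rho> 0 \<omega>], of _ 1] by simp
  qed
  let ?g = "trans_mat A (s - b) *v g"
  let ?k = "\<chi> x. indicator (B b) (h $ x) * ?g $ x"
  have "(\<integral>\<omega>. ?H \<omega> * g $ X s \<omega> \<partial>M) = (\<integral>\<omega>. ?H \<omega> * ?g $ X b \<omega> \<partial>M)"
    by (rule markov[OF b FX_join[OF Hm] Hb])
  also have "\<dots> = (\<integral>\<omega>. (\<rho> $ X 0 \<omega> * (\<Prod>j\<in>J. indicator (B j) (h $ X j \<omega>))) * ?k $ X b \<omega> \<partial>M)"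
    by (rule Bochner_Integration.integral_cong) (use insert in \<open>auto simp: mult_ac\<close>)
  also have "\<dots> = 0"
    by (rule insert.IH) (use insert b in \<open>auto simp: less_imp_le intro!: ctrl_mult_function_of_h ctrl_trans_mat\<close>)
  finally show ?case .
qed

text \<open>The claim is first proved on \<open>GH\<close>, generated by h(X) rather than by
  \<open>X\<close>. The noise is then joined by independence, and the observation is
  \<open>I\<close> plus noise, with \<open>I\<close> determined by \<open>GH\<close> up to null
  sets.\<close>

lemma unobservable_null_on_obs:
  fixes \<rho> :: "real^'n"
  assumes \<rho>: "\<And>g. g \<in> ctrl_subspace A h \<Longrightarrow> \<rho> \<bullet> g = 0" and "0 \<le> t"
  shows "null_on M (obs_sigma M h X W t) (\<lambda>\<omega>. \<rho> $ X 0 \<omega>)"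
proof -
  define Y where "Y r \<omega> = h $ X r \<omega>" for r \<omega>
  define GH where "GH = gen_sigma M (Y ` {0..}) (borel :: real measure)"
  have Ym: "Y r \<in> borel_measurable M" for r unfolding Y_def by (rule gX_meas[OF X_meas])
  have sub: "subalgebra FXall GH"
    unfolding GH_def
    by (rule subalgebra_gen_sigma) (auto simp: Y_def[abs_def] FXall_def intro!: gX_meas measurable_gen_sigma)
  have subM: "subalgebra M GH" using subalgebra_trans[OF sub_FXall sub] .
  have n1: "null_on M GH (\<lambda>\<omega>. \<rho> $ X 0 \<omega>)"
    unfolding GH_def
  proof (rule null_on_gen_sigma[OF Ym gX_int])
    fix J and B :: "real \<Rightarrow> real set"
    assume J: "finite J" "J \<subseteq> {0..}" and B: "\<And>j. j \<in> J \<Longrightarrow> B j \<in> sets borel"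
    \<comment> \<open>The inserted 0 covers an empty \<open>J\<close>. The function at the final
      time \<open>s\<close> is the constant 1, which lies in the controllable subspace.\<close>
    define s where "s = Max (insert 0 J)"
    have s: "0 \<le> s" "J \<subseteq> {0..s}" using J by (auto simp: s_def)
    \<comment> \<open>Outside \<open>J\<close> the sets are replaced by the empty set, because
      \<open>unobservable_fdd\<close> asks for Borel sets at all indices.\<close>
    let ?B = "\<lambda>j. if j \<in> J then B j else {}"
    have "(\<integral>\<omega>\<in>{\<omega> \<in> space M. \<forall>j\<in>J. Y j \<omega> \<in> B j}. \<rho> $ X 0 \<omega> \<partial>M) =
      (\<integral>\<omega>. (\<rho> $ X 0 \<omega> * (\<Prod>j\<in>J. indicator (?B j) (h $ X j \<omega>))) * 1 $ X s \<omega> \<partial>M)"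
      unfolding set_lebesgue_integral_def
    proof (rule Bochner_Integration.integral_cong[OF refl])
      fix \<omega> assume w: "\<omega> \<in> space M"
      have "(\<Prod>j\<in>J. indicator (?B j) (h $ X j \<omega>)) = (if \<forall>j\<in>J. Y j \<omega> \<in> B j then 1 else (0::real))"
        using J(1) by (auto simp: Y_def indicator_def intro!: prod.neutral)
      then show "indicator {\<omega> \<in> space M. \<forall>j\<in>J. Y j \<omega> \<in> B j} \<omega> *\<^sub>R \<rho> $ X 0 \<omega> =
         \<rho> $ X 0 \<omega> * (\<Prod>j\<in>J. indicator (?B j) (h $ X j \<omega>)) * 1 $ X s \<omega>"
        using w by (auto simp: indicator_def)
    qed
    also have "\<dots> = 0"
      by (rule unobservable_fdd) (use \<rho> B J s one_in_ctrl in auto)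
    finally show "(\<integral>\<omega>\<in>{\<omega> \<in> space M. \<forall>j\<in>J. Y j \<omega> \<in> B j}. \<rho> $ X 0 \<omega> \<partial>M) = 0" .
  qed
  have Xa: "X 0 \<in> measurable (ae_augment M FXall) (count_space UNIV)"
    using X_FXall sub_aug_FXall(2) measurable_from_subalg by blast
  have n2: "null_on M (join_sigma M (ae_augment M GH) FWall) (\<lambda>\<omega>. \<rho> $ X 0 \<omega>)"
    by (rule null_on_join_FWall[OF sub _ _ n1]) (auto intro: gX_meas[OF Xa] gX_bound)
  have "subalgebra (join_sigma M (ae_augment M GH) FWall) (obs_sigma M h X W t)"
    unfolding obs_sigma_def
  proof (rule subalgebra_gen_sigma)
    fix f assume "f \<in> obs h X W ` {0..t}"
    then obtain s where s: "f = obs h X W s" "0 \<le> s" by auto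
    have "(\<lambda>\<omega>. h $ X r \<omega>) \<in> borel_measurable GH" if "r \<in> {0..s}" for r
      using measurable_gen_sigma[of "Y r" "Y ` {0..}" M borel] that Ym by (auto simp: GH_def Y_def[abs_def])
    then show "f \<in> borel_measurable (join_sigma M (ae_augment M GH) FWall)"
      unfolding s(1) by (intro obs_join_sigma subM s sub_FWall W_FWall)
  qed simp
  then show ?thesis using n2 by (auto simp: null_on_def subalgebra_def)
qed

section \<open>Reweighted laws, and decay of unobservable weights under filter stability\<close>

lemma Pmu_integral:
  assumes "f \<in> borel_measurable M" "prob_vec \<mu>"
  shows "(\<integral>\<omega>. f \<omega> \<partial>Pmu M X \<mu>) = (\<integral>\<omega>. (real CARD('n) * \<mu> $ X 0 \<omega>) * f \<omega> \<partial>M)"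
proof -
  have "(\<lambda>\<omega>. real CARD('n) * \<mu> $ X 0 \<omega>) \<in> borel_measurable M"
    by (intro borel_measurable_times gX_meas[OF X_meas] borel_measurable_const)
  then show ?thesis
    unfolding Pmu_def using assms by (subst integral_density) (auto simp: prob_vec_def)
qed

lemma Pmu_sets [simp]: "sets (Pmu M X \<mu>) = sets M" "space (Pmu M X \<mu>) = space M"
  by (simp_all add: Pmu_def)

lemma subalgebra_Pmu: "subalgebra M F \<Longrightarrow> subalgebra (Pmu M X \<mu>) F"
  by (simp add: subalgebra_def)

lemma Pmu_prob_space:
  assumes "prob_vec \<mu>"
  shows "prob_space (Pmu M X \<mu>)"
proof (rule prob_spaceI)
  have [measurable]: "(\<lambda>\<omega>. real CARD('n) * \<mu> $ X 0 \<omega>) \<in> borel_measurable M"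
    by (intro borel_measurable_times gX_meas[OF X_meas] borel_measurable_const)
  have "emeasure (Pmu M X \<mu>) (space (Pmu M X \<mu>)) = (\<integral>\<^sup>+\<omega>. ennreal (real CARD('n) * \<mu> $ X 0 \<omega>) * indicator (space M) \<omega> \<partial>M)"
    unfolding Pmu_def by (simp add: emeasure_density)
  also have "\<dots> = (\<integral>\<^sup>+\<omega>. ennreal (real CARD('n) * \<mu> $ X 0 \<omega>) \<partial>M)"
    by (rule nn_integral_cong) auto
  also have "\<dots> = ennreal (\<integral>\<omega>. real CARD('n) * \<mu> $ X 0 \<omega> \<partial>M)"
    using assms gX_int by (intro nn_integral_eq_integral) (auto simp: prob_vec_def)
  also have "\<dots> = 1" using assms by (simp add: expectation_X0 prob_vec_def)
  finally show "emeasure (Pmu M X \<mu>) (space (Pmu M X \<mu>)) = 1" .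
qed

lemma AE_Pmu: "AE \<omega> in M. P \<omega> \<Longrightarrow> AE \<omega> in Pmu M X \<mu>. P \<omega>"
proof -
  have "(\<lambda>\<omega>. ennreal (real CARD('n) * \<mu> $ X 0 \<omega>)) \<in> borel_measurable M"
    by (intro measurable_compose[OF _ measurable_ennreal] borel_measurable_times gX_meas[OF X_meas] borel_measurable_const)
  then show "AE \<omega> in M. P \<omega> \<Longrightarrow> AE \<omega> in Pmu M X \<mu>. P \<omega>"
    unfolding Pmu_def by (simp add: AE_density) (erule eventually_mono, simp)
qed

lemma Pmu_uniform: "Pmu M X (\<chi> x. 1 / real CARD('n)) = M"
  by (simp add: Pmu_def density_1)

lemma stable_imp_unobservable_decay:
  assumes stable: "filter_stable M h X W"
    and \<rho>: "\<And>g. g \<in> ctrl_subspace A h \<Longrightarrow> \<rho> \<bullet> g = 0"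
  shows "((\<lambda>t. \<rho> \<bullet> (trans_mat A t *v f)) \<longlongrightarrow> 0) at_top"
proof -
  define d where "d = real CARD('n)"
  have d: "d > 0" unfolding d_def by simp
  \<comment> \<open>Small enough for \<open>\<nu> + \<epsilon> *\<^sub>R \<rho>\<close> to stay
    nonnegative, as each entry of \<open>\<nu>\<close> is \<open>1 / d\<close>; the added 1 covers
    \<open>\<rho> = 0\<close>.\<close>
  define \<epsilon> where "\<epsilon> = 1 / (d * (norm \<rho> + 1))"
  have \<epsilon>: "\<epsilon> > 0" unfolding \<epsilon>_def using d by (simp add: add_nonneg_pos)
  define \<nu> :: "real^'n" where "\<nu> = (\<chi> x. 1 / d)"
  define \<mu> where "\<mu> = \<nu> + \<epsilon> *\<^sub>R \<rho>"
  have \<nu>p: "prob_vec \<nu>" unfolding prob_vec_def \<nu>_def d_def by simp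
  have "\<rho> \<bullet> 1 = 0" by (rule \<rho>[OF one_in_ctrl])
  then have s0: "(\<Sum>x\<in>UNIV. \<rho> $ x) = 0" by (simp add: inner_vec_def)
  have "\<epsilon> * \<bar>\<rho> $ x\<bar> \<le> 1 / d" for x
  proof -
    have "\<epsilon> * \<bar>\<rho> $ x\<bar> \<le> \<epsilon> * (norm \<rho> + 1)"
      using \<epsilon> component_le_norm_cart[of \<rho> x] by (intro mult_left_mono) auto
    also have "\<dots> = 1 / d"
      unfolding \<epsilon>_def using d norm_ge_zero[of \<rho>] by (simp add: field_simps add_nonneg_eq_0_iff)
    finally show ?thesis .
  qed
  then have "0 \<le> \<mu> $ x" for x
    using \<epsilon> abs_le_D2[of "\<epsilon> * \<rho> $ x"] by (simp add: \<mu>_def \<nu>_def abs_mult) (smt (verit))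
  then have \<mu>p: "prob_vec \<mu>"
    using \<nu>p s0 unfolding prob_vec_def \<mu>_def by (simp add: sum.distrib sum_distrib_left[symmetric])
  have ac: "abs_cont \<mu> \<nu>" unfolding abs_cont_def \<nu>_def using d by simp
  interpret P: prob_space "Pmu M X \<mu>" by (rule Pmu_prob_space[OF \<mu>p])
  define D where "D t \<omega> = filt M h X W \<mu> t f \<omega> - filt M h X W \<nu> t f \<omega>" for t \<omega>
  have lim: "((\<lambda>t. \<integral>\<omega>. (D t \<omega>)\<^sup>2 \<partial>Pmu M X \<mu>) \<longlongrightarrow> 0) at_top"
    using stable \<mu>p \<nu>p ac unfolding filter_stable_def D_def by blast
  \<comment> \<open>The squared mean of \<open>D t\<close> is at most its mean square, which
    stability sends to 0.\<close>
  have key: "(\<epsilon> * (\<rho> \<bullet> (trans_mat A t *v f)))\<^sup>2 \<le> (\<integral>\<omega>. (D t \<omega>)\<^sup>2 \<partial>Pmu M X \<mu>)" if t: "0 \<le> t" for t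
  proof -
    let ?O = "obs_sigma M h X W t"
    let ?f = "\<lambda>\<omega>. f $ X t \<omega>"
    have fm [measurable]: "?f \<in> borel_measurable M" by (rule gX_meas[OF X_meas])
    have [measurable]: "?f \<in> borel_measurable (Pmu M X \<mu>)" using fm by (simp add: Pmu_def)
    interpret S: sigma_finite_subalgebra M ?O by (rule sigma_finite_subalg[OF sub_obs])
    interpret SP: sigma_finite_subalgebra "Pmu M X \<mu>" ?O
      by (rule P.sigma_finite_subalg[OF subalgebra_Pmu[OF sub_obs]])
    have fn: "filt M h X W \<nu> t f = real_cond_exp M ?O ?f"
      unfolding filt_def \<nu>_def d_def Pmu_uniform ..
    have fmu: "filt M h X W \<mu> t f = real_cond_exp (Pmu M X \<mu>) ?O ?f"
      unfolding filt_def ..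
    have fi: "integrable (Pmu M X \<mu>) ?f"
      by (rule P.integrable_bounded[OF _ gX_bound]) simp
    have b1: "AE \<omega> in Pmu M X \<mu>. \<bar>filt M h X W \<mu> t f \<omega>\<bar> \<le> norm f"
      unfolding fmu by (rule P.real_cond_exp_abs_le[OF subalgebra_Pmu[OF sub_obs] _ gX_bound]) simp
    have b2M: "AE \<omega> in M. \<bar>filt M h X W \<nu> t f \<omega>\<bar> \<le> norm f"
      unfolding fn by (rule real_cond_exp_abs_le[OF sub_obs fm gX_bound])
    note b2 = AE_Pmu[OF b2M, of \<mu>]
    have m1: "filt M h X W \<mu> t f \<in> borel_measurable ?O" unfolding fmu by measurable
    have m2: "filt M h X W \<nu> t f \<in> borel_measurable ?O" unfolding fn by measurable
    have mM [measurable]: "filt M h X W \<mu> t f \<in> borel_measurable M" "filt M h X W \<nu> t f \<in> borel_measurable M"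
      using m1 m2 sub_obs measurable_from_subalg by blast+
    then have mP [measurable]: "filt M h X W \<mu> t f \<in> borel_measurable (Pmu M X \<mu>)"
      "filt M h X W \<nu> t f \<in> borel_measurable (Pmu M X \<mu>)" by (simp_all add: Pmu_def)
    have i1: "integrable (Pmu M X \<mu>) (filt M h X W \<mu> t f)"
      by (rule P.integrable_const_bound[where B="norm f"]) (use b1 in auto)
    have i2: "integrable (Pmu M X \<mu>) (filt M h X W \<nu> t f)"
      by (rule P.integrable_const_bound[where B="norm f"]) (use b2 in auto)
    have e1: "(\<integral>\<omega>. filt M h X W \<mu> t f \<omega> \<partial>Pmu M X \<mu>) = \<mu> \<bullet> (trans_mat A t *v f)"
    proof -
      have "(\<integral>\<omega>. filt M h X W \<mu> t f \<omega> \<partial>Pmu M X \<mu>) = (\<integral>\<omega>. ?f \<omega> \<partial>Pmu M X \<mu>)"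
        unfolding fmu by (rule SP.real_cond_exp_int(2)[OF fi])
      also have "\<dots> = (\<integral>\<omega>. (real CARD('n) *\<^sub>R \<mu>) $ X 0 \<omega> * f $ X t \<omega> \<partial>M)"
        by (simp add: Pmu_integral[OF fm \<mu>p])
      also have "\<dots> = \<mu> \<bullet> (trans_mat A t *v f)"
        by (subst expectation_initial_weight[OF t]) simp
      finally show ?thesis .
    qed
    \<comment> \<open>The \<open>\<nu>\<close>-filter is a function of the observation, so the
      density 1 + d \<epsilon> \<rho>(X_0) acts on it like 1, and its mean is the one under the
      reference law.\<close>
    have e2: "(\<integral>\<omega>. filt M h X W \<nu> t f \<omega> \<partial>Pmu M X \<mu>) = \<nu> \<bullet> (trans_mat A t *v f)"
    proof -
      \<comment> \<open>Truncation makes the almost everywhere bound on the filter hold everywhere,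
        as testing against \<open>\<rho>\<close> requires.\<close>
      define N where "N \<omega> = max (- norm f) (min (norm f) (filt M h X W \<nu> t f \<omega>))" for \<omega>
      have Nb: "\<bar>N \<omega>\<bar> \<le> norm f" for \<omega> unfolding N_def by (simp add: abs_le_iff max_def min_def)
      have NO: "N \<in> borel_measurable ?O" unfolding N_def using m2 by measurable
      have NM [measurable]: "N \<in> borel_measurable M" using NO sub_obs measurable_from_subalg by blast
      have NM2 [measurable]: "N \<in> borel_measurable (Pmu M X \<mu>)" using NM by (simp add: Pmu_def)
      have eqM: "AE \<omega> in M. filt M h X W \<nu> t f \<omega> = N \<omega>"
        using b2M by eventually_elim (auto simp: N_def)
      have Ni: "integrable M N" by (rule integrable_bounded[OF NM Nb])
      have "(\<integral>\<omega>. filt M h X W \<nu> t f \<omega> \<partial>Pmu M X \<mu>) = (\<integral>\<omega>. N \<omega> \<partial>Pmu M X \<mu>)"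
        by (rule integral_cong_AE) (use AE_Pmu[OF eqM] in auto)
      also have "\<dots> = (\<integral>\<omega>. N \<omega> + d * \<epsilon> * (N \<omega> * \<rho> $ X 0 \<omega>) \<partial>M)"
        unfolding Pmu_integral[OF NM \<mu>p]
        by (rule Bochner_Integration.integral_cong) (use d in \<open>auto simp: \<mu>_def \<nu>_def d_def[symmetric] field_simps\<close>)
      also have "\<dots> = (\<integral>\<omega>. N \<omega> \<partial>M) + d * \<epsilon> * (\<integral>\<omega>. N \<omega> * \<rho> $ X 0 \<omega> \<partial>M)"
        using Ni integrable_bounded_mult[OF gX_int NM Nb, of \<rho> 0] by simp
      also have "(\<integral>\<omega>. N \<omega> * \<rho> $ X 0 \<omega> \<partial>M) = 0"
        by (rule null_on_integral_mult[OF sub_obs gX_int unobservable_null_on_obs[OF \<rho> t] NO Nb])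
      also have "(\<integral>\<omega>. N \<omega> \<partial>M) = (\<integral>\<omega>. filt M h X W \<nu> t f \<omega> \<partial>M)"
        by (rule integral_cong_AE) (use eqM in auto)
      also have "\<dots> = (\<integral>\<omega>. ?f \<omega> \<partial>M)"
        unfolding fn by (rule S.real_cond_exp_int(2)[OF gX_int])
      also have "\<dots> = (\<integral>\<omega>. (\<chi> x. 1) $ X 0 \<omega> * f $ X t \<omega> \<partial>M)" by simp
      also have "\<dots> = \<nu> \<bullet> (trans_mat A t *v f)"
        unfolding expectation_initial_weight[OF t] by (simp add: \<nu>_def d_def inner_vec_def sum_divide_distrib)
      finally show ?thesis by simp
    qed
    have "(\<integral>\<omega>. D t \<omega> \<partial>Pmu M X \<mu>) = \<epsilon> * (\<rho> \<bullet> (trans_mat A t *v f))"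
      unfolding D_def using i1 i2 e1 e2 by (simp add: \<mu>_def inner_add_left)
    moreover have "(\<integral>\<omega>. D t \<omega> \<partial>Pmu M X \<mu>)\<^sup>2 \<le> (\<integral>\<omega>. (D t \<omega>)\<^sup>2 \<partial>Pmu M X \<mu>)"
    proof -
      have Di: "integrable (Pmu M X \<mu>) (D t)" unfolding D_def using i1 i2 by simp
      have "AE \<omega> in Pmu M X \<mu>. norm ((D t \<omega>)\<^sup>2) \<le> (2 * norm f)\<^sup>2"
        using b1 b2
      proof eventually_elim
        case (elim \<omega>)
        then have "\<bar>D t \<omega>\<bar> \<le> 2 * norm f" unfolding D_def by linarith
        from power_mono[OF this abs_ge_zero, of 2] show ?case by simp
      qed
      moreover have "(\<lambda>\<omega>. (D t \<omega>)\<^sup>2) \<in> borel_measurable (Pmu M X \<mu>)" unfolding D_def by measurable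
      ultimately have "integrable (Pmu M X \<mu>) (\<lambda>\<omega>. (D t \<omega>)\<^sup>2)"
        by (intro P.integrable_const_bound[where B="(2 * norm f)\<^sup>2"])
      then show ?thesis using P.variance_positive[of "D t"] P.variance_eq[OF Di] by simp
    qed
    ultimately show ?thesis by simp
  qed
  have "((\<lambda>t. (\<epsilon> * (\<rho> \<bullet> (trans_mat A t *v f)))\<^sup>2) \<longlongrightarrow> 0) at_top"
    by (rule tendsto_sandwich[OF _ _ tendsto_const lim])
      (auto intro!: eventually_mono[OF eventually_ge_at_top[of 0]] key)
  from tendsto_real_sqrt[OF this] have "((\<lambda>t. \<bar>\<epsilon> * (\<rho> \<bullet> (trans_mat A t *v f))\<bar>) \<longlongrightarrow> 0) at_top" by simp
  then have "((\<lambda>t. \<epsilon> * (\<rho> \<bullet> (trans_mat A t *v f))) \<longlongrightarrow> 0) at_top" by (rule tendsto_rabs_zero_cancel)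
  from tendsto_mult[OF tendsto_const[of "1/\<epsilon>"] this] show ?thesis using \<epsilon> by simp
qed

lemma stable_imp_stabilizable: "filter_stable M h X W \<Longrightarrow> stabilizable A h"
  unfolding stabilizable_def
  using quotient_eigenvalue_neg[OF stable_imp_unobservable_decay] by blast

end

section \<open>Estimation of controllable functions from the observation\<close>

lemma abs_sin_minus_le: "\<bar>sin x - x\<bar> \<le> x\<^sup>2" for x :: real
proof -
  have "\<bar>sin x - (\<Sum>m<2. sin_coeff m * x ^ m)\<bar> \<le> inverse (fact 2) * \<bar>x\<bar> ^ 2"
    by (rule Maclaurin_sin_bound)
  moreover have "(\<Sum>m<2. sin_coeff m * x ^ m) = x"
    by (simp add: numeral_2_eq_2 sin_coeff_def)
  ultimately show ?thesis by (simp add: fact_numeral) (smt (verit) zero_le_power2)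
qed

text \<open>Real and imaginary part of the Gaussian characteristic function.\<close>

lemma std_normal_cos_sin:
  "(\<integral>x. std_normal_density x * cos (t * x) \<partial>lborel) = exp (- t\<^sup>2 / 2)"
  "(\<integral>x. std_normal_density x * sin (t * x) \<partial>lborel) = 0"
proof -
  interpret N: real_distribution std_normal_distribution by (rule real_dist_normal_dist)
  have c: "(CLINT x|std_normal_distribution. iexp (t * x)) = complex_of_real (exp (- t\<^sup>2 / 2))"
    using char_std_normal_distribution unfolding char_def fun_eq_iff by blast
  have i: "integrable std_normal_distribution (\<lambda>x. iexp (t * x))"
    by (rule N.integrable_const_bound[where B=1]) auto
  have "(\<integral>x. cos (t * x) \<partial>std_normal_distribution) = exp (- t\<^sup>2 / 2)"
    using arg_cong[OF c, of Re] integral_Re[OF i] by (simp add: Re_exp)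
  moreover have "(\<integral>x. sin (t * x) \<partial>std_normal_distribution) = 0"
    using arg_cong[OF c, of Im] integral_Im[OF i] by (simp add: Im_exp)
  ultimately show "(\<integral>x. std_normal_density x * cos (t * x) \<partial>lborel) = exp (- t\<^sup>2 / 2)"
    "(\<integral>x. std_normal_density x * sin (t * x) \<partial>lborel) = 0"
    by (simp_all add: integral_density)
qed

section \<open>Trigonometric moments of the noise, joint pasts, and the signal over short
  windows\<close>

context wonham
begin

lemma brownian_cos_sin:
  assumes "0 \<le> s" "0 < \<delta>"
  shows "(\<integral>\<omega>. cos (W (s + \<delta>) \<omega> - W s \<omega>) \<partial>M) = exp (- (R * \<delta>) / 2)"
    "(\<integral>\<omega>. sin (W (s + \<delta>) \<omega> - W s \<omega>) \<partial>M) = 0"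
proof -
  define \<sigma> where "\<sigma> = sqrt (R * \<delta>)"
  have \<sigma>: "\<sigma> > 0" "\<sigma>\<^sup>2 = R * \<delta>" using assms R_pos by (auto simp: \<sigma>_def)
  have "distributed M lborel (\<lambda>\<omega>. W (s + \<delta>) \<omega> - W s \<omega>) (\<lambda>x. ennreal (normal_density 0 \<sigma> x))"
    using W_distr[of s "s + \<delta>"] assms by (simp add: \<sigma>_def)
  then have d: "distributed M lborel (\<lambda>\<omega>. (W (s + \<delta>) \<omega> - W s \<omega> - 0) / \<sigma>) (\<lambda>x. ennreal (std_normal_density x))"
    by (rule normal_standard_normal_convert[OF \<sigma>(1), THEN iffD1])
  show "(\<integral>\<omega>. cos (W (s + \<delta>) \<omega> - W s \<omega>) \<partial>M) = exp (- (R * \<delta>) / 2)"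
    using distributed_integral[OF d, of "\<lambda>x. cos (\<sigma> * x)"] \<sigma> std_normal_cos_sin(1)[of \<sigma>] by simp
  show "(\<integral>\<omega>. sin (W (s + \<delta>) \<omega> - W s \<omega>) \<partial>M) = 0"
    using distributed_integral[OF d, of "\<lambda>x. sin (\<sigma> * x)"] \<sigma> std_normal_cos_sin(2)[of \<sigma>] by simp
qed

lemma sub_Filt: "subalgebra M (Filt s)"
  unfolding Filt_def by (rule subalgebra_join_sigma_least[OF sub_aug_FX(1) sub_aug_FX(1) sub_FW])

lemma sub_Filt_aug: "subalgebra (Filt s) (ae_augment M (FX s))" "subalgebra (Filt s) (FW s)"
  unfolding Filt_def using subalgebra_join_sigma[OF sub_aug_FX(1) sub_FW] by auto

lemma Filt_mono: "s \<le> t \<Longrightarrow> subalgebra (Filt t) (Filt s)"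
  unfolding Filt_def[of s]
  by (rule subalgebra_join_sigma_least[OF sub_aug_FX(1)
        subalgebra_trans[OF sub_Filt_aug(1) ae_augment_mono[OF sub_FX FX_mono]]
        subalgebra_trans[OF sub_Filt_aug(2) FW_mono]])

lemma Filt_sub_FWall: "subalgebra (join_sigma M (ae_augment M (FX s)) FWall) (Filt s)"
  unfolding Filt_def
  by (rule subalgebra_join_sigma_least[OF sub_aug_FX(1) subalgebra_join_sigma(1)[OF sub_aug_FX(1) sub_FWall]
        subalgebra_trans[OF subalgebra_join_sigma(2)[OF sub_aug_FX(1) sub_FWall] sub_FWall_FW]])

lemma Filt_sub_FXall: "subalgebra (join_sigma M (ae_augment M FXall) (FW s)) (Filt s)"
  unfolding Filt_def
  by (rule subalgebra_join_sigma_least[OF sub_aug_FX(1)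
        subalgebra_trans[OF subalgebra_join_sigma(1)[OF sub_aug_FXall(1) sub_FW] ae_augment_mono[OF sub_FXall sub_FXall_FX]]
        subalgebra_join_sigma(2)[OF sub_aug_FXall(1) sub_FW]])

lemma X_Filt: "0 \<le> r \<Longrightarrow> r \<le> s \<Longrightarrow> X r \<in> measurable (Filt s) (count_space UNIV)"
  by (rule measurable_from_subalg[OF subalgebra_trans[OF sub_Filt_aug(1) sub_aug_FX(2)] X_FX])

lemma obs_Filt: "subalgebra (Filt t) (obs_sigma M h X W t)"
  unfolding obs_sigma_def
proof (rule subalgebra_gen_sigma)
  fix f assume "f \<in> obs h X W ` {0..t}"
  then obtain r where r: "f = obs h X W r" "0 \<le> r" "r \<le> t" by auto
  show "f \<in> borel_measurable (Filt t)"
    unfolding r(1) Filt_def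
    by (rule obs_join_sigma[OF sub_FX _ r(2) sub_FW]) (use r in \<open>auto intro!: gX_meas X_FX W_FW\<close>)
qed (simp add: Filt_def)

text \<open>Given the state at \<open>s\<close>, an equal state at \<open>s + r\<close> has as
  probability a diagonal entry of exp(rA), close to 1 for small \<open>r\<close>. Time homogeneity
  and finiteness of the state space make \<open>\<delta>0\<close> independent of
  \<open>s\<close>.\<close>

lemma jump_prob_small:
  assumes "\<epsilon> > 0"
  shows "\<exists>\<delta>0>0. \<forall>s\<ge>0. \<forall>r\<in>{0..\<delta>0}. prob {\<omega>\<in>space M. X (s + r) \<omega> \<noteq> X s \<omega>} \<le> \<epsilon>"
proof -
  let ?P = "\<lambda>r j. (trans_mat A r *v axis j 1) $ j"
  have "eventually (\<lambda>r. \<forall>j\<in>UNIV. dist (?P r j) (axis j 1 $ j) < \<epsilon>) (at 0)"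
    by (intro eventually_ball_finite ballI tendstoD[OF trans_mat_nth_tendsto_0] assms) simp
  then obtain d where d: "d > 0" "\<And>r j. r \<noteq> 0 \<Longrightarrow> dist r 0 < d \<Longrightarrow> dist (?P r j) (axis j 1 $ j) < \<epsilon>"
    unfolding eventually_at by auto
  have P: "?P r j \<ge> 1 - \<epsilon>" if "r \<in> {0..d/2}" for r j
  proof (cases "r = 0")
    case True
    then show ?thesis using assms by simp
  next
    case False
    then show ?thesis using d(2)[of r j] that d(1) by (simp add: dist_real_def)
  qed
  have "prob {\<omega>\<in>space M. X (s + r) \<omega> \<noteq> X s \<omega>} \<le> \<epsilon>" if s: "s \<ge> 0" and r: "r \<in> {0..d/2}" for s r
  proof -
    define E where "E = {\<omega>\<in>space M. X (s + r) \<omega> = X s \<omega>}"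
    have E: "E \<in> sets M" unfolding E_def by measurable
    have ii: "integrable M (\<lambda>\<omega>. (axis j 1 :: real^'n) $ X s \<omega> * g $ X t \<omega>)" for j g t
      by (rule integrable_bounded_mult[where c="norm (axis j 1 :: real^'n)"])
        (rule gX_int gX_meas[OF X_meas] gX_bound)+
    \<comment> \<open>The sum over \<open>j\<close> picks the diagonal entry at the current state;
      moved forward by \<open>markov\<close>, it becomes the indicator of equal states at
      \<open>s\<close> and \<open>s + r\<close>.\<close>
    let ?S = "\<integral>\<omega>. (\<Sum>j\<in>UNIV. axis j 1 $ X s \<omega> * (trans_mat A r *v axis j 1) $ X s \<omega>) \<partial>M"
    have "(\<integral>\<omega>. 1 - \<epsilon> \<partial>M) \<le> ?S"
    proof (rule integral_mono)
      fix \<omega>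
      have "(\<Sum>j\<in>UNIV. axis j 1 $ X s \<omega> * (trans_mat A r *v axis j 1) $ X s \<omega>) = ?P r (X s \<omega>)"
        by (simp add: axis_def if_distrib if_distribR sum.delta cong: if_cong)
      then show "1 - \<epsilon> \<le> (\<Sum>j\<in>UNIV. axis j 1 $ X s \<omega> * (trans_mat A r *v axis j 1) $ X s \<omega>)"
        using P[OF r, of "X s \<omega>"] by simp
    qed (use ii in auto)
    moreover have "?S = prob E"
    proof -
      have "?S = (\<Sum>j\<in>UNIV. \<integral>\<omega>. axis j 1 $ X s \<omega> * (trans_mat A (s + r - s) *v axis j 1) $ X s \<omega> \<partial>M)"
        using ii by (subst Bochner_Integration.integral_sum) auto
      also have "\<dots> = (\<Sum>j\<in>UNIV. \<integral>\<omega>. axis j 1 $ X s \<omega> * axis j 1 $ X (s + r) \<omega> \<partial>M)"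
        by (rule sum.cong[OF refl], rule markov[symmetric, OF _ _ FX_join gX_bound])
          (use s r in \<open>auto intro!: gX_meas X_FX\<close>)
      also have "\<dots> = (\<integral>\<omega>. (\<Sum>j\<in>UNIV. axis j 1 $ X s \<omega> * axis j 1 $ X (s + r) \<omega>) \<partial>M)"
        using ii by (subst Bochner_Integration.integral_sum) auto
      also have "\<dots> = (\<integral>\<omega>. indicator E \<omega> \<partial>M)"
      proof (rule Bochner_Integration.integral_cong[OF refl])
        fix \<omega> assume "\<omega> \<in> space M"
        have "axis j 1 $ X s \<omega> * axis j 1 $ X (s + r) \<omega>
          = (if j = X s \<omega> then (if X (s + r) \<omega> = X s \<omega> then 1 else 0) else (0::real))" for j
          by (auto simp: axis_def)
        then have "(\<Sum>j\<in>UNIV. axis j 1 $ X s \<omega> * axis j 1 $ X (s + r) \<omega>)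
          = (if X (s + r) \<omega> = X s \<omega> then 1 else (0::real))"
          by (simp only: sum.delta finite UNIV_I if_True)
        then show "(\<Sum>j\<in>UNIV. axis j 1 $ X s \<omega> * axis j 1 $ X (s + r) \<omega>) = indicat_real E \<omega>"
          using \<open>\<omega> \<in> space M\<close> by (simp add: E_def)
      qed
      also have "(\<integral>\<omega>. indicator E \<omega> \<partial>M) = prob E" using E by simp
      finally show ?thesis .
    qed
    ultimately have "1 - \<epsilon> \<le> prob E" by (simp add: prob_space)
    moreover have "{\<omega>\<in>space M. X (s + r) \<omega> \<noteq> X s \<omega>} = space M - E" by (auto simp: E_def)
    ultimately show ?thesis using prob_compl[OF E] by simp
  qed
  then show ?thesis using d(1) by (intro exI[of _ "d/2"]) auto
qed

lemma path_meas: "\<omega> \<in> space M \<Longrightarrow> (\<lambda>s. (g::real^'n) $ X s \<omega>) \<in> borel_measurable lborel"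
  using measurable_compose[OF measurable_Pair2'[of \<omega> M lborel] gX_joint] by simp

lemma I_diff:
  assumes "\<omega> \<in> space M" "0 \<le> s" "0 \<le> \<delta>"
  shows "I (s + \<delta>) \<omega> - I s \<omega> = (LINT r:{s..s+\<delta>}|lborel. h $ X r \<omega>)"
proof -
  have e: "{0..s+\<delta>} = {0..s} \<union> {s..s+\<delta>}" using assms by auto
  have "AE r in lborel. r \<noteq> s" by (rule AE_lborel_singleton)
  then have "AE r in lborel. \<not> (r \<in> {0..s} \<and> r \<in> {s..s+\<delta>})" by eventually_elim auto
  then show ?thesis
    unfolding I_def e
    by (subst set_integral_Un_AE) (auto intro!: set_integrable_bounded_path[OF path_meas[OF assms(1)] gX_bound])
qed

text \<open>Two errors arise. Replacing sin x by x costs at most the squared signal increment, which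
  is of order \<delta> after division by \<delta>. Freezing the signal at \<open>s\<close> costs
  only where the state at \<open>r\<close> or at \<open>s + \<delta>\<close> differs from that at
  \<open>s\<close>. Both bounds are uniform in \<open>s\<close>.\<close>

lemma increment_approximates_product:
  fixes g :: "real^'n"
  assumes "\<epsilon> > 0"
  shows "\<exists>\<delta>>0. \<forall>s\<ge>0. (\<integral>\<omega>. \<bar>sin (I (s + \<delta>) \<omega> - I s \<omega>) / \<delta> * g $ X (s + \<delta>) \<omega> - (g * h) $ X s \<omega>\<bar> \<partial>M) \<le> \<epsilon>"
proof -
  define b where "b = norm h"
  define c where "c = norm g"
  have bc: "b \<ge> 0" "c \<ge> 0" by (simp_all add: b_def c_def)
  \<comment> \<open>The freezing error is at most \<open>4 * b * c * \<eta>\<close>, from two jump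
    events and the bound \<open>2 * b * c\<close> on \<open>Y\<close>; its share is \<epsilon>/2.
    The added 1 keeps the denominator positive.\<close>
  define \<eta> where "\<eta> = \<epsilon> / (8 * (b * c + 1))"
  have \<eta>: "\<eta> > 0" using assms bc by (simp add: \<eta>_def add_nonneg_pos)
  obtain \<delta>0 where \<delta>0: "\<delta>0 > 0" "\<And>s r. s \<ge> 0 \<Longrightarrow> r \<in> {0..\<delta>0} \<Longrightarrow> prob {\<omega>\<in>space M. X (s + r) \<omega> \<noteq> X s \<omega>} \<le> \<eta>"
    using jump_prob_small[OF \<eta>] by blast
  \<comment> \<open>The second entry of the minimum keeps the sine error b^2 c \<delta> below
    \<epsilon>/2.\<close>
  define \<delta> where "\<delta> = min \<delta>0 (\<epsilon> / (2 * (b\<^sup>2 * c + 1)))"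
  have pos: "b\<^sup>2 * c + 1 > 0" using bc by (simp add: add_nonneg_pos)
  have \<delta>: "\<delta> > 0" "\<delta> \<le> \<delta>0" using assms \<delta>0(1) pos by (auto simp: \<delta>_def)
  have \<delta>1: "b\<^sup>2 * c * \<delta> \<le> \<epsilon> / 2"
  proof -
    have "b\<^sup>2 * c * \<delta> \<le> (b\<^sup>2 * c + 1) * \<delta>" using \<delta> by (simp add: algebra_simps)
    also have "\<dots> \<le> (b\<^sup>2 * c + 1) * (\<epsilon> / (2 * (b\<^sup>2 * c + 1)))"
      using pos by (intro mult_left_mono) (auto simp: \<delta>_def)
    also have "\<dots> = \<epsilon> / 2" using pos by (metis less_irrefl mult.commute mult_divide_mult_cancel_right times_divide_eq_left mult.left_neutral nonzero_mult_div_cancel_right divide_divide_eq_left)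
    finally show ?thesis .
  qed
  have \<eta>1: "4 * b * c * \<eta> \<le> \<epsilon> / 2"
  proof -
    have "4 * b * c * \<eta> \<le> 4 * (b * c + 1) * \<eta>" using \<eta> by (simp add: algebra_simps)
    also have "\<dots> = \<epsilon> / 2" using bc by (simp add: \<eta>_def add_nonneg_eq_0_iff field_simps)
    finally show ?thesis .
  qed
  have "(\<integral>\<omega>. \<bar>sin (I (s + \<delta>) \<omega> - I s \<omega>) / \<delta> * g $ X (s + \<delta>) \<omega> - (g * h) $ X s \<omega>\<bar> \<partial>M) \<le> \<epsilon>" if s: "s \<ge> 0" for s
  proof -
    let ?D = "\<lambda>\<omega>. I (s + \<delta>) \<omega> - I s \<omega>"
    define Y where "Y r \<omega> = \<bar>h $ X r \<omega> * g $ X (s + \<delta>) \<omega> - (g * h) $ X s \<omega>\<bar>" for r \<omega>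
    have [measurable]: "(\<lambda>\<omega>. g $ X t \<omega>) \<in> borel_measurable M" "(\<lambda>\<omega>. h $ X t \<omega>) \<in> borel_measurable M" for t
      by (rule gX_meas[OF X_meas])+
    have hj [measurable]: "(\<lambda>(r, \<omega>). h $ X r \<omega>) \<in> borel_measurable (lborel \<Otimes>\<^sub>M M)" by (rule gX_joint)
    have Yj: "(\<lambda>(r, \<omega>). Y r \<omega>) \<in> borel_measurable (lborel \<Otimes>\<^sub>M M)"
      unfolding Y_def by simp measurable
    have hb: "\<bar>h $ X t \<omega>\<bar> \<le> b" and gb: "\<bar>g $ X t \<omega>\<bar> \<le> c" for t \<omega>
      unfolding b_def c_def by (rule gX_bound)+
    have pb: "\<bar>h $ X t \<omega> * g $ X t' \<omega>\<bar> \<le> b * c" for t t' \<omega>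
      unfolding abs_mult using hb gb bc by (intro mult_mono) auto
    have Yb: "\<bar>Y r \<omega>\<bar> \<le> 2 * b * c" for r \<omega>
    proof -
      have "\<bar>(g * h) $ X s \<omega>\<bar> \<le> b * c" using pb[of s \<omega> s] by (simp add: mult.commute)
      then show ?thesis using pb[of r \<omega> "s + \<delta>"] unfolding Y_def by linarith
    qed
    have Db: "\<bar>?D \<omega>\<bar> \<le> b * \<delta>" if "\<omega> \<in> space M" for \<omega>
      unfolding I_diff[OF that s less_imp_le[OF \<delta>(1)]]
      using set_integral_path_bound[OF path_meas[OF that] hb, of s "s + \<delta>"] \<delta> by simp
    \<comment> \<open>Division by \<open>\<delta>\<close> turns the quadratic sine error into a
      linear one, and the freezing error into the average of \<open>Y\<close> over the
      window.\<close>
    have pt: "\<bar>sin (?D \<omega>) / \<delta> * g $ X (s + \<delta>) \<omega> - (g * h) $ X s \<omega>\<bar>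
        \<le> b\<^sup>2 * c * \<delta> + (1 / \<delta>) * (LINT r:{s..s+\<delta>}|lborel. Y r \<omega>)" if w: "\<omega> \<in> space M" for \<omega>
    proof -
      have path: "(\<lambda>r. h $ X r \<omega>) \<in> borel_measurable lborel" by (rule path_meas[OF w])
      let ?y = "\<lambda>r. h $ X r \<omega> * g $ X (s + \<delta>) \<omega>"
      have yi: "set_integrable lborel {s..s+\<delta>} ?y"
        by (rule set_integrable_bounded_path[OF _ pb]) (use path in measurable)
      have ci: "set_integrable lborel {s..s+\<delta>} (\<lambda>_. (g * h) $ X s \<omega>)"
        by (rule set_integrable_bounded_path[where c="\<bar>(g * h) $ X s \<omega>\<bar>"]) auto
      have "?D \<omega> * g $ X (s + \<delta>) \<omega> - \<delta> * (g * h) $ X s \<omega>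
        = (LINT r:{s..s+\<delta>}|lborel. ?y r) - (LINT r:{s..s+\<delta>}|lborel. (g * h) $ X s \<omega>)"
        unfolding I_diff[OF w s less_imp_le[OF \<delta>(1)]] using \<delta> by (simp add: set_integral_const)
      also have "\<dots> = (LINT r:{s..s+\<delta>}|lborel. ?y r - (g * h) $ X s \<omega>)"
        by (rule set_integral_diff(2)[symmetric, OF yi ci])
      finally have "\<bar>?D \<omega> * g $ X (s + \<delta>) \<omega> - \<delta> * (g * h) $ X s \<omega>\<bar> \<le> (LINT r:{s..s+\<delta>}|lborel. Y r \<omega>)"
        using set_integral_norm_bound[OF set_integral_diff(1)[OF yi ci]] by (simp add: Y_def)
      then have 1: "(1/\<delta>) * \<bar>?D \<omega> * g $ X (s + \<delta>) \<omega> - \<delta> * (g * h) $ X s \<omega>\<bar> \<le> (1/\<delta>) * (LINT r:{s..s+\<delta>}|lborel. Y r \<omega>)"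
        using \<delta> by (intro mult_left_mono) auto
      have "\<bar>sin (?D \<omega>) - ?D \<omega>\<bar> \<le> (b * \<delta>)\<^sup>2"
        using abs_sin_minus_le[of "?D \<omega>"] power_mono[OF Db[OF w] abs_ge_zero, of 2] by simp
      then have "\<bar>sin (?D \<omega>) - ?D \<omega>\<bar> * \<bar>g $ X (s + \<delta>) \<omega>\<bar> \<le> (b * \<delta>)\<^sup>2 * c"
        using gb bc by (intro mult_mono) auto
      then have "(1/\<delta>) * \<bar>(sin (?D \<omega>) - ?D \<omega>) * g $ X (s + \<delta>) \<omega>\<bar> \<le> (1/\<delta>) * ((b * \<delta>)\<^sup>2 * c)"
        using \<delta> unfolding abs_mult by (intro mult_left_mono) auto
      also have "\<dots> = b\<^sup>2 * c * \<delta>" using \<delta> by (simp add: power2_eq_square)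
      finally have 2: "(1/\<delta>) * \<bar>(sin (?D \<omega>) - ?D \<omega>) * g $ X (s + \<delta>) \<omega>\<bar> \<le> b\<^sup>2 * c * \<delta>" .
      have "sin (?D \<omega>) / \<delta> * g $ X (s + \<delta>) \<omega> - (g * h) $ X s \<omega>
        = (1/\<delta>) * ((sin (?D \<omega>) - ?D \<omega>) * g $ X (s + \<delta>) \<omega>) + (1/\<delta>) * (?D \<omega> * g $ X (s + \<delta>) \<omega> - \<delta> * (g * h) $ X s \<omega>)"
        using \<delta> by (simp add: field_simps)
      then have "\<bar>sin (?D \<omega>) / \<delta> * g $ X (s + \<delta>) \<omega> - (g * h) $ X s \<omega>\<bar>
        \<le> (1/\<delta>) * \<bar>(sin (?D \<omega>) - ?D \<omega>) * g $ X (s + \<delta>) \<omega>\<bar> + (1/\<delta>) * \<bar>?D \<omega> * g $ X (s + \<delta>) \<omega> - \<delta> * (g * h) $ X s \<omega>\<bar>"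
        using \<delta> abs_triangle_ineq[of "(1/\<delta>) * ((sin (?D \<omega>) - ?D \<omega>) * g $ X (s + \<delta>) \<omega>)"
            "(1/\<delta>) * (?D \<omega> * g $ X (s + \<delta>) \<omega> - \<delta> * (g * h) $ X s \<omega>)"]
        unfolding abs_mult[of "1/\<delta>"] by simp
      then show ?thesis by (rule order_trans[OF _ add_mono[OF 2 1]])
    qed
    have Jm: "(\<lambda>\<omega>. LINT r:{s..s+\<delta>}|lborel. Y r \<omega>) \<in> borel_measurable M"
      by (rule set_integral_time_measurable[OF Yj])
    have Ypath: "(\<lambda>r. Y r \<omega>) \<in> borel_measurable lborel" if "\<omega> \<in> space M" for \<omega>
      using measurable_compose[OF measurable_Pair2'[OF that, of lborel] Yj] by simp
    have Ji: "integrable M (\<lambda>\<omega>. LINT r:{s..s+\<delta>}|lborel. Y r \<omega>)"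
      by (rule integrable_bounded[OF Jm set_integral_path_bound[OF Ypath Yb]]) (use \<delta> in auto)
    have EY: "(\<integral>\<omega>. Y r \<omega> \<partial>M) \<le> 4 * b * c * \<eta>" if r: "r \<in> {s..s+\<delta>}" for r
    proof -
      let ?N = "\<lambda>t. {\<omega>\<in>space M. X t \<omega> \<noteq> X s \<omega>}"
      have [measurable]: "?N t \<in> sets M" for t by measurable
      have Ym: "Y r \<in> borel_measurable M"
        using measurable_compose[OF measurable_Pair1'[of r lborel M] Yj] by simp
      have "(\<integral>\<omega>. Y r \<omega> \<partial>M) \<le> (\<integral>\<omega>. 2 * b * c * (indicator (?N r) \<omega> + indicator (?N (s + \<delta>)) \<omega>) \<partial>M)"
      proof (rule integral_mono)
        show "integrable M (Y r)" by (rule integrable_bounded[OF Ym Yb])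
        show "integrable M (\<lambda>\<omega>. 2 * b * c * (indicator (?N r) \<omega> + indicator (?N (s + \<delta>)) \<omega>))"
          by (rule integrable_bounded[where c="4 * b * c"]) (use bc in \<open>auto simp: indicator_def\<close>)
        show "Y r \<omega> \<le> 2 * b * c * (indicator (?N r) \<omega> + indicator (?N (s + \<delta>)) \<omega>)" if "\<omega> \<in> space M" for \<omega>
        proof (cases "X r \<omega> = X s \<omega> \<and> X (s + \<delta>) \<omega> = X s \<omega>")
          case True
          then show ?thesis using bc by (simp add: Y_def mult.commute)
        next
          case False
          have "2 * b * c * 1 \<le> 2 * b * c * (indicator (?N r) \<omega> + indicator (?N (s + \<delta>)) \<omega>)"
            using False that bc by (intro mult_left_mono) (auto simp: indicator_def)
          then show ?thesis using Yb[of r \<omega>] by linarith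
        qed
      qed
      also have "\<dots> = 2 * b * c * (prob (?N r) + prob (?N (s + \<delta>)))"
        by (simp add: less_top[symmetric])
      also have "\<dots> \<le> 2 * b * c * (\<eta> + \<eta>)"
        using \<delta>0(2)[OF s, of "r - s"] \<delta>0(2)[OF s, of \<delta>] r \<delta> bc
        by (intro mult_left_mono add_mono) auto
      finally show ?thesis by simp
    qed
    have m [measurable]: "(\<lambda>\<omega>. (g * h) $ X s \<omega>) \<in> borel_measurable M" by (rule gX_meas[OF X_meas])
    have L: "(\<integral>\<omega>. \<bar>sin (?D \<omega>) / \<delta> * g $ X (s + \<delta>) \<omega> - (g * h) $ X s \<omega>\<bar> \<partial>M)
        \<le> (\<integral>\<omega>. b\<^sup>2 * c * \<delta> + (1 / \<delta>) * (LINT r:{s..s+\<delta>}|lborel. Y r \<omega>) \<partial>M)"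
    proof (rule integral_mono_AE')
      show "integrable M (\<lambda>\<omega>. b\<^sup>2 * c * \<delta> + (1 / \<delta>) * (LINT r:{s..s+\<delta>}|lborel. Y r \<omega>))"
        using Ji by simp
      show "AE \<omega> in M. 0 \<le> b\<^sup>2 * c * \<delta> + (1 / \<delta>) * (LINT r:{s..s+\<delta>}|lborel. Y r \<omega>)"
        by (intro AE_I2 order_trans[OF abs_ge_zero pt])
    qed (intro AE_I2 pt)
    have L2: "(\<integral>\<omega>. b\<^sup>2 * c * \<delta> + (1 / \<delta>) * (LINT r:{s..s+\<delta>}|lborel. Y r \<omega>) \<partial>M)
        = b\<^sup>2 * c * \<delta> + (1 / \<delta>) * (\<integral>\<omega>. (LINT r:{s..s+\<delta>}|lborel. Y r \<omega>) \<partial>M)"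
      using Ji by (simp add: prob_space)
    have "(\<integral>\<omega>. (LINT r:{s..s+\<delta>}|lborel. Y r \<omega>) \<partial>M) = (LINT r:{s..s+\<delta>}|lborel. (\<integral>\<omega>. Y r \<omega> \<partial>M))"
      by (rule expectation_time_integral[OF Yj Yb])
    also have "\<dots> \<le> (LINT r:{s..s+\<delta>}|lborel. 4 * b * c * \<eta>)"
    proof (rule set_integral_mono)
      have "(\<lambda>r. \<integral>\<omega>. Y r \<omega> \<partial>M) \<in> borel_measurable lborel"
        using Yj by (intro borel_measurable_lebesgue_integral) simp
      moreover have "\<bar>\<integral>\<omega>. Y r \<omega> \<partial>M\<bar> \<le> 2 * b * c" for r
      proof -
        have "\<bar>\<integral>\<omega>. Y r \<omega> \<partial>M\<bar> \<le> (\<integral>\<omega>. 2 * b * c \<partial>M)"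
          by (rule order_trans[OF integral_abs_bound integral_mono_AE'])
            (use Yb bc in auto)
        then show ?thesis by (simp add: prob_space)
      qed
      ultimately show "set_integrable lborel {s..s+\<delta>} (\<lambda>r. \<integral>\<omega>. Y r \<omega> \<partial>M)"
        by (rule set_integrable_bounded_path)
      show "set_integrable lborel {s..s+\<delta>} (\<lambda>r. 4 * b * c * \<eta>)"
        by (rule set_integrable_bounded_path[where c="\<bar>4 * b * c * \<eta>\<bar>"]) auto
    qed (rule EY)
    also have "\<dots> = 4 * b * c * \<eta> * \<delta>" using \<delta> by (simp add: set_integral_const)
    finally have "(1 / \<delta>) * (\<integral>\<omega>. (LINT r:{s..s+\<delta>}|lborel. Y r \<omega>) \<partial>M) \<le> (1 / \<delta>) * (4 * b * c * \<eta> * \<delta>)"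
      using \<delta> by (intro mult_left_mono) auto
    also have "\<dots> = 4 * b * c * \<eta>" using \<delta> by simp
    finally show ?thesis using L L2 \<delta>1 \<eta>1 by linarith
  qed
  then show ?thesis using \<delta>(1) by blast
qed

end

section \<open>Estimable functions contain the controllable subspace\<close>

context wonham
begin

text \<open>Quantifying over the test functions \<open>H\<close> says that the conditional mean of \<open>G s\<close> given the past
  of time \<open>s\<close> is within \<open>\<epsilon>\<close> of \<open>g(X\<^sub>s)\<close> in \<open>L\<^sup>1\<close>.\<close>

definition estimator :: "real^'n \<Rightarrow> real \<Rightarrow> real \<Rightarrow> real \<Rightarrow> (real \<Rightarrow> 'w \<Rightarrow> real) \<Rightarrow> bool" where
  "estimator g \<epsilon> \<tau> K G \<longleftrightarrow> 0 \<le> \<tau> \<and> 0 \<le> K \<and> (\<forall>s\<ge>0.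
     G s \<in> borel_measurable (obs_sigma M h X W (s + \<tau>)) \<and> (\<forall>\<omega>\<in>space M. \<bar>G s \<omega>\<bar> \<le> K) \<and>
     (\<forall>H. H \<in> borel_measurable (Filt s) \<longrightarrow> (\<forall>\<omega>\<in>space M. \<bar>H \<omega>\<bar> \<le> 1) \<longrightarrow>
       \<bar>\<integral>\<omega>. (G s \<omega> - g $ X s \<omega>) * H \<omega> \<partial>M\<bar> \<le> \<epsilon>))"

definition estimable :: "real^'n \<Rightarrow> bool" where
  "estimable g \<longleftrightarrow> (\<forall>\<epsilon>>0. \<exists>\<tau> K G. estimator g \<epsilon> \<tau> K G)"

lemma estimatorD:
  assumes "estimator g \<epsilon> \<tau> K G"
  shows "0 \<le> \<tau>" "0 \<le> K"
    "\<And>s. 0 \<le> s \<Longrightarrow> G s \<in> borel_measurable (obs_sigma M h X W (s + \<tau>))"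
    "\<And>s \<omega>. 0 \<le> s \<Longrightarrow> \<omega> \<in> space M \<Longrightarrow> \<bar>G s \<omega>\<bar> \<le> K"
    "\<And>s H. 0 \<le> s \<Longrightarrow> H \<in> borel_measurable (Filt s) \<Longrightarrow> (\<And>\<omega>. \<omega> \<in> space M \<Longrightarrow> \<bar>H \<omega>\<bar> \<le> 1) \<Longrightarrow>
       \<bar>\<integral>\<omega>. (G s \<omega> - g $ X s \<omega>) * H \<omega> \<partial>M\<bar> \<le> \<epsilon>"
  using assms unfolding estimator_def by auto

lemma obs_sigma_meas:
  "f \<in> borel_measurable (obs_sigma M h X W s) \<Longrightarrow> s \<le> t \<Longrightarrow> f \<in> borel_measurable (obs_sigma M h X W t)"
  using measurable_from_subalg[OF sub_obs_mono] .

lemma estimable_error_integrable: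
  fixes f H :: "'w \<Rightarrow> real" and K c :: real
  assumes "f \<in> borel_measurable (obs_sigma M h X W t)" "\<And>\<omega>. \<omega> \<in> space M \<Longrightarrow> \<bar>f \<omega>\<bar> \<le> K"
    and "H \<in> borel_measurable (Filt s)" "\<And>\<omega>. \<omega> \<in> space M \<Longrightarrow> \<bar>H \<omega>\<bar> \<le> c"
  shows "integrable M (\<lambda>\<omega>. (f \<omega> - g $ X r \<omega>) * H \<omega>)"
proof -
  have f: "f \<in> borel_measurable M" using assms(1) sub_obs measurable_from_subalg by blast
  have H: "H \<in> borel_measurable M" using assms(3) sub_Filt measurable_from_subalg by blast
  have "integrable M f" by (rule integrable_bounded[where c=K]) (use f assms(2) in auto)
  then have "integrable M (\<lambda>\<omega>. f \<omega> - g $ X r \<omega>)"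
    by (rule Bochner_Integration.integrable_diff[OF _ gX_int])
  then have "integrable M (\<lambda>\<omega>. H \<omega> * (f \<omega> - g $ X r \<omega>))"
    by (rule integrable_bounded_mult[OF _ H assms(4)])
  then show ?thesis by (simp add: mult.commute)
qed

lemma estimable_one: "estimable 1"
proof -
  have "estimator 1 \<epsilon> 0 1 (\<lambda>_ _. 1)" if "\<epsilon> > 0" for \<epsilon>
    using that unfolding estimator_def by auto
  then show ?thesis unfolding estimable_def by blast
qed

lemma estimable_add:
  assumes "estimable g" "estimable k"
  shows "estimable (g + k)"
proof (unfold estimable_def, intro allI impI)
  fix \<epsilon> :: real assume "\<epsilon> > 0"
  then have \<epsilon>: "\<epsilon> / 2 > 0" by simp
  from assms(1) \<epsilon> obtain \<tau>1 K1 G1 where "estimator g (\<epsilon> / 2) \<tau>1 K1 G1"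
    unfolding estimable_def by blast
  note 1 = estimatorD[OF this]
  from assms(2) \<epsilon> obtain \<tau>2 K2 G2 where "estimator k (\<epsilon> / 2) \<tau>2 K2 G2"
    unfolding estimable_def by blast
  note 2 = estimatorD[OF this]
  let ?G = "\<lambda>s \<omega>. G1 s \<omega> + G2 s \<omega>"
  have "?G s \<in> borel_measurable (obs_sigma M h X W (s + (\<tau>1 + \<tau>2)))" if "0 \<le> s" for s
    using obs_sigma_meas[OF 1(3)[OF that], of "s + (\<tau>1 + \<tau>2)"] obs_sigma_meas[OF 2(3)[OF that], of "s + (\<tau>1 + \<tau>2)"]
      1(1) 2(1) by (intro borel_measurable_add) auto
  moreover have "\<bar>?G s \<omega>\<bar> \<le> K1 + K2" if "0 \<le> s" "\<omega> \<in> space M" for s \<omega>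
    using 1(4)[OF that] 2(4)[OF that] by linarith
  moreover have "\<bar>\<integral>\<omega>. (?G s \<omega> - (g + k) $ X s \<omega>) * H \<omega> \<partial>M\<bar> \<le> \<epsilon>"
    if s: "0 \<le> s" and H: "H \<in> borel_measurable (Filt s)" "\<And>\<omega>. \<omega> \<in> space M \<Longrightarrow> \<bar>H \<omega>\<bar> \<le> 1" for s H
  proof -
    have "(\<integral>\<omega>. (?G s \<omega> - (g + k) $ X s \<omega>) * H \<omega> \<partial>M)
      = (\<integral>\<omega>. (G1 s \<omega> - g $ X s \<omega>) * H \<omega> + (G2 s \<omega> - k $ X s \<omega>) * H \<omega> \<partial>M)"
      by (rule Bochner_Integration.integral_cong) (auto simp: algebra_simps)
    also have "\<dots> = (\<integral>\<omega>. (G1 s \<omega> - g $ X s \<omega>) * H \<omega> \<partial>M) + (\<integral>\<omega>. (G2 s \<omega> - k $ X s \<omega>) * H \<omega> \<partial>M)"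
      by (rule Bochner_Integration.integral_add)
        (rule estimable_error_integrable[OF 1(3)[OF s] 1(4)[OF s] H], assumption+,
         rule estimable_error_integrable[OF 2(3)[OF s] 2(4)[OF s] H], assumption+)
    finally show ?thesis using 1(5)[OF s H] 2(5)[OF s H] by linarith
  qed
  ultimately have "estimator (g + k) \<epsilon> (\<tau>1 + \<tau>2) (K1 + K2) ?G"
    using 1(1,2) 2(1,2) unfolding estimator_def by auto
  then show "\<exists>\<tau> K G. estimator (g + k) \<epsilon> \<tau> K G" by blast
qed

lemma estimable_scale:
  assumes "estimable g"
  shows "estimable (a *\<^sub>R g)"
proof (unfold estimable_def, intro allI impI)
  fix \<epsilon> :: real assume "\<epsilon> > 0"
  then have \<epsilon>: "\<epsilon> / (\<bar>a\<bar> + 1) > 0" by simp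
  from assms \<epsilon> obtain \<tau> K G where "estimator g (\<epsilon> / (\<bar>a\<bar> + 1)) \<tau> K G"
    unfolding estimable_def by blast
  note 1 = estimatorD[OF this]
  let ?G = "\<lambda>s \<omega>. a * G s \<omega>"
  have "?G s \<in> borel_measurable (obs_sigma M h X W (s + \<tau>))" if "0 \<le> s" for s
    using 1(3)[OF that] by simp
  moreover have "\<bar>?G s \<omega>\<bar> \<le> \<bar>a\<bar> * K" if "0 \<le> s" "\<omega> \<in> space M" for s \<omega>
    using 1(4)[OF that] by (simp add: abs_mult mult_left_mono)
  moreover have "\<bar>\<integral>\<omega>. (?G s \<omega> - (a *\<^sub>R g) $ X s \<omega>) * H \<omega> \<partial>M\<bar> \<le> \<epsilon>"
    if s: "0 \<le> s" and H: "H \<in> borel_measurable (Filt s)" "\<And>\<omega>. \<omega> \<in> space M \<Longrightarrow> \<bar>H \<omega>\<bar> \<le> 1" for s H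
  proof -
    have "(\<integral>\<omega>. (?G s \<omega> - (a *\<^sub>R g) $ X s \<omega>) * H \<omega> \<partial>M) = (\<integral>\<omega>. a * ((G s \<omega> - g $ X s \<omega>) * H \<omega>) \<partial>M)"
      by (rule Bochner_Integration.integral_cong) (auto simp: algebra_simps)
    then have "\<bar>\<integral>\<omega>. (?G s \<omega> - (a *\<^sub>R g) $ X s \<omega>) * H \<omega> \<partial>M\<bar> = \<bar>a\<bar> * \<bar>\<integral>\<omega>. (G s \<omega> - g $ X s \<omega>) * H \<omega> \<partial>M\<bar>"
      by (simp add: abs_mult)
    also have "\<dots> \<le> (\<bar>a\<bar> + 1) * (\<epsilon> / (\<bar>a\<bar> + 1))"
      by (intro mult_mono 1(5)[OF s H]) auto
    also have "\<dots> = \<epsilon>" by (simp add: add_nonneg_eq_0_iff)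
    finally show ?thesis .
  qed
  ultimately have "estimator (a *\<^sub>R g) \<epsilon> \<tau> (\<bar>a\<bar> * K) ?G"
    using 1(1,2) unfolding estimator_def by auto
  then show "\<exists>\<tau> K G. estimator (a *\<^sub>R g) \<epsilon> \<tau> K G" by blast
qed

lemma subspace_estimable: "subspace {g. estimable g}"
  unfolding subspace_def using estimable_add estimable_scale estimable_scale[OF estimable_one, of 0] by auto

text \<open>The estimator is run \<open>\<delta>\<close> later: a test factor from the past of
  \<open>s\<close> also belongs to the past of \<open>s + \<delta>\<close>, and
  \<open>markov\<close> carries \<open>g\<close> back to \<open>s\<close>.\<close>

lemma estimable_trans_mat:
  assumes "estimable g" "0 \<le> \<delta>"
  shows "estimable (trans_mat A \<delta> *v g)"
proof (unfold estimable_def, intro allI impI)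
  fix \<epsilon> :: real assume "\<epsilon> > 0"
  from assms(1) \<open>\<epsilon> > 0\<close> obtain \<tau> K G where "estimator g \<epsilon> \<tau> K G"
    unfolding estimable_def by blast
  note 1 = estimatorD[OF this]
  let ?G = "\<lambda>s. G (s + \<delta>)"
  let ?g = "trans_mat A \<delta> *v g"
  have "?G s \<in> borel_measurable (obs_sigma M h X W (s + (\<delta> + \<tau>)))" if "0 \<le> s" for s
    using 1(3)[of "s + \<delta>"] that assms(2) by (simp add: add.assoc)
  moreover have "\<bar>?G s \<omega>\<bar> \<le> K" if "0 \<le> s" "\<omega> \<in> space M" for s \<omega>
    using 1(4)[of "s + \<delta>"] that assms(2) by simp
  moreover have "\<bar>\<integral>\<omega>. (?G s \<omega> - ?g $ X s \<omega>) * H \<omega> \<partial>M\<bar> \<le> \<epsilon>"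
    if s: "0 \<le> s" and H: "H \<in> borel_measurable (Filt s)" "\<And>\<omega>. \<omega> \<in> space M \<Longrightarrow> \<bar>H \<omega>\<bar> \<le> 1" for s H
  proof -
    have s': "0 \<le> s + \<delta>" using s assms(2) by simp
    have H': "H \<in> borel_measurable (Filt (s + \<delta>))"
      using measurable_from_subalg[OF Filt_mono H(1)] assms(2) by simp
    have HM: "H \<in> borel_measurable M" using H(1) sub_Filt measurable_from_subalg by blast
    have "(\<integral>\<omega>. H \<omega> * g $ X (s + \<delta>) \<omega> \<partial>M) = (\<integral>\<omega>. H \<omega> * (trans_mat A (s + \<delta> - s) *v g) $ X s \<omega> \<partial>M)"
      by (rule markov[OF s _ measurable_from_subalg[OF Filt_sub_FWall H(1)] H(2)]) (use assms(2) in auto)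
    then have z: "(\<integral>\<omega>. H \<omega> * g $ X (s + \<delta>) \<omega> - H \<omega> * ?g $ X s \<omega> \<partial>M) = 0"
      using integrable_bounded_mult[OF gX_int HM H(2)]
      by (subst Bochner_Integration.integral_diff) auto
    have "(\<integral>\<omega>. (?G s \<omega> - ?g $ X s \<omega>) * H \<omega> \<partial>M)
      = (\<integral>\<omega>. (?G s \<omega> - g $ X (s + \<delta>) \<omega>) * H \<omega> + (H \<omega> * g $ X (s + \<delta>) \<omega> - H \<omega> * ?g $ X s \<omega>) \<partial>M)"
      by (rule Bochner_Integration.integral_cong) (auto simp: algebra_simps)
    also have "\<dots> = (\<integral>\<omega>. (?G s \<omega> - g $ X (s + \<delta>) \<omega>) * H \<omega> \<partial>M)"
    proof (subst Bochner_Integration.integral_add)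
      show "integrable M (\<lambda>\<omega>. (?G s \<omega> - g $ X (s + \<delta>) \<omega>) * H \<omega>)"
        by (rule estimable_error_integrable[OF 1(3)[OF s'] 1(4)[OF s'] H]) assumption+
      show "integrable M (\<lambda>\<omega>. H \<omega> * g $ X (s + \<delta>) \<omega> - H \<omega> * ?g $ X s \<omega>)"
        by (intro Bochner_Integration.integrable_diff integrable_bounded_mult[OF gX_int HM H(2)])
    qed (simp add: z)
    finally show ?thesis using 1(5)[OF s' H' H(2)] by simp
  qed
  ultimately have "estimator ?g \<epsilon> (\<delta> + \<tau>) K ?G"
    using 1(1,2) assms(2) unfolding estimator_def by auto
  then show "\<exists>\<tau> K G. estimator ?g \<epsilon> \<tau> K G" by blast
qed

text \<open>The difference quotients of the semigroup at positive times are estimable, and the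
  estimable functions form a subspace of a finite-dimensional space, which is closed under
  limits.\<close>

lemma estimable_A:
  assumes "estimable g"
  shows "estimable (A *v g)"
proof -
  define f where "f n = (1 / inverse (real (Suc n))) *\<^sub>R (trans_mat A (inverse (real (Suc n))) *v g - g)" for n
  have "filterlim (\<lambda>n. inverse (real (Suc n))) (at 0) sequentially"
    using LIMSEQ_inverse_real_of_nat by (auto simp: filterlim_at)
  from filterlim_compose[OF trans_mat_mv_quotient_tendsto this] have "f \<longlonglongrightarrow> A *v g"
    unfolding f_def .
  moreover have "f n \<in> {g. estimable g}" for n
    unfolding f_def
    by (intro subspace_scale[OF subspace_estimable] subspace_diff[OF subspace_estimable])
      (use assms estimable_trans_mat[OF assms] in auto)
  ultimately have "A *v g \<in> {g. estimable g}"
    using closed_sequentially[OF closed_subspace[OF subspace_estimable]] by metis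
  then show ?thesis by simp
qed

text \<open>The Gaussian factor \<open>exp (R \<delta> / 2)\<close> is the reciprocal of the mean of \<open>cos (W\<^bsub>s+\<delta>\<^esub> - W\<^bsub>s\<^esub>)\<close>,
  so that averaging out the noise turns \<open>sin\<close> of the observed increment into \<open>sin\<close> of the signal
  increment, which is \<open>\<delta> h(X\<^sub>s)\<close> to first order.\<close>

lemma estimable_h:
  assumes "estimable g"
  shows "estimable (g * h)"
proof (unfold estimable_def, intro allI impI)
  fix \<epsilon> :: real assume "\<epsilon> > 0"
  then have "\<epsilon> / 2 > 0" by simp
  from increment_approximates_product[OF this, of g] obtain \<delta> where \<delta>: "\<delta> > 0"
    "\<And>s. 0 \<le> s \<Longrightarrow> (\<integral>\<omega>. \<bar>sin (I (s + \<delta>) \<omega> - I s \<omega>) / \<delta> * g $ X (s + \<delta>) \<omega> - (g * h) $ X s \<omega>\<bar> \<partial>M) \<le> \<epsilon> / 2"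
    by auto
  define a where "a = exp (R * \<delta> / 2) / \<delta>"
  have a: "a > 0" using \<delta> by (simp add: a_def)
  \<comment> \<open>The given estimator is multiplied by \<open>a\<close> below, so its error
    allowance is divided by \<open>a\<close>.\<close>
  have \<epsilon>a: "\<epsilon> / (2 * a) > 0" using a \<open>\<epsilon> > 0\<close> by simp
  from assms \<epsilon>a obtain \<tau> K G where "estimator g (\<epsilon> / (2 * a)) \<tau> K G"
    unfolding estimable_def by blast
  note 1 = estimatorD[OF this]
  define Z where "Z = obs h X W"
  define S where "S s \<omega> = sin (Z (s + \<delta>) \<omega> - Z s \<omega>)" for s \<omega>
  have Sb: "\<bar>S s \<omega>\<bar> \<le> 1" for s \<omega> unfolding S_def by simp
  have SO: "S s \<in> borel_measurable (obs_sigma M h X W (s + \<delta>))" if "0 \<le> s" for s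
    unfolding S_def Z_def
    by (intro measurable_compose[OF _ borel_measurable_sin] borel_measurable_diff obs_in_obs_sigma)
      (use that \<delta> in auto)
  \<comment> \<open>The sine of the observed increment supplies the factor \<open>h\<close>; the
    estimator started at the end of the window supplies the factor \<open>g\<close>.\<close>
  let ?G = "\<lambda>s \<omega>. a * (S s \<omega> * G (s + \<delta>) \<omega>)"
  have "?G s \<in> borel_measurable (obs_sigma M h X W (s + (\<delta> + \<tau>)))" if "0 \<le> s" for s
    using 1(3)[of "s + \<delta>"] obs_sigma_meas[OF SO[OF that], of "s + (\<delta> + \<tau>)"] that \<delta>(1) 1(1)
    by (intro borel_measurable_times) (auto simp: add.assoc)
  moreover have "\<bar>?G s \<omega>\<bar> \<le> a * K" if "0 \<le> s" "\<omega> \<in> space M" for s \<omega>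
  proof -
    have "\<bar>S s \<omega>\<bar> * \<bar>G (s + \<delta>) \<omega>\<bar> \<le> 1 * K"
      using 1(4)[of "s + \<delta>" \<omega>] that \<delta>(1) Sb by (intro mult_mono) auto
    then show ?thesis using a by (simp add: abs_mult)
  qed
  moreover have "\<bar>\<integral>\<omega>. (?G s \<omega> - (g * h) $ X s \<omega>) * H \<omega> \<partial>M\<bar> \<le> \<epsilon>"
    if s: "0 \<le> s" and H: "H \<in> borel_measurable (Filt s)" "\<And>\<omega>. \<omega> \<in> space M \<Longrightarrow> \<bar>H \<omega>\<bar> \<le> 1" for s H
  proof -
    define t where "t = s + \<delta>"
    have t: "0 \<le> t" "s < t" "s \<le> t" using s \<delta> by (auto simp: t_def)
    have [measurable]: "H \<in> borel_measurable M" using H(1) sub_Filt measurable_from_subalg by blast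
    have [measurable]: "S s \<in> borel_measurable M" using SO[OF s] sub_obs measurable_from_subalg by blast
    have [measurable]: "(\<lambda>\<omega>. k $ X r \<omega>) \<in> borel_measurable M" for k :: "real^'n" and r by (rule gX_meas[OF X_meas])
    have SHb: "\<bar>S s \<omega> * H \<omega>\<bar> \<le> 1" if "\<omega> \<in> space M" for \<omega>
      using mult_mono[OF Sb[of s \<omega>] H(2)[OF that]] by (simp add: abs_mult)
    \<comment> \<open>The sine belongs to the observation up to \<open>t\<close>, so together with
      \<open>H\<close> it is an admissible test factor for the estimator started at
      \<open>t\<close>.\<close>
    have SHF: "(\<lambda>\<omega>. S s \<omega> * H \<omega>) \<in> borel_measurable (Filt t)"
      using measurable_from_subalg[OF obs_Filt SO[OF s]] measurable_from_subalg[OF Filt_mono[OF t(3)] H(1)]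
      by (intro borel_measurable_times) (simp_all add: t_def)
    have i1: "integrable M (\<lambda>\<omega>. (G t \<omega> - g $ X t \<omega>) * (S s \<omega> * H \<omega>))"
      by (rule estimable_error_integrable[OF 1(3)[OF t(1)] 1(4)[OF t(1)] SHF SHb]) assumption+
    have e1: "\<bar>\<integral>\<omega>. (G t \<omega> - g $ X t \<omega>) * (S s \<omega> * H \<omega>) \<partial>M\<bar> \<le> \<epsilon> / (2 * a)"
      by (rule 1(5)[OF t(1) SHF SHb])

    define D where "D \<omega> = I t \<omega> - I s \<omega>" for \<omega>
    define B where "B \<omega> = W t \<omega> - W s \<omega>" for \<omega>
    \<comment> \<open>\<open>k\<close> looks ahead to \<open>X t\<close> but uses no noise after
      \<open>s\<close>, which is exactly what \<open>brownian_increment_indep\<close>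
      allows.\<close>
    define k where "k \<omega> = g $ X t \<omega> * H \<omega>" for \<omega>
    let ?F = "join_sigma M (ae_augment M FXall) (FW s)"
    have Ia: "I r \<in> borel_measurable (ae_augment M FXall)" if "0 \<le> r" for r
      by (rule I_ae_augment[OF sub_FXall gX_meas[OF X_FXall] that])
    have subF: "subalgebra ?F (ae_augment M FXall)"
      by (rule subalgebra_join_sigma(1)[OF sub_aug_FXall(1) sub_FW])
    have DF: "D \<in> borel_measurable ?F"
      unfolding D_def using measurable_from_subalg[OF subF Ia] s t by (intro borel_measurable_diff) auto
    have kF: "k \<in> borel_measurable ?F"
      unfolding k_def
      using measurable_from_subalg[OF subalgebra_trans[OF subF sub_aug_FXall(2)] gX_meas[OF X_FXall]]
        measurable_from_subalg[OF Filt_sub_FXall H(1)]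
      by (intro borel_measurable_times) auto
    have kb: "\<bar>k \<omega>\<bar> \<le> norm g" if "\<omega> \<in> space M" for \<omega>
      using mult_mono[OF gX_bound[of g t \<omega>] H(2)[OF that]] by (simp add: k_def abs_mult)
    have [measurable]: "k \<in> borel_measurable M" "D \<in> borel_measurable M" "B \<in> borel_measurable M"
      unfolding k_def D_def B_def by measurable
    have Skb: "\<bar>sin (D \<omega>) * k \<omega>\<bar> \<le> norm g" "\<bar>cos (D \<omega>) * k \<omega>\<bar> \<le> norm g" if "\<omega> \<in> space M" for \<omega>
      using mult_mono[OF abs_sin_le_one[of "D \<omega>"] kb[OF that]] mult_mono[OF abs_cos_le_one[of "D \<omega>"] kb[OF that]]
      by (simp_all add: abs_mult)
    have ib: "integrable M (\<lambda>\<omega>. u \<omega> * k \<omega> * v \<omega>)"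
      if [measurable]: "u \<in> borel_measurable M" "v \<in> borel_measurable M" and uv: "\<And>\<omega>. \<bar>u \<omega>\<bar> \<le> 1" "\<And>\<omega>. \<bar>v \<omega>\<bar> \<le> 1" for u v
    proof (rule integrable_bounded[where c="norm g"])
      fix \<omega> assume w: "\<omega> \<in> space M"
      have "\<bar>u \<omega>\<bar> * \<bar>k \<omega>\<bar> * \<bar>v \<omega>\<bar> \<le> 1 * norm g * 1"
        using uv kb[OF w] by (intro mult_mono) auto
      then show "\<bar>u \<omega> * k \<omega> * v \<omega>\<bar> \<le> norm g" by (simp add: abs_mult)
    qed measurable
    \<comment> \<open>The addition theorem separates signal and noise. The sine of the noise
      increment has mean 0, so only the term with its cosine survives.\<close>
    have Seq: "S s \<omega> = sin (D \<omega>) * cos (B \<omega>) + cos (D \<omega>) * sin (B \<omega>)" for \<omega>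
      unfolding S_def Z_def obs_eq D_def B_def t_def sin_add[symmetric] by (simp add: algebra_simps)
    have "(\<integral>\<omega>. S s \<omega> * k \<omega> \<partial>M) = (\<integral>\<omega>. sin (D \<omega>) * k \<omega> * cos (B \<omega>) + cos (D \<omega>) * k \<omega> * sin (B \<omega>) \<partial>M)"
      by (rule Bochner_Integration.integral_cong) (auto simp: Seq algebra_simps)
    also have "\<dots> = (\<integral>\<omega>. sin (D \<omega>) * k \<omega> * cos (B \<omega>) \<partial>M) + (\<integral>\<omega>. cos (D \<omega>) * k \<omega> * sin (B \<omega>) \<partial>M)"
      by (rule Bochner_Integration.integral_add) (rule ib; simp)+
    also have "(\<integral>\<omega>. sin (D \<omega>) * k \<omega> * cos (B \<omega>) \<partial>M) = (\<integral>\<omega>. sin (D \<omega>) * k \<omega> \<partial>M) * (\<integral>\<omega>. cos (B \<omega>) \<partial>M)"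
      unfolding B_def
      by (rule brownian_increment_indep[OF s t(2) _ abs_cos_le_one _ Skb(1)]) (use DF kF in measurable)
    also have "(\<integral>\<omega>. cos (D \<omega>) * k \<omega> * sin (B \<omega>) \<partial>M) = (\<integral>\<omega>. cos (D \<omega>) * k \<omega> \<partial>M) * (\<integral>\<omega>. sin (B \<omega>) \<partial>M)"
      unfolding B_def
      by (rule brownian_increment_indep[OF s t(2) _ abs_sin_le_one _ Skb(2)]) (use DF kF in measurable)
    also have "(\<integral>\<omega>. sin (B \<omega>) \<partial>M) = 0"
      using brownian_cos_sin(2)[OF s \<delta>(1)] by (simp add: B_def t_def)
    also have "(\<integral>\<omega>. cos (B \<omega>) \<partial>M) = exp (- (R * \<delta>) / 2)"
      using brownian_cos_sin(1)[OF s \<delta>(1)] by (simp add: B_def t_def)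
    finally have "a * (\<integral>\<omega>. S s \<omega> * k \<omega> \<partial>M) = (\<integral>\<omega>. sin (D \<omega>) * k \<omega> \<partial>M) * (a * exp (- (R * \<delta>) / 2))" by simp
    also have "a * exp (- (R * \<delta>) / 2) = 1 / \<delta>"
      unfolding a_def by (simp add: exp_minus field_simps)
    finally have e2: "a * (\<integral>\<omega>. S s \<omega> * k \<omega> \<partial>M) = (\<integral>\<omega>. sin (D \<omega>) / \<delta> * k \<omega> \<partial>M)"
      by simp

    let ?E = "\<lambda>\<omega>. sin (D \<omega>) / \<delta> * g $ X t \<omega> - (g * h) $ X s \<omega>"
    have Eb: "\<bar>?E \<omega>\<bar> \<le> norm g / \<delta> + norm (g * h)" for \<omega>
    proof -
      have "\<bar>sin (D \<omega>)\<bar> * \<bar>g $ X t \<omega>\<bar> \<le> 1 * norm g"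
        by (intro mult_mono gX_bound) auto
      then have "\<bar>sin (D \<omega>) / \<delta> * g $ X t \<omega>\<bar> \<le> norm g / \<delta>"
        using \<delta>(1) by (simp add: abs_mult divide_right_mono)
      then show ?thesis using gX_bound[of "g * h" s \<omega>] by linarith
    qed
    have Ei: "integrable M ?E" by (rule integrable_bounded[OF _ Eb]) measurable
    have EHi: "integrable M (\<lambda>\<omega>. H \<omega> * ?E \<omega>)" by (rule integrable_bounded_mult[OF Ei _ H(2)]) measurable
    have "\<bar>\<integral>\<omega>. H \<omega> * ?E \<omega> \<partial>M\<bar> \<le> (\<integral>\<omega>. \<bar>H \<omega> * ?E \<omega>\<bar> \<partial>M)" by (rule integral_abs_bound)
    also have "\<dots> \<le> (\<integral>\<omega>. \<bar>?E \<omega>\<bar> \<partial>M)"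
    proof (rule integral_mono)
      show "\<bar>H \<omega> * ?E \<omega>\<bar> \<le> \<bar>?E \<omega>\<bar>" if "\<omega> \<in> space M" for \<omega>
        using mult_right_mono[OF H(2)[OF that] abs_ge_zero[of "?E \<omega>"]] by (simp add: abs_mult)
    qed (use EHi Ei in auto)
    also have "\<dots> \<le> \<epsilon> / 2" using \<delta>(2)[OF s] by (simp add: D_def t_def)
    finally have e3: "\<bar>\<integral>\<omega>. H \<omega> * ?E \<omega> \<partial>M\<bar> \<le> \<epsilon> / 2" .
    have iSk: "integrable M (\<lambda>\<omega>. S s \<omega> * k \<omega>)"
      using ib[of "S s" "\<lambda>_. 1"] Sb by simp
    have iDk: "integrable M (\<lambda>\<omega>. sin (D \<omega>) / \<delta> * k \<omega>)"
      using ib[of "\<lambda>\<omega>. sin (D \<omega>)" "\<lambda>_. 1"] by (simp add: mult.commute)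
    have igh: "integrable M (\<lambda>\<omega>. H \<omega> * (g * h) $ X s \<omega>)"
      by (rule integrable_bounded_mult[OF gX_int _ H(2)]) measurable
    have "(\<integral>\<omega>. (?G s \<omega> - (g * h) $ X s \<omega>) * H \<omega> \<partial>M)
      = (\<integral>\<omega>. a * ((G t \<omega> - g $ X t \<omega>) * (S s \<omega> * H \<omega>)) + (a * (S s \<omega> * k \<omega>) - H \<omega> * (g * h) $ X s \<omega>) \<partial>M)"
      by (rule Bochner_Integration.integral_cong) (auto simp: k_def t_def algebra_simps)
    also have "\<dots> = a * (\<integral>\<omega>. (G t \<omega> - g $ X t \<omega>) * (S s \<omega> * H \<omega>) \<partial>M)
        + (a * (\<integral>\<omega>. S s \<omega> * k \<omega> \<partial>M) - (\<integral>\<omega>. H \<omega> * (g * h) $ X s \<omega> \<partial>M))"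
      using i1 iSk igh by (simp only: Bochner_Integration.integral_add Bochner_Integration.integral_diff
          integral_mult_right_zero integrable_mult_right Bochner_Integration.integrable_diff)
    also have "a * (\<integral>\<omega>. S s \<omega> * k \<omega> \<partial>M) - (\<integral>\<omega>. H \<omega> * (g * h) $ X s \<omega> \<partial>M)
      = (\<integral>\<omega>. sin (D \<omega>) / \<delta> * k \<omega> - H \<omega> * (g * h) $ X s \<omega> \<partial>M)"
      unfolding e2 by (rule Bochner_Integration.integral_diff[symmetric, OF iDk igh])
    also have "\<dots> = (\<integral>\<omega>. H \<omega> * ?E \<omega> \<partial>M)"
      by (rule Bochner_Integration.integral_cong) (auto simp: k_def algebra_simps)
    \<comment> \<open>Two errors remain, each at most \<epsilon>/2: that of \<open>G\<close> at
      \<open>t\<close>, amplified by \<open>a\<close>, and the short-time error of the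
      signal.\<close>
    finally have eq: "(\<integral>\<omega>. (?G s \<omega> - (g * h) $ X s \<omega>) * H \<omega> \<partial>M)
      = a * (\<integral>\<omega>. (G t \<omega> - g $ X t \<omega>) * (S s \<omega> * H \<omega>) \<partial>M) + (\<integral>\<omega>. H \<omega> * ?E \<omega> \<partial>M)" .
    have "\<bar>a * (\<integral>\<omega>. (G t \<omega> - g $ X t \<omega>) * (S s \<omega> * H \<omega>) \<partial>M)\<bar> \<le> a * (\<epsilon> / (2 * a))"
      unfolding abs_mult using a e1 by (intro mult_mono) auto
    also have "\<dots> = \<epsilon> / 2" using a by simp
    finally show ?thesis unfolding eq using e3 by linarith
  qed
  ultimately have "estimator (g * h) \<epsilon> (\<delta> + \<tau>) (a * K) ?G"
    using 1(1,2) \<delta>(1) a unfolding estimator_def by auto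
  then show "\<exists>\<tau> K G. estimator (g * h) \<epsilon> \<tau> K G" by blast
qed

lemma ctrl_estimable: "g \<in> ctrl_subspace A h \<Longrightarrow> estimable g"
  using ctrl_subspace_least[OF subspace_estimable] estimable_one estimable_A estimable_h by blast

end

section \<open>Identification of the ergodic class\<close>

context wonham
begin

text \<open>An indicator equals its square, so the mean square of g(X_t) - g(X_0) contains g(X_t)
  only linearly. There the semigroup, which fixes the kernel vector, replaces it by g(X_0), and the
  terms cancel. The exceptional null set may depend on \<open>t\<close>.\<close>

lemma X_class_invariant:
  assumes A0: "A *v (\<chi> x. indicator D x) = 0" and t: "0 \<le> t"
  shows "AE \<omega> in M. (\<chi> x. indicat_real D x) $ X t \<omega> = (\<chi> x. indicator D x) $ X 0 \<omega>"
proof -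
  define g :: "real^'n" where "g = (\<chi> x. indicator D x)"
  have P: "trans_mat A s *v g = g" for s using trans_mat_kernel_mv[OF A0] by (simp add: g_def)
  have [measurable]: "(\<lambda>\<omega>. g $ X r \<omega>) \<in> borel_measurable M" for r by (rule gX_meas[OF X_meas])
  have sq: "g $ x * g $ x = g $ x" for x by (simp add: g_def indicator_def)
  have ii: "integrable M (\<lambda>\<omega>. g $ X 0 \<omega> * g $ X t \<omega>)"
    by (rule integrable_bounded_mult[OF gX_int _ gX_bound]) measurable
  have m: "(\<integral>\<omega>. \<rho> $ X 0 \<omega> * g $ X t \<omega> \<partial>M) = (\<integral>\<omega>. \<rho> $ X 0 \<omega> * g $ X 0 \<omega> \<partial>M)" for \<rho>
    using expectation_initial_weight[OF t, of \<rho> g] expectation_initial_weight[of 0 \<rho> g] by (simp add: P)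
  have "(\<integral>\<omega>. (g $ X t \<omega> - g $ X 0 \<omega>)\<^sup>2 \<partial>M) = (\<integral>\<omega>. g $ X t \<omega> + g $ X 0 \<omega> - 2 * (g $ X 0 \<omega> * g $ X t \<omega>) \<partial>M)"
    by (rule Bochner_Integration.integral_cong) (auto simp: power2_eq_square algebra_simps sq)
  also have "\<dots> = (\<integral>\<omega>. g $ X t \<omega> \<partial>M) + (\<integral>\<omega>. g $ X 0 \<omega> \<partial>M) - 2 * (\<integral>\<omega>. g $ X 0 \<omega> * g $ X t \<omega> \<partial>M)"
    using ii gX_int by simp
  also have "\<dots> = 0" using m[of 1] m[of g] by (simp add: sq)
  finally have "(\<integral>\<omega>. (g $ X t \<omega> - g $ X 0 \<omega>)\<^sup>2 \<partial>M) = 0" .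
  moreover have "integrable M (\<lambda>\<omega>. (g $ X t \<omega> - g $ X 0 \<omega>)\<^sup>2)"
    by (rule integrable_bounded[where c=1]) (auto simp: g_def indicator_def)
  ultimately have "AE \<omega> in M. (g $ X t \<omega> - g $ X 0 \<omega>)\<^sup>2 = 0"
    by (subst (asm) integral_nonneg_eq_0_iff_AE) auto
  then show ?thesis unfolding g_def[symmetric] by simp
qed

text \<open>The statistics over disjoint blocks are, up to a small bias, uncorrelated around the invariant
  value \<open>g(X\<^sub>0)\<close>, so their averages converge to it.\<close>

lemma estimable_invariant_L1:
  assumes g: "estimable g" and inv: "\<And>t. 0 \<le> t \<Longrightarrow> AE \<omega> in M. g $ X t \<omega> = g $ X 0 \<omega>" and \<epsilon>: "\<epsilon> > 0"
  obtains T Q c where "0 \<le> T" "Q \<in> borel_measurable (obs_sigma M h X W T)" "\<And>\<omega>. \<omega> \<in> space M \<Longrightarrow> \<bar>Q \<omega>\<bar> \<le> c"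
    "(\<integral>\<omega>. \<bar>Q \<omega> - g $ X 0 \<omega>\<bar> \<partial>M) \<le> \<epsilon>"
proof -
  have "\<epsilon> / 2 > 0" using \<epsilon> by simp
  with g obtain \<tau> K G where "estimator g (\<epsilon> / 2) \<tau> K G" unfolding estimable_def by blast
  note 1 = estimatorD[OF this]
  \<comment> \<open>Blocks of length \<open>\<tau>\<close>: the statistic started at
    \<open>t n\<close> is complete when the next block starts.\<close>
  define t where "t n = real n * \<tau>" for n
  have t: "0 \<le> t n" for n using 1(1) by (simp add: t_def)
  have t_mono: "t m + \<tau> \<le> t n" if "m < n" for m n
  proof -
    have "real (Suc m) * \<tau> \<le> real n * \<tau>" using that 1(1) by (intro mult_right_mono) auto
    then show ?thesis by (simp add: t_def algebra_simps)
  qed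
  define L where "L = K + norm g"
  have L: "L \<ge> 0" using 1(2) by (simp add: L_def)
  define \<xi> where "\<xi> n \<omega> = G (t n) \<omega> - g $ X 0 \<omega>" for n \<omega>
  have gm: "(\<lambda>\<omega>. g $ X r \<omega>) \<in> borel_measurable M" for r by (rule gX_meas[OF X_meas])
  have Gm: "G (t n) \<in> borel_measurable M" for n using 1(3)[OF t] sub_obs measurable_from_subalg by blast
  have \<xi>m [measurable]: "\<xi> n \<in> borel_measurable M" for n unfolding \<xi>_def using Gm gm by measurable
  have \<xi>b: "\<bar>\<xi> n \<omega>\<bar> \<le> L" if "\<omega> \<in> space M" for n \<omega>
    using 1(4)[OF t that, of n] gX_bound[of g 0 \<omega>] unfolding \<xi>_def L_def by linarith
  have "\<exists>e. e \<in> borel_measurable (Filt (t n)) \<and> (\<forall>\<omega>. \<bar>e \<omega>\<bar> \<le> L) \<and> null_on M (Filt (t n)) (\<lambda>\<omega>. \<xi> n \<omega> - e \<omega>)" for n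
    by (rule obtain_bounded_cond_exp[OF sub_Filt \<xi>m \<xi>b]) blast+
  then obtain e where e: "\<And>n. e n \<in> borel_measurable (Filt (t n))" "\<And>n \<omega>. \<bar>e n \<omega>\<bar> \<le> L"
    "\<And>n. null_on M (Filt (t n)) (\<lambda>\<omega>. \<xi> n \<omega> - e n \<omega>)" by metis
  have em [measurable]: "e n \<in> borel_measurable M" for n using e(1) sub_Filt measurable_from_subalg by blast
  have ei: "integrable M (e n)" for n by (rule integrable_bounded[OF em e(2)])
  \<comment> \<open>\<open>e n\<close> is the conditional bias given the past of \<open>t n\<close>;
    \<open>\<eta> n\<close> is the remaining centred fluctuation.\<close>
  define \<eta> where "\<eta> n \<omega> = \<xi> n \<omega> - e n \<omega>" for n \<omega>
  have \<eta>m [measurable]: "\<eta> n \<in> borel_measurable M" for n unfolding \<eta>_def by measurable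
  have \<eta>b: "\<bar>\<eta> n \<omega>\<bar> \<le> 2 * L" if "\<omega> \<in> space M" for n \<omega>
    using \<xi>b[OF that, of n] e(2)[of n \<omega>] unfolding \<eta>_def by linarith
  have \<eta>i: "integrable M (\<eta> n)" for n by (rule integrable_bounded[OF \<eta>m \<eta>b])
  have \<eta>null: "null_on M (Filt (t n)) (\<eta> n)" for n unfolding \<eta>_def by (rule e(3))
  have e_small: "(\<integral>\<omega>. \<bar>e n \<omega>\<bar> \<partial>M) \<le> \<epsilon> / 2" for n
  proof -
    \<comment> \<open>The sign of the bias is a test factor from the past; it turns the bound on
      tested errors into an \<open>L^1\<close> bound.\<close>
    define H where "H \<omega> = sgn (e n \<omega>)" for \<omega>
    have H: "H \<in> borel_measurable (Filt (t n))" unfolding H_def using e(1)[of n] by measurable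
    have Hb: "\<bar>H \<omega>\<bar> \<le> 1" for \<omega> by (simp add: H_def sgn_real_def)
    have HM [measurable]: "H \<in> borel_measurable M" using H sub_Filt measurable_from_subalg by blast
    have "(\<integral>\<omega>. \<bar>e n \<omega>\<bar> \<partial>M) = (\<integral>\<omega>. H \<omega> * \<xi> n \<omega> - H \<omega> * \<eta> n \<omega> \<partial>M)"
      by (rule Bochner_Integration.integral_cong) (auto simp: H_def \<eta>_def sgn_real_def algebra_simps)
    also have "\<dots> = (\<integral>\<omega>. H \<omega> * \<xi> n \<omega> \<partial>M) - (\<integral>\<omega>. H \<omega> * \<eta> n \<omega> \<partial>M)"
      by (intro Bochner_Integration.integral_diff integrable_bounded_mult[OF _ HM Hb] \<eta>i integrable_bounded[OF \<xi>m \<xi>b])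
    also have "(\<integral>\<omega>. H \<omega> * \<eta> n \<omega> \<partial>M) = 0"
      by (rule null_on_integral_mult[OF sub_Filt \<eta>i \<eta>null H Hb])
    also have "(\<integral>\<omega>. H \<omega> * \<xi> n \<omega> \<partial>M) = (\<integral>\<omega>. (G (t n) \<omega> - g $ X (t n) \<omega>) * H \<omega> \<partial>M)"
    proof (rule integral_cong_AE)
      show "AE \<omega> in M. H \<omega> * \<xi> n \<omega> = (G (t n) \<omega> - g $ X (t n) \<omega>) * H \<omega>"
        using inv[OF t, of n] by eventually_elim (simp add: \<xi>_def)
    qed (use Gm gm in measurable)
    finally show ?thesis using 1(5)[OF t H Hb] by (simp add: abs_le_iff)
  qed
  \<comment> \<open>The value g(X_0) is not observed, but \<open>Filt\<close> contains the signal
    and therefore knows it.\<close>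
  have past: "\<eta> m \<in> borel_measurable (Filt (t n))" if "m < n" for m n
  proof -
    have "G (t m) \<in> borel_measurable (Filt (t n))"
      using measurable_from_subalg[OF obs_Filt obs_sigma_meas[OF 1(3)[OF t] t_mono[OF that]]] .
    moreover have "(\<lambda>\<omega>. g $ X 0 \<omega>) \<in> borel_measurable (Filt (t n))"
      by (rule gX_meas[OF X_Filt]) (use t in auto)
    moreover have "e m \<in> borel_measurable (Filt (t n))"
      using measurable_from_subalg[OF Filt_mono e(1)] t_mono[OF that] 1(1) by auto
    ultimately show ?thesis unfolding \<eta>_def \<xi>_def by measurable
  qed
  define S where "S N \<omega> = (\<Sum>n<N. \<eta> n \<omega>)" for N \<omega>
  have Sm [measurable]: "S N \<in> borel_measurable M" for N unfolding S_def by measurable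
  have Sb: "\<bar>S N \<omega>\<bar> \<le> real N * (2 * L)" if "\<omega> \<in> space M" for N \<omega>
    unfolding S_def
    using sum_bounded_above[of "{..<N}" "\<lambda>n. \<bar>\<eta> n \<omega>\<bar>" "2 * L"] \<eta>b[OF that]
    by (intro order_trans[OF sum_abs]) simp
  have Si: "integrable M (S N)" for N by (rule integrable_bounded[OF Sm Sb])
  have S2i: "integrable M (\<lambda>\<omega>. (S N \<omega>)\<^sup>2)" for N
    unfolding power2_eq_square by (rule integrable_bounded_mult[OF Si Sm Sb])
  have \<eta>2i: "integrable M (\<lambda>\<omega>. (\<eta> n \<omega>)\<^sup>2)" for n
    unfolding power2_eq_square by (rule integrable_bounded_mult[OF \<eta>i \<eta>m \<eta>b])
  \<comment> \<open>Orthogonality: \<open>\<eta> N\<close> has conditional mean 0 given the past,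
    for which \<open>S N\<close> is measurable, so cross terms vanish; each square is at most
    (2L)^2.\<close>
  have S2: "(\<integral>\<omega>. (S N \<omega>)\<^sup>2 \<partial>M) \<le> real N * (4 * L\<^sup>2)" for N
  proof (induction N)
    case 0
    then show ?case by (simp add: S_def)
  next
    case (Suc N)
    have S_past: "S N \<in> borel_measurable (Filt (t N))"
      unfolding S_def by (intro borel_measurable_sum past) auto
    have c0: "(\<integral>\<omega>. S N \<omega> * \<eta> N \<omega> \<partial>M) = 0"
      by (rule null_on_integral_mult[OF sub_Filt \<eta>i \<eta>null S_past Sb])
    have ci: "integrable M (\<lambda>\<omega>. S N \<omega> * \<eta> N \<omega>)"
      by (rule integrable_bounded_mult[OF \<eta>i Sm Sb])
    have "(\<integral>\<omega>. (S (Suc N) \<omega>)\<^sup>2 \<partial>M) = (\<integral>\<omega>. (S N \<omega>)\<^sup>2 + 2 * (S N \<omega> * \<eta> N \<omega>) + (\<eta> N \<omega>)\<^sup>2 \<partial>M)"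
      by (rule Bochner_Integration.integral_cong) (auto simp: S_def power2_eq_square algebra_simps)
    also have "\<dots> = (\<integral>\<omega>. (S N \<omega>)\<^sup>2 \<partial>M) + 2 * (\<integral>\<omega>. S N \<omega> * \<eta> N \<omega> \<partial>M) + (\<integral>\<omega>. (\<eta> N \<omega>)\<^sup>2 \<partial>M)"
      using S2i ci \<eta>2i by simp
    also have "(\<integral>\<omega>. (\<eta> N \<omega>)\<^sup>2 \<partial>M) \<le> (\<integral>\<omega>. 4 * L\<^sup>2 \<partial>M)"
    proof (rule integral_mono[OF \<eta>2i])
      fix \<omega> assume "\<omega> \<in> space M"
      from power_mono[OF \<eta>b[OF this] abs_ge_zero, of N 2] show "(\<eta> N \<omega>)\<^sup>2 \<le> 4 * L\<^sup>2"
        by (simp add: power_mult_distrib)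
    qed simp
    finally show ?case using Suc c0 by (simp add: prob_space algebra_simps)
  qed
  define \<kappa> where "\<kappa> = \<epsilon> / 2"
  have \<kappa>: "\<kappa> > 0" using \<epsilon> by (simp add: \<kappa>_def)
  \<comment> \<open>The second moment of S_N / N is at most 4 L^2 / N, which has to be at most
    \<kappa>^2.\<close>
  obtain N0 :: nat where N0: "4 * L\<^sup>2 / \<kappa>\<^sup>2 \<le> real N0" using real_arch_simple by blast
  define N where "N = Suc N0"
  have N: "real N > 0" "4 * L\<^sup>2 \<le> \<kappa>\<^sup>2 * real N"
  proof -
    have "4 * L\<^sup>2 \<le> \<kappa>\<^sup>2 * real N0" using N0 \<kappa> by (simp add: field_simps)
    also have "\<dots> \<le> \<kappa>\<^sup>2 * real N" by (intro mult_left_mono) (auto simp: N_def)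
    finally show "4 * L\<^sup>2 \<le> \<kappa>\<^sup>2 * real N" .
  qed (simp add: N_def)
  have S_small: "(\<integral>\<omega>. \<bar>S N \<omega>\<bar> / real N \<partial>M) \<le> \<kappa>"
  proof -
    \<comment> \<open>Young's inequality, passing from the second moment to the first.\<close>
    have am: "\<bar>x\<bar> \<le> \<kappa> / 2 + x\<^sup>2 / (2 * \<kappa>)" for x
    proof -
      have "0 \<le> (\<bar>x\<bar> - \<kappa>)\<^sup>2" by simp
      then have "2 * \<kappa> * \<bar>x\<bar> \<le> \<kappa>\<^sup>2 + x\<^sup>2" by (simp add: power2_eq_square algebra_simps)
      then show ?thesis using \<kappa> by (simp add: field_simps power2_eq_square)
    qed
    have "(\<integral>\<omega>. \<bar>S N \<omega>\<bar> / real N \<partial>M) \<le> (\<integral>\<omega>. \<kappa> / 2 + (S N \<omega>)\<^sup>2 / (2 * \<kappa> * (real N)\<^sup>2) \<partial>M)"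
    proof (rule integral_mono)
      show "\<bar>S N \<omega>\<bar> / real N \<le> \<kappa> / 2 + (S N \<omega>)\<^sup>2 / (2 * \<kappa> * (real N)\<^sup>2)" for \<omega>
        using am[of "S N \<omega> / real N"] by (simp add: power_divide mult.commute)
    qed (use Si[of N] S2i[of N] in auto)
    also have "\<dots> = \<kappa> / 2 + (\<integral>\<omega>. (S N \<omega>)\<^sup>2 \<partial>M) / (2 * \<kappa> * (real N)\<^sup>2)"
      using S2i[of N] by (simp add: prob_space)
    also have "\<dots> \<le> \<kappa> / 2 + (real N * (\<kappa>\<^sup>2 * real N)) / (2 * \<kappa> * (real N)\<^sup>2)"
      using order_trans[OF S2[of N] mult_left_mono[OF N(2), of "real N"]] \<kappa> N(1)
      by (intro add_left_mono divide_right_mono) auto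
    also have "\<dots> = \<kappa>" using \<kappa> N(1) by (simp add: field_simps power2_eq_square)
    finally show ?thesis .
  qed
  define Q where "Q \<omega> = (\<Sum>n<N. G (t n) \<omega>) / real N" for \<omega>
  have "Q \<in> borel_measurable (obs_sigma M h X W (t N))"
    unfolding Q_def
    by (intro borel_measurable_divide borel_measurable_sum borel_measurable_const
        obs_sigma_meas[OF 1(3)[OF t] t_mono]) auto
  moreover have "\<bar>Q \<omega>\<bar> \<le> K" if "\<omega> \<in> space M" for \<omega>
  proof -
    have "\<bar>\<Sum>n<N. G (t n) \<omega>\<bar> \<le> real N * K"
      using sum_bounded_above[of "{..<N}" "\<lambda>n. \<bar>G (t n) \<omega>\<bar>" K] 1(4)[OF t that]
      by (intro order_trans[OF sum_abs]) simp
    then show ?thesis using N(1) unfolding Q_def by (simp add: field_simps)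
  qed
  moreover have "(\<integral>\<omega>. \<bar>Q \<omega> - g $ X 0 \<omega>\<bar> \<partial>M) \<le> \<epsilon>"
  proof -
    have "(\<integral>\<omega>. \<bar>Q \<omega> - g $ X 0 \<omega>\<bar> \<partial>M) \<le> (\<integral>\<omega>. \<bar>S N \<omega>\<bar> / real N + (\<Sum>n<N. \<bar>e n \<omega>\<bar>) / real N \<partial>M)"
    proof (rule integral_mono_AE')
      show "integrable M (\<lambda>\<omega>. \<bar>S N \<omega>\<bar> / real N + (\<Sum>n<N. \<bar>e n \<omega>\<bar>) / real N)"
        using Si[of N] ei by auto
      show "AE \<omega> in M. \<bar>Q \<omega> - g $ X 0 \<omega>\<bar> \<le> \<bar>S N \<omega>\<bar> / real N + (\<Sum>n<N. \<bar>e n \<omega>\<bar>) / real N"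
      proof (rule AE_I2)
        fix \<omega>
        have "Q \<omega> - g $ X 0 \<omega> = (S N \<omega> + (\<Sum>n<N. e n \<omega>)) / real N"
          using N(1) by (simp add: Q_def S_def \<eta>_def \<xi>_def sum_subtractf sum.distrib field_simps)
        moreover have "\<bar>S N \<omega> + (\<Sum>n<N. e n \<omega>)\<bar> \<le> \<bar>S N \<omega>\<bar> + (\<Sum>n<N. \<bar>e n \<omega>\<bar>)"
          using sum_abs[of "\<lambda>n. e n \<omega>" "{..<N}"] by linarith
        ultimately show "\<bar>Q \<omega> - g $ X 0 \<omega>\<bar> \<le> \<bar>S N \<omega>\<bar> / real N + (\<Sum>n<N. \<bar>e n \<omega>\<bar>) / real N"
          using N(1) by (simp add: add_divide_distrib[symmetric] divide_right_mono)
      qed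
    qed (auto intro!: sum_nonneg divide_nonneg_nonneg add_nonneg_nonneg)
    also have "\<dots> = (\<integral>\<omega>. \<bar>S N \<omega>\<bar> / real N \<partial>M) + (\<Sum>n<N. \<integral>\<omega>. \<bar>e n \<omega>\<bar> \<partial>M) / real N"
      using Si[of N] ei by simp
    also have "\<dots> \<le> \<kappa> + (real N * (\<epsilon> / 2)) / real N"
      using S_small sum_bounded_above[of "{..<N}" "\<lambda>n. \<integral>\<omega>. \<bar>e n \<omega>\<bar> \<partial>M" "\<epsilon> / 2"] e_small N(1)
      by (intro add_mono divide_right_mono) auto
    also have "\<dots> = \<epsilon>" using N(1) by (simp add: \<kappa>_def)
    finally show ?thesis .
  qed
  ultimately show thesis using that[of "t N" Q K] t by blast
qed

text \<open>The statistic \<open>Q\<close> is known from \<open>T0\<close> on, and the filter at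
  \<open>T\<close> is the conditional mean of the fixed variable g(X_0). They differ by at most the
  conditional mean of \<open>\<Phi>\<close>, which the maximal inequality controls at all later
  rational times at once; Markov's inequality compares \<open>Q\<close> with g(X_0).\<close>

lemma filt_tail_prob:
  assumes \<nu>: "prob_vec \<nu>" and g: "estimable g" and inv: "\<And>t. 0 \<le> t \<Longrightarrow> AE \<omega> in M. g $ X t \<omega> = g $ X 0 \<omega>"
    and \<kappa>: "\<kappa> > 0" and \<epsilon>: "\<epsilon> > 0"
  shows "\<exists>T0\<ge>0. measure (Pmu M X \<nu>) {\<omega>\<in>space M. \<exists>T\<in>\<rat> \<inter> {T0..}. \<bar>filt M h X W \<nu> T g \<omega> - g $ X 0 \<omega>\<bar> > \<kappa>} \<le> \<epsilon>"
proof -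
  define d where "d = real CARD('n)"
  have d: "d > 0" by (simp add: d_def)
  interpret P: prob_space "Pmu M X \<nu>" by (rule Pmu_prob_space[OF \<nu>])
  \<comment> \<open>The density of the reweighted law is at most \<open>d\<close>, and the bad event
    is covered by two events of probability at most 2 d \<epsilon>1 / \<kappa> = \<epsilon>/2
    each.\<close>
  define \<epsilon>1 where "\<epsilon>1 = \<epsilon> * \<kappa> / (4 * d)"
  have \<epsilon>1: "\<epsilon>1 > 0" using \<epsilon> \<kappa> d by (simp add: \<epsilon>1_def)
  obtain T0 Q c where T0: "0 \<le> T0" and QO: "Q \<in> borel_measurable (obs_sigma M h X W T0)"
    and Qb: "\<And>\<omega>. \<omega> \<in> space M \<Longrightarrow> \<bar>Q \<omega>\<bar> \<le> c" and Q1: "(\<integral>\<omega>. \<bar>Q \<omega> - g $ X 0 \<omega>\<bar> \<partial>M) \<le> \<epsilon>1"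
    by (rule estimable_invariant_L1[OF g inv \<epsilon>1]) blast+
  let ?P = "Pmu M X \<nu>"
  let ?O = "obs_sigma M h X W"
  have QM [measurable]: "Q \<in> borel_measurable M" using QO sub_obs measurable_from_subalg by blast
  have gm [measurable]: "(\<lambda>\<omega>. g $ X r \<omega>) \<in> borel_measurable M" for r by (rule gX_meas[OF X_meas])
  have mP: "f \<in> borel_measurable ?P \<longleftrightarrow> f \<in> borel_measurable M" for f :: "'w \<Rightarrow> real"
    by (simp add: Pmu_def)
  define \<Phi> where "\<Phi> \<omega> = \<bar>Q \<omega> - g $ X 0 \<omega>\<bar>" for \<omega>
  have \<Phi>m [measurable]: "\<Phi> \<in> borel_measurable M" unfolding \<Phi>_def by measurable
  have \<Phi>b: "\<bar>\<Phi> \<omega>\<bar> \<le> c + norm g" if "\<omega> \<in> space M" for \<omega>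
    using Qb[OF that] gX_bound[of g 0 \<omega>] unfolding \<Phi>_def by linarith
  have \<Phi>i: "integrable M \<Phi>" by (rule integrable_bounded[OF \<Phi>m \<Phi>b])
  have \<Phi>iP: "integrable ?P \<Phi>" by (rule P.integrable_bounded[where c="c + norm g"]) (use mP \<Phi>m \<Phi>b in auto)
  have \<nu>1: "\<nu> $ x \<le> 1" "0 \<le> \<nu> $ x" for x
    using \<nu> member_le_sum[of x UNIV "\<lambda>x. \<nu> $ x"] by (auto simp: prob_vec_def)
  have \<Phi>P: "(\<integral>\<omega>. \<Phi> \<omega> \<partial>?P) \<le> d * \<epsilon>1"
  proof -
    have "(\<integral>\<omega>. \<Phi> \<omega> \<partial>?P) = (\<integral>\<omega>. (d * \<nu> $ X 0 \<omega>) * \<Phi> \<omega> \<partial>M)"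
      unfolding d_def by (rule Pmu_integral[OF \<Phi>m \<nu>])
    also have "\<dots> \<le> (\<integral>\<omega>. d * \<Phi> \<omega> \<partial>M)"
    proof (rule integral_mono)
      show "integrable M (\<lambda>\<omega>. (d * \<nu> $ X 0 \<omega>) * \<Phi> \<omega>)"
        by (rule integrable_bounded_mult[OF \<Phi>i, where c=d])
          (use d \<nu>1 gX_meas[OF X_meas, of "\<lambda>x. \<nu> $ x" 0] in \<open>auto simp: abs_mult\<close>)
      show "d * \<nu> $ X 0 \<omega> * \<Phi> \<omega> \<le> d * \<Phi> \<omega>" for \<omega>
        using d \<nu>1 by (intro mult_right_mono) (auto simp: \<Phi>_def)
    qed (use \<Phi>i in auto)
    also have "\<dots> \<le> d * \<epsilon>1" using Q1 d by (simp add: \<Phi>_def)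
    finally show ?thesis .
  qed
  define J where "J = \<rat> \<inter> {T0..}"
  have J: "countable J" unfolding J_def by (simp add: countable_rat)
  have close: "AE \<omega> in ?P. \<bar>filt M h X W \<nu> T g \<omega> - Q \<omega>\<bar> \<le> real_cond_exp ?P (?O T) \<Phi> \<omega>" if T: "T \<in> J" for T
  proof -
    have T0T: "T0 \<le> T" "0 \<le> T" using T T0 by (auto simp: J_def)
    interpret F: sigma_finite_subalgebra ?P "?O T" by (rule P.sigma_finite_subalg[OF subalgebra_Pmu[OF sub_obs]])
    have QT: "Q \<in> borel_measurable (?O T)" by (rule obs_sigma_meas[OF QO T0T(1)])
    have gP: "integrable ?P (\<lambda>\<omega>. g $ X 0 \<omega>)"
      by (rule P.integrable_bounded[where c="norm g"]) (use mP gm gX_bound in auto)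
    have QP: "integrable ?P Q" by (rule P.integrable_bounded[where c=c]) (use mP QM Qb in auto)
    have "AE \<omega> in ?P. filt M h X W \<nu> T g \<omega> = real_cond_exp ?P (?O T) (\<lambda>\<omega>. g $ X 0 \<omega>) \<omega>"
      unfolding filt_def by (rule F.real_cond_exp_cong[OF AE_Pmu[OF inv[OF T0T(2)]]]) (use mP gm in auto)
    moreover have "AE \<omega> in ?P. real_cond_exp ?P (?O T) Q \<omega> = Q \<omega>"
      by (rule F.real_cond_exp_F_meas[OF QP QT])
    moreover have "AE \<omega> in ?P. real_cond_exp ?P (?O T) (\<lambda>\<omega>. g $ X 0 \<omega> - Q \<omega>) \<omega>
        = real_cond_exp ?P (?O T) (\<lambda>\<omega>. g $ X 0 \<omega>) \<omega> - real_cond_exp ?P (?O T) Q \<omega>"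
      by (rule F.real_cond_exp_diff[OF gP QP])
    moreover have "AE \<omega> in ?P. real_cond_exp ?P (?O T) (\<lambda>\<omega>. Q \<omega> - g $ X 0 \<omega>) \<omega>
        = real_cond_exp ?P (?O T) Q \<omega> - real_cond_exp ?P (?O T) (\<lambda>\<omega>. g $ X 0 \<omega>) \<omega>"
      by (rule F.real_cond_exp_diff[OF QP gP])
    moreover have "AE \<omega> in ?P. real_cond_exp ?P (?O T) (\<lambda>\<omega>. g $ X 0 \<omega> - Q \<omega>) \<omega> \<le> real_cond_exp ?P (?O T) \<Phi> \<omega>"
      by (rule F.real_cond_exp_mono) (use gP QP \<Phi>iP in \<open>auto simp: \<Phi>_def\<close>)
    moreover have "AE \<omega> in ?P. real_cond_exp ?P (?O T) (\<lambda>\<omega>. Q \<omega> - g $ X 0 \<omega>) \<omega> \<le> real_cond_exp ?P (?O T) \<Phi> \<omega>"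
      by (rule F.real_cond_exp_mono) (use gP QP \<Phi>iP in \<open>auto simp: \<Phi>_def\<close>)
    ultimately show ?thesis by eventually_elim linarith
  qed
  let ?B1 = "{\<omega>\<in>space ?P. \<exists>T\<in>J. real_cond_exp ?P (?O T) \<Phi> \<omega> > \<kappa> / 2}"
  let ?B2 = "{\<omega>\<in>space ?P. \<Phi> \<omega> \<ge> \<kappa> / 2}"
  let ?B = "{\<omega>\<in>space M. \<exists>T\<in>\<rat> \<inter> {T0..}. \<bar>filt M h X W \<nu> T g \<omega> - g $ X 0 \<omega>\<bar> > \<kappa>}"
  have condm: "real_cond_exp ?P (?O T) f \<in> borel_measurable M" for T f
    by (rule measurable_from_subalg[OF sub_obs borel_measurable_cond_exp])
  have B1m: "?B1 \<in> sets ?P"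
  proof -
    have "?B1 = (\<Union>T\<in>J. {\<omega>\<in>space M. real_cond_exp ?P (?O T) \<Phi> \<omega> > \<kappa> / 2})" by auto
    also have "\<dots> \<in> sets M"
      using condm by (intro sets.countable_UN' J) (auto intro!: borel_measurable_less)
    finally show ?thesis by simp
  qed
  have B2m: "?B2 \<in> sets ?P" using \<Phi>m by simp
  have p1: "P.prob ?B1 \<le> d * \<epsilon>1 / (\<kappa> / 2)"
  proof -
    have "P.prob ?B1 \<le> (\<integral>\<omega>. \<Phi> \<omega> \<partial>?P) / (\<kappa> / 2)"
      by (rule P.cond_exp_maximal) (use \<kappa> J \<Phi>iP in \<open>auto simp: \<Phi>_def intro: subalgebra_Pmu sub_obs sub_obs_mono\<close>)
    also have "\<dots> \<le> d * \<epsilon>1 / (\<kappa> / 2)" using \<Phi>P \<kappa> by (intro divide_right_mono) auto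
    finally show ?thesis .
  qed
  have p2: "P.prob ?B2 \<le> d * \<epsilon>1 / (\<kappa> / 2)"
  proof -
    have "P.prob ?B2 \<le> (\<integral>\<omega>. \<Phi> \<omega> \<partial>?P) / (\<kappa> / 2)"
      by (rule integral_Markov_inequality_measure[OF \<Phi>iP sets.empty_sets]) (use \<kappa> in \<open>auto simp: \<Phi>_def\<close>)
    also have "\<dots> \<le> d * \<epsilon>1 / (\<kappa> / 2)" using \<Phi>P \<kappa> by (intro divide_right_mono) auto
    finally show ?thesis .
  qed
  have "AE \<omega> in ?P. \<forall>T\<in>J. \<bar>filt M h X W \<nu> T g \<omega> - Q \<omega>\<bar> \<le> real_cond_exp ?P (?O T) \<Phi> \<omega>"
    using close by (simp add: AE_ball_countable[OF J])
  then have "AE \<omega> in ?P. \<omega> \<in> ?B \<longrightarrow> \<omega> \<in> ?B1 \<union> ?B2"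
  proof eventually_elim
    case (elim \<omega>)
    show ?case
    proof
      assume "\<omega> \<in> ?B"
      then obtain T where T: "\<omega> \<in> space M" "T \<in> J" "\<bar>filt M h X W \<nu> T g \<omega> - g $ X 0 \<omega>\<bar> > \<kappa>"
        by (auto simp: J_def)
      have "\<bar>filt M h X W \<nu> T g \<omega> - g $ X 0 \<omega>\<bar> \<le> real_cond_exp ?P (?O T) \<Phi> \<omega> + \<Phi> \<omega>"
        using elim T(2) unfolding \<Phi>_def by force
      then have "real_cond_exp ?P (?O T) \<Phi> \<omega> > \<kappa> / 2 \<or> \<Phi> \<omega> \<ge> \<kappa> / 2" using T(3) by linarith
      then show "\<omega> \<in> ?B1 \<union> ?B2" using T by auto
    qed
  qed
  then have "P.prob ?B \<le> P.prob (?B1 \<union> ?B2)"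
    by (rule P.finite_measure_mono_AE) (rule sets.Un[OF B1m B2m])
  also have "\<dots> \<le> P.prob ?B1 + P.prob ?B2" by (rule measure_Un_le[OF B1m B2m])
  also have "\<dots> \<le> d * \<epsilon>1 / (\<kappa> / 2) + d * \<epsilon>1 / (\<kappa> / 2)" using p1 p2 by linarith
  also have "\<dots> = \<epsilon>" using \<kappa> d by (simp add: \<epsilon>1_def field_simps)
  finally show ?thesis using T0 by blast
qed

text \<open>The bad events decrease as the starting time grows, and their intersection has
  probability below every positive bound.\<close>

lemma filt_converges_rat:
  assumes \<nu>: "prob_vec \<nu>" and g: "estimable g" and inv: "\<And>t. 0 \<le> t \<Longrightarrow> AE \<omega> in M. g $ X t \<omega> = g $ X 0 \<omega>"
    and \<kappa>: "\<kappa> > 0"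
  shows "AE \<omega> in Pmu M X \<nu>. \<exists>n::nat. \<forall>T\<in>\<rat> \<inter> {real n..}. \<bar>filt M h X W \<nu> T g \<omega> - g $ X 0 \<omega>\<bar> \<le> \<kappa>"
proof -
  interpret P: prob_space "Pmu M X \<nu>" by (rule Pmu_prob_space[OF \<nu>])
  define B where "B r = {\<omega>\<in>space M. \<exists>T\<in>\<rat> \<inter> {r..}. \<bar>filt M h X W \<nu> T g \<omega> - g $ X 0 \<omega>\<bar> > \<kappa>}" for r :: real
  have fm: "filt M h X W \<nu> T g \<in> borel_measurable M" for T
    unfolding filt_def by (rule measurable_from_subalg[OF sub_obs borel_measurable_cond_exp])
  have gm: "(\<lambda>\<omega>. g $ X r \<omega>) \<in> borel_measurable M" for r by (rule gX_meas[OF X_meas])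
  have Bm: "B r \<in> sets (Pmu M X \<nu>)" for r
  proof -
    have "B r = (\<Union>T\<in>\<rat> \<inter> {r..}. {\<omega>\<in>space M. \<bar>filt M h X W \<nu> T g \<omega> - g $ X 0 \<omega>\<bar> > \<kappa>})"
      by (auto simp: B_def)
    also have "\<dots> \<in> sets M"
      using fm gm by (intro sets.countable_UN' countable_Int1 countable_rat) (auto intro!: borel_measurable_less)
    finally show ?thesis by simp
  qed
  let ?N = "\<Inter>n::nat. B (real n)"
  have Nm: "?N \<in> sets (Pmu M X \<nu>)" using Bm by auto
  have "P.prob ?N \<le> \<epsilon>" if \<epsilon>: "\<epsilon> > 0" for \<epsilon>
  proof -
    obtain T0 where T0: "T0 \<ge> 0" "P.prob (B T0) \<le> \<epsilon>"
      using filt_tail_prob[OF \<nu> g inv \<kappa> \<epsilon>] unfolding B_def by blast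
    obtain n :: nat where n: "T0 \<le> real n" using real_arch_simple by blast
    have "?N \<subseteq> B T0"
    proof
      fix \<omega> assume "\<omega> \<in> ?N"
      then have "\<omega> \<in> B (real n)" by blast
      then show "\<omega> \<in> B T0" using n unfolding B_def by (auto intro: bexI)
    qed
    then have "P.prob ?N \<le> P.prob (B T0)" by (rule P.finite_measure_mono[OF _ Bm])
    then show ?thesis using T0 by linarith
  qed
  then have "P.prob ?N = 0"
    by (meson dense_ge measure_nonneg order_antisym)
  then have "AE \<omega> in Pmu M X \<nu>. \<omega> \<notin> ?N"
    using P.prob_eq_0[OF Nm] by simp
  with AE_space show ?thesis
  proof eventually_elim
    case (elim \<omega>)
    then obtain n :: nat where n: "\<omega> \<notin> B (real n)" "\<omega> \<in> space M" by auto
    then show ?case unfolding B_def by (intro exI[of _ n]) (auto simp: not_less)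
  qed
qed

text \<open>Almost sure identities survive along the countable set of rational times only.
  Continuity closes the gap: near every \<open>T\<close> there is a rational time at which
  \<open>p\<close> takes almost the same value.\<close>

lemma continuous_version_converges:
  assumes \<nu>: "prob_vec \<nu>" and g: "estimable g" and inv: "\<And>t. 0 \<le> t \<Longrightarrow> AE \<omega> in M. g $ X t \<omega> = g $ X 0 \<omega>"
    and p: "\<forall>T\<ge>0. AE \<omega> in Pmu M X \<nu>. p T \<omega> = filt M h X W \<nu> T g \<omega>"
    and cont: "AE \<omega> in Pmu M X \<nu>. continuous_on {0..} (\<lambda>T. p T \<omega>)"
  shows "AE \<omega> in Pmu M X \<nu>. ((\<lambda>T. p T \<omega>) \<longlongrightarrow> g $ X 0 \<omega>) at_top"
proof -
  have "AE \<omega> in Pmu M X \<nu>. \<forall>k::nat. \<exists>n::nat. \<forall>T\<in>\<rat> \<inter> {real n..}.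
      \<bar>filt M h X W \<nu> T g \<omega> - g $ X 0 \<omega>\<bar> \<le> inverse (real (Suc k))"
    unfolding AE_all_countable using filt_converges_rat[OF \<nu> g inv] by simp
  moreover have "AE \<omega> in Pmu M X \<nu>. \<forall>T\<in>\<rat> \<inter> {0..}. p T \<omega> = filt M h X W \<nu> T g \<omega>"
    using p by (subst AE_ball_countable) (auto intro: countable_Int1 countable_rat)
  ultimately show ?thesis using cont
  proof eventually_elim
    case (elim \<omega>)
    show ?case
    proof (rule tendstoI)
      fix r :: real assume "r > 0"
      then obtain k :: nat where k: "inverse (real (Suc k)) < r / 2" using reals_Archimedean[of "r / 2"] by auto
      obtain n :: nat where n: "\<And>T. T \<in> \<rat> \<Longrightarrow> T \<ge> real n \<Longrightarrow> \<bar>filt M h X W \<nu> T g \<omega> - g $ X 0 \<omega>\<bar> \<le> inverse (real (Suc k))"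
        using elim(1) by force
      have "dist (p T \<omega>) (g $ X 0 \<omega>) < r" if T: "T \<ge> real n" for T
      proof -
        have T': "T \<in> {0..}" using T by (simp add: order_trans[OF of_nat_0_le_iff])
        obtain \<delta> where \<delta>: "\<delta> > 0" "\<And>T'. T' \<in> {0..} \<Longrightarrow> dist T' T < \<delta> \<Longrightarrow> dist (p T' \<omega>) (p T \<omega>) < r / 2"
          using elim(3) T' \<open>r > 0\<close> unfolding continuous_on_iff by (metis half_gt_zero)
        \<comment> \<open>Taken to the right of \<open>T\<close>, so that \<open>q\<close> still
          lies beyond \<open>n\<close>.\<close>
        obtain q where q: "q \<in> \<rat>" "T < q" "q < T + \<delta>" using Rats_dense_in_real[of T "T + \<delta>"] \<delta>(1) by auto
        have "dist (p q \<omega>) (p T \<omega>) < r / 2" using q T' by (intro \<delta>(2)) (auto simp: dist_real_def)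
        moreover have "p q \<omega> = filt M h X W \<nu> q g \<omega>" using elim(2) q T' by auto
        moreover have "\<bar>filt M h X W \<nu> q g \<omega> - g $ X 0 \<omega>\<bar> \<le> inverse (real (Suc k))" using n q T by auto
        ultimately show ?thesis using k unfolding dist_real_def by linarith
      qed
      then show "eventually (\<lambda>T. dist (p T \<omega>) (g $ X 0 \<omega>) < r) at_top"
        unfolding eventually_at_top_linorder by blast
    qed
  qed
qed

text \<open>Convergence is obtained under the law started from \<open>\<nu>\<close>, where the
  \<open>\<nu>\<close>-filter is a genuine conditional expectation. The density for
  \<open>\<mu>\<close> vanishes wherever that for \<open>\<nu>\<close> does, so the almost sure
  statement transfers.\<close>

lemma AE_Pmu_abs_cont:
  assumes "prob_vec \<nu>" "abs_cont \<mu> \<nu>" "AE \<omega> in Pmu M X \<nu>. P \<omega>"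
  shows "AE \<omega> in Pmu M X \<mu>. P \<omega>"
proof -
  have m: "(\<lambda>\<omega>. ennreal (real CARD('n) * \<rho> $ X 0 \<omega>)) \<in> borel_measurable M" for \<rho> :: "real^'n"
    by (intro measurable_compose[OF _ measurable_ennreal] borel_measurable_times gX_meas[OF X_meas] borel_measurable_const)
  have "AE \<omega> in M. 0 < ennreal (real CARD('n) * \<nu> $ X 0 \<omega>) \<longrightarrow> P \<omega>"
    using assms(3) unfolding Pmu_def AE_density[OF m] .
  then have "AE \<omega> in M. 0 < ennreal (real CARD('n) * \<mu> $ X 0 \<omega>) \<longrightarrow> P \<omega>"
  proof eventually_elim
    case (elim \<omega>)
    show ?case
    proof
      assume "0 < ennreal (real CARD('n) * \<mu> $ X 0 \<omega>)"
      then have "\<mu> $ X 0 \<omega> \<noteq> 0" by (auto simp: ennreal_less_zero_iff)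
      then have "\<nu> $ X 0 \<omega> \<noteq> 0" "\<nu> $ X 0 \<omega> \<ge> 0" using assms(1,2) by (auto simp: abs_cont_def prob_vec_def)
      then have "0 < ennreal (real CARD('n) * \<nu> $ X 0 \<omega>)" by simp
      then show "P \<omega>" using elim by blast
    qed
  qed
  then show ?thesis unfolding Pmu_def AE_density[OF m] .
qed

end

text \<open>The filter at each time is a conditional expectation, fixed only up to a null set
  depending on the time. An almost sure limit over all real times is therefore stated for versions
  \<open>p\<close> with almost surely continuous paths.\<close>

theorem theorem1:
  fixes M :: "'w measure" and A :: "real^'n::finite^'n" and h :: "real^'n" and R :: real
    and X :: "real \<Rightarrow> 'w \<Rightarrow> 'n" and W :: "real \<Rightarrow> 'w \<Rightarrow> real"
  assumes "rate_matrix A"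
    and "\<forall>x. \<exists>D. ergodic_class A D \<and> x \<in> D"
    and "0 < R"
    and "wonham_model M A R X W"
  shows "(filter_stable M h X W \<longrightarrow> stabilizable A h) \<and>
    (stabilizable A h \<longrightarrow>
      (\<forall>\<mu> \<nu> D p. prob_vec \<mu> \<longrightarrow> prob_vec \<nu> \<longrightarrow> abs_cont \<mu> \<nu> \<longrightarrow> ergodic_class A D \<longrightarrow>
        (\<forall>T\<ge>0. AE \<omega> in Pmu M X \<nu>. p T \<omega> = filt M h X W \<nu> T (\<chi> x. indicator D x) \<omega>) \<longrightarrow>
        (AE \<omega> in Pmu M X \<nu>. continuous_on {0..} (\<lambda>T. p T \<omega>)) \<longrightarrow>
        (AE \<omega> in Pmu M X \<mu>. ((\<lambda>T. p T \<omega>) \<longlongrightarrow> indicator D (X 0 \<omega>)) at_top)))"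
proof -
  interpret prob_space M using assms(4) by (simp add: wonham_model_def)
  interpret wonham M A h R X W by unfold_locales (use assms in auto)
  show ?thesis
  proof (intro conjI impI allI)
    show "filter_stable M h X W \<Longrightarrow> stabilizable A h" by (rule stable_imp_stabilizable)
    fix \<mu> \<nu> :: "real^'n" and D :: "'n set" and p :: "real \<Rightarrow> 'w \<Rightarrow> real"
    assume st: "stabilizable A h" and \<nu>: "prob_vec \<nu>" and ac: "abs_cont \<mu> \<nu>" and D: "ergodic_class A D"
      and p: "\<forall>T\<ge>0. AE \<omega> in Pmu M X \<nu>. p T \<omega> = filt M h X W \<nu> T (\<chi> x. indicator D x) \<omega>"
      and cont: "AE \<omega> in Pmu M X \<nu>. continuous_on {0..} (\<lambda>T. p T \<omega>)"
    have A0: "A *v (\<chi> x. indicator D x) = 0"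
      by (rule generator_indicator_eq_0[OF assms(1,2) D])
    have est: "estimable (\<chi> x. indicator D x)"
      by (rule ctrl_estimable[OF stabilizable_kernel_in_ctrl[OF st A0]])
    have "AE \<omega> in Pmu M X \<nu>. ((\<lambda>T. p T \<omega>) \<longlongrightarrow> (\<chi> x. indicator D x) $ X 0 \<omega>) at_top"
      by (rule continuous_version_converges[OF \<nu> est X_class_invariant[OF A0] p cont])
    then show "AE \<omega> in Pmu M X \<mu>. ((\<lambda>T. p T \<omega>) \<longlongrightarrow> indicator D (X 0 \<omega>)) at_top"
      using AE_Pmu_abs_cont[OF \<nu> ac] by simp
  qed
qed

end
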